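(* Assume the standing hypotheses below (in particular, that homogeneous $f,g\in\mathfrak p$ with $\sqrt{(f,g)R}=\mathfrak p$ exist). Then every minimal prime divisor of the ideal $(f_{\min},g_{\min})R$ and every minimal prime divisor of the ideal $(f_{\max},g_{\max})R$ has height one. In particular, $f_{\min},g_{\min}$ have a non-unit common divisor in $R$, and $f_{\max},g_{\max}$ have a non-unit common divisor in $R$.
   Context: Let $k$ be an algebraically closed field of characteristic zero, $R=k[w,x,y,z]$, and let $\mathfrak p\subseteq R$ be the homogeneous prime ideal of Macaulay's curve $C_4\subseteq\mathbb P^3_k$, the curve with parametrization $[s^4:s^3t:st^3:t^4]$. Endow $R$ with the bigrading $\deg w=(4,0)$, $\deg x=(3,1)$, $\deg y=(1,3)$, $\deg z=(0,4)$; $\mathfrak p$ is bihomogeneous. Standing hypothesis: $f,g\in\mathfrak p$ are homogeneous (in the usual grading) of degrees $d_1,d_2$ with $\sqrt{(f,g)R}=\mathfrak p$. Write $f=\sum_{i=i_{\min}}^{i_{\max}} f^{(i,4d_1-i)}$ and $g=\sum_{j=j_{\min}}^{j_{\max}} g^{(j,4d_2-j)}$ as sums of bihomogeneous components, where $f^{(i,4d_1-i)}$ is the component of bidegree $(i,4d_1-i)$ and $i_{\min},i_{\max},j_{\min},j_{\max}$ are chosen so that $f_{\min}:=f^{(i_{\min},4d_1-i_{\min})}$, $f_{\max}:=f^{(i_{\max},4d_1-i_{\max})}$, $g_{\min}:=g^{(j_{\min},4d_2-j_{\min})}$, $g_{\max}:=g^{(j_{\max},4d_2-j_{\max})}$ are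 all nonzero. *)

theory Defs
  imports Main "HOL-Library.Poly_Mapping" "HOL-Library.Product_Plus"
    "HOL-Computational_Algebra.Polynomial"
begin

text \<open>A monomial w^a x^b y^c z^d is encoded by its exponent vector (a,b,c,d).
  R is the ring of finitely supported coefficient functions on monomials, with
  convolution product (library instance: a commutative ring with 1).\<close>

type_synonym mon4 = "nat \<times> nat \<times> nat \<times> nat"
type_synonym 'k poly4 = "mon4 \<Rightarrow>\<^sub>0 'k"

definition alg_closed :: "'k::field itself \<Rightarrow> bool" where
  "alg_closed _ \<longleftrightarrow> (\<forall>p::'k poly. 0 < degree p \<longrightarrow> (\<exists>a. poly p a = 0))"

definition eval4 :: "'k::comm_ring_1 poly4 \<Rightarrow> 'k \<Rightarrow> 'k \<Rightarrow> 'k \<Rightarrow> 'k \<Rightarrow> 'k" where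
  "eval4 f w x y z =
     (\<Sum>m\<in>Poly_Mapping.keys f. Poly_Mapping.lookup f m * (case m of (a,b,c,d) \<Rightarrow> w^a * x^b * y^c * z^d))"

text \<open>Homogeneous prime ideal of Macaulay's curve C4 = {[s^4 : s^3 t : s t^3 : t^4]}:
  the polynomials vanishing on the affine cone over the curve.\<close>
definition macaulay_ideal :: "'k::comm_ring_1 poly4 set" where
  "macaulay_ideal = {f. \<forall>s t. eval4 f (s^4) (s^3 * t) (s * t^3) (t^4) = 0}"

fun tdeg :: "mon4 \<Rightarrow> nat" where
  "tdeg (a,b,c,d) = a + b + c + d"

fun bideg1 :: "mon4 \<Rightarrow> nat" where
  "bideg1 (a,b,c,d) = 4*a + 3*b + c"

fun bideg2 :: "mon4 \<Rightarrow> nat" where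
  "bideg2 (a,b,c,d) = b + 3*c + 4*d"

definition homogeneous4 :: "'k::zero poly4 \<Rightarrow> nat \<Rightarrow> bool" where
  "homogeneous4 f n \<longleftrightarrow> (\<forall>m\<in>Poly_Mapping.keys f. tdeg m = n)"

text \<open>Bihomogeneous component of f of bidegree (i, 4n - i) for homogeneous f of degree n:
  the part of f supported on monomials with first bidegree i.\<close>
lift_definition bicomp :: "'k::zero poly4 \<Rightarrow> nat \<Rightarrow> 'k poly4" is
  "\<lambda>f i m. if bideg1 m = i then f m else 0"
  by (erule finite_subset[rotated]) auto

definition comp_min :: "'k::zero poly4 \<Rightarrow> 'k poly4" where
  "comp_min f = bicomp f (Min (bideg1 ` Poly_Mapping.keys f))"

definition comp_max :: "'k::zero poly4 \<Rightarrow> 'k poly4" where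
  "comp_max f = bicomp f (Max (bideg1 ` Poly_Mapping.keys f))"

definition is_ideal :: "'a::comm_ring_1 set \<Rightarrow> bool" where
  "is_ideal I \<longleftrightarrow> 0 \<in> I \<and> (\<forall>a\<in>I. \<forall>b\<in>I. a + b \<in> I) \<and> (\<forall>r. \<forall>a\<in>I. r * a \<in> I)"

definition ideal_gen :: "'a::comm_ring_1 set \<Rightarrow> 'a set" where
  "ideal_gen S = \<Inter>{I. is_ideal I \<and> S \<subseteq> I}"

definition radical :: "'a::comm_ring_1 set \<Rightarrow> 'a set" where
  "radical I = {a. \<exists>n. a ^ n \<in> I}"

definition prime_ideal :: "'a::comm_ring_1 set \<Rightarrow> bool" where
  "prime_ideal P \<longleftrightarrow> is_ideal P \<and> P \<noteq> UNIV \<and> (\<forall>a b. a * b \<in> P \<longrightarrow> a \<in> P \<or> b \<in> P)"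

definition minimal_prime_over :: "'a::comm_ring_1 set \<Rightarrow> 'a set \<Rightarrow> bool" where
  "minimal_prime_over I P \<longleftrightarrow> prime_ideal P \<and> I \<subseteq> P \<and>
     (\<forall>Q. prime_ideal Q \<and> I \<subseteq> Q \<and> Q \<subseteq> P \<longrightarrow> Q = P)"

definition prime_chain_to :: "'a::comm_ring_1 set \<Rightarrow> nat \<Rightarrow> bool" where
  "prime_chain_to P n \<longleftrightarrow> (\<exists>Q :: nat \<Rightarrow> 'a set.
     (\<forall>i\<le>n. prime_ideal (Q i)) \<and> (\<forall>i<n. Q i \<subset> Q (Suc i)) \<and> Q n = P)"

definition height_eq :: "'a::comm_ring_1 set \<Rightarrow> nat \<Rightarrow> bool" where
  "height_eq P n \<longleftrightarrow> prime_chain_to P n \<and> \<not> prime_chain_to P (Suc n)"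

end

theory Submission
  imports Defs "Berlekamp_Zassenhaus.Unique_Factorization_Poly" "Jordan_Normal_Form.Determinant"
    "HOL-Library.Product_Lexorder"
begin

text \<open>
  Write \<open>f\<^sub>0, g\<^sub>0\<close> for the lowest components and \<open>h\<close> for their greatest common divisor,
  \<open>f\<^sub>0 = h f\<^sub>1\<close> and \<open>g\<^sub>0 = h g\<^sub>1\<close>; the highest components are the lowest ones for the opposite
  grading. The point is that \<open>h\<close> vanishes on the curve. Then a power of \<open>h\<close> lies in \<open>(f, g)\<close>, and since
  the only relations between \<open>f\<^sub>1\<close> and \<open>g\<^sub>1\<close> are the Koszul relations, a further multiple by a power of
  \<open>h\<close> lies in \<open>(f\<^sub>0, g\<^sub>0)\<close>. So every minimal prime of \<open>(f\<^sub>0, g\<^sub>0)\<close> contains \<open>h\<close>, hence a prime factor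
  \<open>q\<close> of \<open>h\<close>, hence equals \<open>(q)\<close>.

  Suppose \<open>h\<close> does not vanish on the curve. The ideal of lowest components of \<open>(f, g)\<close> has the Hilbert
  function of \<open>(f, g)\<close> and agrees with \<open>(f\<^sub>1, g\<^sub>1)\<close> up to a bounded dimension in each degree, because
  modulo \<open>h\<close> and powers of elements of the prime ideal the graded pieces of the polynomial ring have
  bounded dimension. Hence \<open>deg f deg g \<le> deg f\<^sub>1 deg g\<^sub>1\<close> and \<open>h\<close> is constant. Now
  \<open>x\<^sup>4 - w\<^sup>3z\<close>, \<open>y\<^sup>4 - wz\<^sup>3\<close> and \<open>xy - wz\<close> are nilpotent modulo \<open>(f\<^sub>0, g\<^sub>0)\<close>, and bihomogeneity
  forces, up to scalars and order, \<open>f\<^sub>0 = y\<^sup>c + z\<^sup>2(\<dots>)\<close> and \<open>g\<^sub>0 = x\<^sup>m + w\<^sup>2(\<dots>)\<close>. The quotient by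
  \<open>(f\<^sub>0, g\<^sub>0)\<close> is free over \<open>k[w,z]\<close> on the monomials \<open>x\<^sup>by\<^sup>e\<close> with \<open>b < m\<close>, \<open>e < c\<close>. Multiplication
  by \<open>1 + xy - wz\<close> is invertible on it, so its determinant is constant; but modulo \<open>(w\<^sup>2, z\<^sup>2)\<close>
  the determinant is \<open>1 - cmwz\<close>, which is impossible in characteristic zero.
\<close>
section \<open>Polynomials as finitely supported functions\<close>

text \<open>With the lexicographic order, exponent vectors form a linearly ordered cancellative
  monoid; this makes \<open>poly4\<close> over a field an integral domain.\<close>

instance prod :: (ordered_cancel_comm_monoid_add, ordered_cancel_comm_monoid_add)
  ordered_cancel_comm_monoid_add
  by intro_classes
    (auto simp: less_eq_prod_def intro: add_strict_left_mono add_left_mono)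

abbreviation lookup :: "('m \<Rightarrow>\<^sub>0 'a::zero) \<Rightarrow> 'm \<Rightarrow> 'a" where
  "lookup \<equiv> Poly_Mapping.lookup"

abbreviation keys :: "('m \<Rightarrow>\<^sub>0 'a::zero) \<Rightarrow> 'm set" where
  "keys \<equiv> Poly_Mapping.keys"

abbreviation coef :: "'a \<Rightarrow> ('m::zero \<Rightarrow>\<^sub>0 'a::zero)" where
  "coef c \<equiv> Poly_Mapping.single 0 c"

abbreviation mon :: "'m \<Rightarrow> ('m \<Rightarrow>\<^sub>0 'a::zero_neq_one)" where
  "mon m \<equiv> Poly_Mapping.single m 1"

lemma lookup_coef_mult [simp]:
  "lookup (coef c * f) m = c * lookup (f :: 'm::monoid_add \<Rightarrow>\<^sub>0 'a::comm_ring_1) m"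
  unfolding mult_map_scale_conv_mult[symmetric] by (simp add: map.rep_eq when_def)

lemma poly_mapping_eq_sum_single:
  "f = (\<Sum>m\<in>keys (f :: 'm \<Rightarrow>\<^sub>0 'a::comm_monoid_add). Poly_Mapping.single m (lookup f m))"
  by (rule poly_mapping_eqI) (auto simp: lookup_sum lookup_single when_def in_keys_iff)

lemma poly_mapping_induct [case_names zero single add]:
  assumes "P 0" and "\<And>m c. P (Poly_Mapping.single m c)"
    and "\<And>f g. P f \<Longrightarrow> P g \<Longrightarrow> P (f + g)"
  shows "P (f :: 'm \<Rightarrow>\<^sub>0 'a::comm_monoid_add)"
proof -
  have "P (\<Sum>m\<in>A. Poly_Mapping.single m (lookup f m))" if "finite A" for A
    using that by (induction A) (auto intro: assms)
  from this[OF finite_keys] show ?thesis by (metis poly_mapping_eq_sum_single)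
qed

lift_definition part :: "('m \<Rightarrow> bool) \<Rightarrow> ('m \<Rightarrow>\<^sub>0 'a::zero) \<Rightarrow> ('m \<Rightarrow>\<^sub>0 'a)" is
  "\<lambda>P f m. if P m then f m else 0"
  by (erule finite_subset[rotated]) auto

lemma lookup_part: "lookup (part P f) m = (if P m then lookup f m else 0)"
  by transfer simp

lemma keys_part: "keys (part P f) = {m \<in> keys f. P m}"
  by (auto simp: in_keys_iff lookup_part split: if_splits)

lemma part_add: "part P (f + g) = part P f + part P (g :: 'm \<Rightarrow>\<^sub>0 'a::monoid_add)"
  by (rule poly_mapping_eqI) (simp add: lookup_part lookup_add)

lemma part_eq_self: "(\<And>m. m \<in> keys f \<Longrightarrow> P m) \<Longrightarrow> part P f = f"
  by (rule poly_mapping_eqI) (auto simp: lookup_part in_keys_iff)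

lemma part_eq_0: "(\<And>m. m \<in> keys f \<Longrightarrow> \<not> P m) \<Longrightarrow> part P f = 0"
  by (rule poly_mapping_eqI) (auto simp: lookup_part in_keys_iff)

lemma part_split: "f = part P f + part (\<lambda>m. \<not> P m) (f :: 'm \<Rightarrow>\<^sub>0 'a::monoid_add)"
  by (rule poly_mapping_eqI) (simp add: lookup_part lookup_add)

lemma keys_multD: "m \<in> keys (f * g) \<Longrightarrow> \<exists>a\<in>keys f. \<exists>b\<in>keys g. m = a + b"
  using keys_mult[of f g] by blast

lemma keys_addD: "m \<in> keys (f + g) \<Longrightarrow> m \<in> keys f \<or> m \<in> keys g"
  using keys_add[of f g] by blast

lemma keys_diffD: "m \<in> keys (f - g :: 'm \<Rightarrow>\<^sub>0 'a::ab_group_add) \<Longrightarrow> m \<in> keys f \<or> m \<in> keys g"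
  by (auto simp: in_keys_iff lookup_minus)

section \<open>Weights\<close>

text \<open>Weights take integer values rather than natural numbers so that the negative of a weight
  is again a weight.\<close>

definition weight :: "('m::monoid_add \<Rightarrow> int) \<Rightarrow> bool" where
  "weight \<omega> \<longleftrightarrow> (\<forall>a b. \<omega> (a + b) = \<omega> a + \<omega> b)"

lemma weight_add: "weight \<omega> \<Longrightarrow> \<omega> (a + b) = \<omega> a + \<omega> b"
  by (simp add: weight_def)

lemma weight_0: "weight \<omega> \<Longrightarrow> \<omega> 0 = 0"
  unfolding weight_def by (metis add.right_neutral add_cancel_right_right)

lemma weight_uminus: "weight \<omega> \<Longrightarrow> weight (\<lambda>m. - \<omega> m)"
  by (simp add: weight_def)

definition low :: "('m \<Rightarrow> int) \<Rightarrow> int \<Rightarrow> ('m \<Rightarrow>\<^sub>0 'a::zero) \<Rightarrow> bool" where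
  "low \<omega> i f \<longleftrightarrow> (\<forall>m\<in>keys f. i \<le> \<omega> m)"

definition pure :: "('m \<Rightarrow> int) \<Rightarrow> int \<Rightarrow> ('m \<Rightarrow>\<^sub>0 'a::zero) \<Rightarrow> bool" where
  "pure \<omega> i f \<longleftrightarrow> (\<forall>m\<in>keys f. \<omega> m = i)"

lemma pure_imp_low: "pure \<omega> i f \<Longrightarrow> low \<omega> i f"
  by (simp add: pure_def low_def)

lemma low_mono: "low \<omega> i f \<Longrightarrow> j \<le> i \<Longrightarrow> low \<omega> j f"
  by (auto simp: low_def)

lemma pure_0 [simp]: "pure \<omega> i 0"
  by (simp add: pure_def)

lemma low_0 [simp]: "low \<omega> i 0"
  by (simp add: low_def)

lemma pure_single: "\<omega> m = i \<Longrightarrow> pure \<omega> i (Poly_Mapping.single m c)"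
  by (auto simp: pure_def split: if_splits)

lemma pure_add: "pure \<omega> i f \<Longrightarrow> pure \<omega> i g \<Longrightarrow> pure \<omega> i (f + g)"
  unfolding pure_def using keys_addD by metis

lemma pure_diff: "pure \<omega> i f \<Longrightarrow> pure \<omega> i g \<Longrightarrow> pure \<omega> i (f - g :: 'm \<Rightarrow>\<^sub>0 'a::ab_group_add)"
  unfolding pure_def using keys_diffD by metis

lemma low_add: "low \<omega> i f \<Longrightarrow> low \<omega> i g \<Longrightarrow> low \<omega> i (f + g)"
  unfolding low_def using keys_addD by metis

lemma low_diff: "low \<omega> i f \<Longrightarrow> low \<omega> i g \<Longrightarrow> low \<omega> i (f - g :: 'm \<Rightarrow>\<^sub>0 'a::ab_group_add)"
  unfolding low_def using keys_diffD by metis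

lemma pure_mult: "weight \<omega> \<Longrightarrow> pure \<omega> i f \<Longrightarrow> pure \<omega> j g \<Longrightarrow> pure \<omega> (i + j) (f * g)"
  unfolding pure_def by (metis keys_multD weight_add)

lemma low_mult: "weight \<omega> \<Longrightarrow> low \<omega> i f \<Longrightarrow> low \<omega> j g \<Longrightarrow> low \<omega> (i + j) (f * g)"
  unfolding low_def by (metis keys_multD weight_add add_mono)

lemma pure_power:
  fixes f :: "'m::comm_monoid_add \<Rightarrow>\<^sub>0 'a::comm_ring_1"
  shows "weight \<omega> \<Longrightarrow> pure \<omega> i f \<Longrightarrow> pure \<omega> (int n * i) (f ^ n)"
proof (induction n)
  case 0
  then show ?case by (simp add: pure_def weight_0)
next
  case (Suc n)
  then show ?case using pure_mult[of \<omega> i f "int n * i" "f ^ n"] by (simp add: algebra_simps)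
qed

lemma pure_unique: "pure \<omega> i f \<Longrightarrow> pure \<omega> j f \<Longrightarrow> f \<noteq> 0 \<Longrightarrow> i = j"
  unfolding pure_def by (metis ex_in_conv keys_eq_empty)

lemma part_of_pure: "pure \<omega> i f \<Longrightarrow> part (\<lambda>m. \<omega> m = j) f = (if i = j then f else 0)"
  by (auto simp: pure_def intro!: part_eq_self part_eq_0)

lemma part_of_low: "low \<omega> i f \<Longrightarrow> j < i \<Longrightarrow> part (\<lambda>m. \<omega> m = j) f = 0"
  by (force simp: low_def intro!: part_eq_0)

lemma pure_part: "pure \<omega> i (part (\<lambda>m. \<omega> m = i) f)"
  by (simp add: pure_def keys_part)

lemma low_split:
  fixes f :: "'m \<Rightarrow>\<^sub>0 'a::monoid_add"
  assumes "low \<omega> i f"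
  obtains r where "f = part (\<lambda>m. \<omega> m = i) f + r" "low \<omega> (i + 1) r"
proof
  show "f = part (\<lambda>m. \<omega> m = i) f + part (\<lambda>m. \<omega> m \<noteq> i) f" by (rule part_split)
  show "low \<omega> (i + 1) (part (\<lambda>m. \<omega> m \<noteq> i) f)"
    using assms by (force simp: low_def keys_part)
qed

text \<open>All other products of terms have weight above \<open>i + j\<close>. The numbers
  \<open>i\<close> and \<open>j\<close> are only lower bounds, so either part may be 0.\<close>

lemma part_mult_low:
  fixes a f :: "'m::comm_monoid_add \<Rightarrow>\<^sub>0 'a::comm_ring_1"
  assumes w: "weight \<omega>" and a: "low \<omega> i a" and f: "low \<omega> j f"
  shows "part (\<lambda>m. \<omega> m = i + j) (a * f) = part (\<lambda>m. \<omega> m = i) a * part (\<lambda>m. \<omega> m = j) f"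
proof -
  let ?a = "part (\<lambda>m. \<omega> m = i) a" and ?f = "part (\<lambda>m. \<omega> m = j) f"
  obtain a' where a': "a = ?a + a'" "low \<omega> (i + 1) a'" using low_split[OF a] .
  obtain f' where f': "f = ?f + f'" "low \<omega> (j + 1) f'" using low_split[OF f] .
  have "low \<omega> (i + (j + 1)) (?a * f')"
    by (intro low_mult w pure_imp_low pure_part f')
  moreover have "low \<omega> ((i + 1) + j) (a' * f)" by (intro low_mult w a' f)
  ultimately have "low \<omega> (i + j + 1) (?a * f' + a' * f)" by (intro low_add) (simp_all add: algebra_simps)
  moreover have "a * f = ?a * ?f + (?a * f' + a' * f)"
  proof -
    have "a * f = ?a * f + a' * f" by (subst a'(1)) (rule distrib_right)
    also have "?a * f = ?a * ?f + ?a * f'" by (subst f'(1)) (rule distrib_left)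
    finally show ?thesis by (simp add: add.assoc)
  qed
  moreover have "pure \<omega> (i + j) (?a * ?f)" by (intro pure_mult w pure_part)
  ultimately show ?thesis
    using part_of_low[of \<omega> "i + j + 1" "?a * f' + a' * f" "i + j"] part_of_pure[of \<omega> "i + j" "?a * ?f" "i + j"]
      part_add[of "\<lambda>m. \<omega> m = i + j" "?a * ?f" "?a * f' + a' * f"]
    by simp
qed

lemma lowest_component:
  assumes "f \<noteq> (0 :: 'm \<Rightarrow>\<^sub>0 'a::zero)"
  obtains i where "low \<omega> i f" "part (\<lambda>m. \<omega> m = i) f \<noteq> 0" "i = Min (\<omega> ` keys f)"
proof
  let ?i = "Min (\<omega> ` keys f)"
  have ne: "keys f \<noteq> {}" using assms by simp
  show "low \<omega> ?i f" by (simp add: low_def)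
  have "?i \<in> \<omega> ` keys f" using ne by (intro Min_in) auto
  then obtain m where "m \<in> keys f" "\<omega> m = ?i" by force
  then have "m \<in> keys (part (\<lambda>m. \<omega> m = ?i) f)" by (simp add: keys_part)
  then show "part (\<lambda>m. \<omega> m = ?i) f \<noteq> 0" by auto
qed simp

text \<open>Negating the weight turns the lowest components into the highest ones.\<close>

lemma pure_factors:
  fixes a b :: "'m::{ordered_cancel_comm_monoid_add, linorder} \<Rightarrow>\<^sub>0 'a::idom"
  assumes w: "weight \<omega>" and ab: "pure \<omega> n (a * b)" and nz: "a * b \<noteq> 0"
  obtains i j where "pure \<omega> i a" "pure \<omega> j b" "i + j = n"
proof -
  \<comment> \<open>The product of the two lowest components is nonzero in a domain, so it is the
    lowest component of the pure element \<open>a * b\<close> and has weight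
    \<open>n\<close>.\<close>
  have sum: "i + j = n" if w: "weight \<omega>" and ab: "pure \<omega> n (a * b)"
    and i: "low \<omega> i a" "part (\<lambda>m. \<omega> m = i) a \<noteq> 0"
    and j: "low \<omega> j b" "part (\<lambda>m. \<omega> m = j) b \<noteq> 0" for \<omega> n i j
    using part_mult_low[OF w i(1) j(1)] part_of_pure[OF ab, of "i + j"] i(2) j(2)
    by (auto split: if_splits)
  from nz have "a \<noteq> 0" "b \<noteq> 0" by auto
  obtain i where i: "low \<omega> i a" "part (\<lambda>m. \<omega> m = i) a \<noteq> 0" by (rule lowest_component[OF \<open>a \<noteq> 0\<close>])
  obtain j where j: "low \<omega> j b" "part (\<lambda>m. \<omega> m = j) b \<noteq> 0" by (rule lowest_component[OF \<open>b \<noteq> 0\<close>])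
  let ?\<omega> = "\<lambda>m. - \<omega> m"
  obtain i' where i': "low ?\<omega> i' a" "part (\<lambda>m. ?\<omega> m = i') a \<noteq> 0" by (rule lowest_component[OF \<open>a \<noteq> 0\<close>])
  obtain j' where j': "low ?\<omega> j' b" "part (\<lambda>m. ?\<omega> m = j') b \<noteq> 0" by (rule lowest_component[OF \<open>b \<noteq> 0\<close>])
  \<comment> \<open>The lowest weights \<open>i\<close>, \<open>j\<close> add up to
    \<open>n\<close>, and so do the highest weights \<open>- i'\<close>, \<open>- j'\<close>. Lowest
    is at most highest in each factor, so they agree.\<close>
  have n: "i + j = n" by (rule sum[OF w ab i j])
  have "pure ?\<omega> (- n) (a * b)" using ab by (simp add: pure_def)
  from sum[OF weight_uminus[OF w] this i' j'] have n': "i' + j' = - n" .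
  obtain m where m: "m \<in> keys a" using \<open>a \<noteq> 0\<close> by (metis ex_in_conv keys_eq_empty)
  then have "i \<le> - i'" using i(1) i'(1) by (force simp: low_def)
  obtain m' where m': "m' \<in> keys b" using \<open>b \<noteq> 0\<close> by (metis ex_in_conv keys_eq_empty)
  then have "j \<le> - j'" using j(1) j'(1) by (force simp: low_def)
  have "i' = - i" "j' = - j" using n n' \<open>i \<le> - i'\<close> \<open>j \<le> - j'\<close> by linarith+
  then have "pure \<omega> i a" "pure \<omega> j b"
    using i(1) i'(1) j(1) j'(1) by (force simp: low_def pure_def)+
  with n show thesis by (rule that[rotated -1])
qed

section \<open>Unique factorization\<close>

text \<open>Iterated univariate polynomials over a field form a factorial ring; factorization is
  carried back from there along the ring isomorphism \<open>to_nested\<close>.\<close>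

fun nest :: "mon4 \<Rightarrow> 'k::comm_monoid_add \<Rightarrow> 'k poly poly poly poly" where
  "nest (a, b, c, d) r = monom (monom (monom (monom r d) c) b) a"

definition to_nested :: "'k::field poly4 \<Rightarrow> 'k poly poly poly poly" where
  "to_nested f = (\<Sum>m\<in>keys f. nest m (lookup f m))"

fun coeff4 :: "'k::comm_monoid_add poly poly poly poly \<Rightarrow> mon4 \<Rightarrow> 'k" where
  "coeff4 p (a, b, c, d) = coeff (coeff (coeff (coeff p a) b) c) d"

lemma coeff4_nest: "coeff4 (nest m r) n = (if m = n then r else 0)"
  by (cases m; cases n) auto

lemma coeff4_add: "coeff4 (p + q) n = coeff4 p n + coeff4 q n"
  by (cases n) simp

lemma coeff4_sum: "coeff4 (sum f A) n = (\<Sum>x\<in>A. coeff4 (f x) n)"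
  by (cases n) (simp add: coeff_sum)

lemma coeff4_eqI: "(\<And>n. coeff4 p n = coeff4 q n) \<Longrightarrow> p = q"
  apply (intro poly_eqI)
  subgoal for a b c d by (drule meta_spec[of _ "(a, b, c, d)"]) simp
  done

lemma coeff4_to_nested: "coeff4 (to_nested f) n = lookup f n"
  by (auto simp: to_nested_def coeff4_sum coeff4_nest in_keys_iff)

lemma to_nested_add: "to_nested (f + g) = to_nested f + to_nested g"
  by (rule coeff4_eqI) (simp add: coeff4_to_nested coeff4_add lookup_add)

lemma to_nested_single: "to_nested (Poly_Mapping.single m r) = nest m r"
  by (rule coeff4_eqI) (simp add: coeff4_to_nested coeff4_nest lookup_single when_def)

lemma nest_mult: "nest m r * nest n s = nest (m + n) (r * s :: 'k::field)"
  by (cases m; cases n) (simp add: mult_monom)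

lemma to_nested_0: "to_nested 0 = 0"
  by (simp add: to_nested_def)

lemma to_nested_mult: "to_nested (f * g) = to_nested f * to_nested g"
proof (induction f rule: poly_mapping_induct)
  case (single m c)
  show ?case
    by (induction g rule: poly_mapping_induct)
      (simp_all add: mult_single to_nested_single to_nested_add to_nested_0 nest_mult distrib_left)
qed (simp_all add: to_nested_0 to_nested_add distrib_right)

lemma to_nested_1: "to_nested 1 = 1"
  using to_nested_single[of 0 1]
  by (simp add: single_one del: nest.simps) (simp add: zero_prod_def monom_0)

lemma to_nested_inj: "inj (to_nested :: 'k::field poly4 \<Rightarrow> _)"
proof (rule injI)
  fix f g :: "'k poly4"
  assume "to_nested f = to_nested g"
  then show "f = g" using coeff4_to_nested[of f] coeff4_to_nested[of g] by (simp add: poly_mapping_eq_iff fun_eq_iff)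
qed

text \<open>A subset closed under sums and products contains all polynomials once it contains the
  constants and the variable. Surjectivity of \<open>to_nested\<close> applies this once per
  variable, starting with the innermost.\<close>

lemma poly_embedding_subset:
  fixes e :: "'a::comm_semiring_1 poly \<Rightarrow> 'b::comm_ring_1"
  assumes "\<And>p q. e (p + q) = e p + e q" "\<And>p q. e (p * q) = e p * e q"
    and "\<And>x y. x \<in> S \<Longrightarrow> y \<in> S \<Longrightarrow> x + y \<in> S" "\<And>x y. x \<in> S \<Longrightarrow> y \<in> S \<Longrightarrow> x * y \<in> S"
    and "\<And>a. e [:a:] \<in> S" "e [:0, 1:] \<in> S"
  shows "e p \<in> S"
proof (induction p)
  case 0
  then show ?case using assms(5)[of 0] by simp
next
  case (pCons a p)
  have eq: "pCons a p = [:a:] + [:0, 1:] * p" by simp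
  show ?case unfolding eq assms(1,2) by (intro assms(3-6) pCons.IH)
qed

lemma to_nested_surj: "surj (to_nested :: 'k::field poly4 \<Rightarrow> _)"
proof -
  let ?S = "range (to_nested :: 'k poly4 \<Rightarrow> _)"
  have add: "x + y \<in> ?S" and mult: "x * y \<in> ?S" if "x \<in> ?S" "y \<in> ?S" for x y
    using that by (auto simp flip: to_nested_add to_nested_mult)
  have nest: "nest m r \<in> ?S" for m r
    using to_nested_single by (metis rangeI)
  have 1: "[:[:[:p:]:]:] \<in> ?S" for p
    by (rule poly_embedding_subset[where e = "\<lambda>p. [:[:[:p:]:]:]", OF _ _ add mult])
      (use nest[of "(0,0,0,0)"] nest[of "(0,0,0,1)" 1] in \<open>simp_all add: monom_0 monom_Suc\<close>)
  have 2: "[:[:p:]:] \<in> ?S" for p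
    by (rule poly_embedding_subset[where e = "\<lambda>p. [:[:p:]:]", OF _ _ add mult 1])
      (use nest[of "(0,0,1,0)" 1] in \<open>simp_all add: monom_0 monom_Suc\<close>)
  have 3: "[:p:] \<in> ?S" for p
    by (rule poly_embedding_subset[where e = "\<lambda>p. [:p:]", OF _ _ add mult 2])
      (use nest[of "(0,1,0,0)" 1] in \<open>simp_all add: monom_0 monom_Suc\<close>)
  have "p \<in> ?S" for p
    by (rule poly_embedding_subset[where e = "\<lambda>p. p", OF _ _ add mult 3])
      (use nest[of "(1,0,0,0)" 1] in \<open>simp_all add: monom_0 monom_Suc\<close>)
  then show ?thesis by blast
qed

lemma to_nested_dvd: "to_nested f dvd to_nested g \<longleftrightarrow> f dvd g"
proof
  assume "to_nested f dvd to_nested g"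
  then obtain k where k: "to_nested g = to_nested f * k" by (auto simp: dvd_def)
  obtain k' where "k = to_nested k'" using surjD[OF to_nested_surj] by blast
  with k have "to_nested g = to_nested (f * k')" by (simp add: to_nested_mult)
  from injD[OF to_nested_inj this] show "f dvd g" by simp
qed (auto simp: dvd_def to_nested_mult)

lemma prime_elem_to_nested:
  assumes "prime_elem (to_nested f)"
  shows "prime_elem f"
proof (rule prime_elemI)
  show "f \<noteq> 0" using assms by (auto simp: to_nested_0)
  show "\<not> f dvd 1" using assms to_nested_dvd[of f 1] by (auto simp: to_nested_1)
  show "f dvd a \<or> f dvd b" if "f dvd a * b" for a b
    using that prime_elem_dvd_multD[OF assms, of "to_nested a" "to_nested b"]
    by (simp add: to_nested_dvd flip: to_nested_mult)
qed

text \<open>A prime factorization of \<open>to_nested f\<close> is pulled back one factor at a time;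
  the unit left at the end is the base case.\<close>

lemma poly4_prime_induct [case_names zero unit prime]:
  fixes f :: "'k::field poly4"
  assumes "P 0" and unit: "\<And>u. u dvd 1 \<Longrightarrow> P u" and prime: "\<And>q u. prime_elem q \<Longrightarrow> P u \<Longrightarrow> P (q * u)"
  shows "P f"
proof -
  have *: "\<forall>u. to_nested u = prod_mset F \<longrightarrow> P u" if "\<And>q. q \<in># F \<Longrightarrow> prime_elem q" for F
    using that
  proof (induction F)
    case empty
    have "P u" if "to_nested u = to_nested 1" for u
      using injD[OF to_nested_inj that] unit by simp
    then show ?case by (simp add: to_nested_1)
  next
    case (add q F)
    show ?case
    proof (intro allI impI)
      fix u assume u: "to_nested u = prod_mset (add_mset q F)"
      obtain q' where q': "q = to_nested q'" using surjD[OF to_nested_surj] by blast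
      obtain v where v: "prod_mset F = to_nested v" using surjD[OF to_nested_surj] by blast
      have "u = q' * v"
        using u v q' by (intro injD[OF to_nested_inj]) (simp add: to_nested_mult)
      moreover have "prime_elem q'" using add.prems[of q] by (simp add: q' prime_elem_to_nested)
      moreover have "P v" using add v by auto
      ultimately show "P u" using prime by simp
    qed
  qed
  show ?thesis
  proof (cases "f = 0 \<or> f dvd 1")
    case False
    then have "to_nested f \<noteq> 0" "\<not> to_nested f dvd 1"
      using injD[OF to_nested_inj, of f 0] to_nested_dvd[of f 1] by (auto simp: to_nested_0 to_nested_1)
    from mset_factors_exist[OF this] obtain F where F: "mset_factors F (to_nested f)" ..
    then show ?thesis
      using *[of F] mset_factorsD(1,3)[OF F] by auto
  qed (use assms in auto)
qed

text \<open>Coprimality of \<open>a'\<close> and \<open>b'\<close> is stated in the form used later: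
  every relation between them is a multiple of the Koszul relation. In the induction over the prime
  factors of \<open>a\<close>, a new prime \<open>q\<close> moves into \<open>h\<close> if it
  divides \<open>b'\<close>, and into \<open>a'\<close> otherwise.\<close>

lemma poly4_gcd:
  fixes a b :: "'k::field poly4"
  assumes "a \<noteq> 0"
  obtains h a' b' where "a = h * a'" "b = h * b'" "\<And>u v. a' * u = b' * v \<Longrightarrow> b' dvd u"
proof -
  have "\<exists>h a' b'. a = h * a' \<and> b = h * b' \<and> (\<forall>u v. a' * u = b' * v \<longrightarrow> b' dvd u)"
    using assms
  proof (induction a rule: poly4_prime_induct)
    case (unit a)
    from \<open>a dvd 1\<close> obtain c where c: "1 = a * c" by (rule dvdE)
    have "b dvd u" if uv: "a * u = b * v" for u v
    proof -
      have "u = (a * c) * u" by (simp flip: c)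
      also have "\<dots> = b * (c * v)" using uv by (simp add: mult.assoc mult.left_commute)
      finally show ?thesis by simp
    qed
    then show ?case by (intro exI[of _ 1] exI[of _ a] exI[of _ b]) auto
  next
    case (prime q a)
    then have "a \<noteq> 0" "q \<noteq> 0" by auto
    with prime.IH obtain h a' b' where ab: "a = h * a'" "b = h * b'"
      and cop: "\<And>u v. a' * u = b' * v \<Longrightarrow> b' dvd u" by blast
    show ?case
    proof (cases "q dvd b'")
      case True
      then obtain b'' where b'': "b' = q * b''" by (auto simp: dvd_def)
      have "b'' dvd u" if "a' * u = b'' * v" for u v
      proof -
        have "a' * (q * u) = b' * v" using that b'' by (simp add: ac_simps)
        from cop[OF this] show ?thesis using b'' \<open>q \<noteq> 0\<close> by simp
      qed
      then show ?thesis using ab b''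
        by (intro exI[of _ "h * q"] exI[of _ a'] exI[of _ b'']) (auto simp: ac_simps)
    next
      case False
      have "b' dvd u" if uv: "(q * a') * u = b' * v" for u v
      proof -
        have "q dvd b' * v" unfolding uv[symmetric] mult.assoc by (rule dvd_triv_left)
        with False prime_elem_dvd_multD[OF prime.hyps] have "q dvd v" by blast
        then obtain v' where v': "v = q * v'" by (auto simp: dvd_def)
        have "q * (a' * u) = q * (b' * v')" using uv v' by (simp add: ac_simps)
        then have "a' * u = b' * v'" using \<open>q \<noteq> 0\<close> by simp
        then show ?thesis by (rule cop)
      qed
      then show ?thesis using ab
        by (intro exI[of _ h] exI[of _ "q * a'"] exI[of _ b']) (auto simp: ac_simps)
    qed
  qed simp
  then show thesis using that by blast
qed

section \<open>Prime ideals and the prime elements they contain\<close>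

lemma prime_idealD:
  assumes "prime_ideal P"
  shows "0 \<in> P" "a \<in> P \<Longrightarrow> b \<in> P \<Longrightarrow> a + b \<in> P" "a \<in> P \<Longrightarrow> r * a \<in> P"
    "a * b \<in> P \<Longrightarrow> a \<in> P \<or> b \<in> P" "P \<noteq> UNIV"
  using assms unfolding prime_ideal_def is_ideal_def by simp_all

lemma unit_notin_prime_ideal:
  assumes P: "prime_ideal P" and "u dvd 1"
  shows "u \<notin> P"
proof
  assume "u \<in> P"
  from \<open>u dvd 1\<close> obtain c where c: "1 = u * c" by (rule dvdE)
  have "x \<in> P" for x
  proof -
    have "(x * c) * u \<in> P" using P \<open>u \<in> P\<close> by (rule prime_idealD(3))
    moreover have "(x * c) * u = x * (u * c)" by (simp only: ac_simps)
    ultimately show ?thesis by (simp flip: c)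
  qed
  with prime_idealD(5)[OF P] show False by auto
qed

lemma poly4_prime_in_prime_ideal:
  fixes h :: "'k::field poly4"
  assumes P: "prime_ideal P" and "h \<in> P" "h \<noteq> 0"
  obtains q where "prime_elem q" "q \<in> P" "q dvd h"
proof -
  have "h \<in> P \<longrightarrow> h \<noteq> 0 \<longrightarrow> (\<exists>q. prime_elem q \<and> q \<in> P \<and> q dvd h)"
  proof (induction h rule: poly4_prime_induct)
    case zero
    then show ?case by simp
  next
    case (unit u)
    then show ?case using unit_notin_prime_ideal[OF P] by simp
  next
    case (prime q u)
    show ?case
    proof (intro impI)
      assume *: "q * u \<in> P" "q * u \<noteq> 0"
      consider "q \<in> P" | "u \<in> P" using prime_idealD(4)[OF P *(1)] by auto
      then show "\<exists>p. prime_elem p \<and> p \<in> P \<and> p dvd q * u"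
      proof cases
        case 1
        then show ?thesis using prime.hyps by (intro exI[of _ q]) simp
      next
        case 2
        have "u \<noteq> 0" using *(2) by auto
        with 2 prime.IH obtain p where "prime_elem p" "p \<in> P" "p dvd u" by auto
        then show ?thesis by (intro exI[of _ p]) simp
      qed
    qed
  qed
  with assms obtain q where "prime_elem q" "q \<in> P" "q dvd h" by auto
  then show thesis by (rule that)
qed

section \<open>Ideals with two generators and height one primes\<close>

lemma ideal_gen_pair: "ideal_gen {a, b} = {u * a + v * b | u v. True}"
proof
  let ?I = "{u * a + v * b | u v. True}"
  have "0 \<in> ?I" by (intro CollectI exI[of _ 0]) simp
  moreover have "x + y \<in> ?I" if xy: "x \<in> ?I" "y \<in> ?I" for x y
  proof -
    obtain u v u' v' where "x = u * a + v * b" "y = u' * a + v' * b" using xy by blast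
    then have "x + y = (u + u') * a + (v + v') * b" by (simp add: algebra_simps)
    then show ?thesis by blast
  qed
  moreover have "r * x \<in> ?I" if x: "x \<in> ?I" for r x
  proof -
    obtain u v where "x = u * a + v * b" using x by blast
    then have "r * x = (r * u) * a + (r * v) * b" by (simp add: algebra_simps)
    then show ?thesis by blast
  qed
  ultimately have "is_ideal ?I" unfolding is_ideal_def by blast
  moreover have "a = 1 * a + 0 * b" "b = 0 * a + 1 * b" by simp_all
  then have "{a, b} \<subseteq> ?I" by blast
  ultimately show "ideal_gen {a, b} \<subseteq> ?I" unfolding ideal_gen_def by blast
  show "?I \<subseteq> ideal_gen {a, b}"
    unfolding ideal_gen_def is_ideal_def by auto
qed

lemma ideal_gen_pairI: "u * a + v * b \<in> ideal_gen {a, b}"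
  unfolding ideal_gen_pair by blast

lemma prime_ideal_power:
  assumes P: "prime_ideal P" and "a ^ n \<in> P"
  shows "a \<in> P"
  using assms(2)
proof (induction n)
  case 0
  then show ?case using unit_notin_prime_ideal[OF P, of 1] by simp
next
  case (Suc n)
  then show ?case using prime_idealD(4)[OF P, of a "a ^ n"] by auto
qed

lemma prime_ideal_principal:
  fixes q :: "'a::idom"
  assumes "prime_elem q"
  shows "prime_ideal {r. q dvd r}"
proof -
  have "1 \<notin> {r. q dvd r}" using assms by (simp add: prime_elem_def)
  then have "{r. q dvd r} \<noteq> UNIV" by blast
  then show ?thesis
    using prime_elem_dvd_multD[OF assms] unfolding prime_ideal_def is_ideal_def by auto
qed

lemma prime_ideal_zero: "prime_ideal {0 :: 'a::idom}"
proof -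
  have "(1::'a) \<notin> {0}" by simp
  then have "{0::'a} \<noteq> UNIV" by blast
  then show ?thesis unfolding prime_ideal_def is_ideal_def by auto
qed

text \<open>In a factorial ring a nonzero prime ideal contains a prime element. If the ideal lies
  inside the principal ideal of \<open>q\<close>, that element is associated to \<open>q\<close>, so
  the two ideals coincide.\<close>

lemma height_principal_prime:
  fixes q :: "'k::field poly4"
  assumes q: "prime_elem q"
  shows "height_eq {r. q dvd r} 1"
proof -
  let ?P = "{r. q dvd r}"
  have P: "prime_ideal ?P" by (rule prime_ideal_principal[OF q])
  have "q \<noteq> 0" using q by auto
  then have "q \<in> ?P" "q \<notin> {0}" "{0} \<subseteq> ?P" by simp_all
  then have "{0} \<subset> ?P" by blast
  then have "prime_chain_to ?P 1"
    unfolding prime_chain_to_def using P prime_ideal_zero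
    by (intro exI[of _ "\<lambda>i. if i = 0 then {0} else ?P"]) simp
  moreover have "\<not> prime_chain_to ?P (Suc 1)"
  proof
    assume "prime_chain_to ?P (Suc 1)"
    then obtain Q where Q: "(\<forall>i\<le>Suc 1. prime_ideal (Q i)) \<and> (\<forall>i<Suc 1. Q i \<subset> Q (Suc i)) \<and> Q (Suc 1) = ?P"
      unfolding prime_chain_to_def by (elim exE)
    have Qprime: "\<And>i. i \<le> Suc 1 \<Longrightarrow> prime_ideal (Q i)" using conjunct1[OF Q] by blast
    have Qsub: "\<And>i. i < Suc 1 \<Longrightarrow> Q i \<subset> Q (Suc i)" using conjunct1[OF conjunct2[OF Q]] by blast
    have p1: "prime_ideal (Q 1)" by (rule Qprime) simp
    have "Q 0 \<subset> Q 1" using Qsub[of 0] by simp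
    have "Q 1 \<subset> ?P" using Qsub[of 1] unfolding conjunct2[OF conjunct2[OF Q]] by simp
    have "0 \<in> Q 0" by (rule prime_idealD(1)[OF Qprime]) simp
    from \<open>Q 0 \<subset> Q 1\<close> obtain a where a: "a \<in> Q 1" "a \<notin> Q 0" by blast
    from a(2) \<open>0 \<in> Q 0\<close> have "a \<noteq> 0" by blast
    from poly4_prime_in_prime_ideal[OF p1 a(1) this]
    obtain p where p: "prime_elem p" "p \<in> Q 1" .
    then have "q dvd p" using psubsetD[OF \<open>Q 1 \<subset> ?P\<close>] by simp
    then obtain r where r: "p = q * r" by (rule dvdE)
    \<comment> \<open>Since \<open>p = q * r\<close> is prime, it divides \<open>q\<close> or
      \<open>r\<close>; the second case would make \<open>q\<close> a unit.\<close>
    have "q \<in> Q 1"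
    proof (cases "p dvd q")
      case True
      then obtain s where "q = p * s" by (rule dvdE)
      then show ?thesis using prime_idealD(3)[OF p1 p(2), of s] by (simp add: mult.commute)
    next
      case False
      then have "p dvd r" using prime_elem_dvd_multD[OF p(1), of q r] r by simp
      then obtain s where s: "r = p * s" by (rule dvdE)
      have "p * 1 = p * (q * s)" using r s by (simp add: mult.left_commute)
      moreover have "p \<noteq> 0" using p(1) by (simp add: prime_elem_def)
      ultimately have "1 = q * s" using mult_left_cancel[of p 1 "q * s"] by blast
      then have "q dvd 1" by (rule dvdI)
      then show ?thesis using q by (simp add: prime_elem_def)
    qed
    have "?P \<subseteq> Q 1"
    proof
      fix x assume "x \<in> ?P"
      then have "q dvd x" by simp
      then obtain s where "x = q * s" by (rule dvdE)
      then show "x \<in> Q 1" using prime_idealD(3)[OF p1 \<open>q \<in> Q 1\<close>, of s] by (simp add: mult.commute)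
    qed
    with \<open>Q 1 \<subset> ?P\<close> show False by blast
  qed
  ultimately show ?thesis unfolding height_eq_def by blast
qed

text \<open>\<open>P\<close> contains \<open>h\<close> and hence a prime factor \<open>q\<close> of
  \<open>h\<close>. The principal ideal of \<open>q\<close> lies between the given ideal and
  \<open>P\<close>, so minimality identifies it with \<open>P\<close>.\<close>

lemma height_minimal_prime_common_factor:
  fixes h :: "'k::field poly4"
  assumes P: "minimal_prime_over (ideal_gen {h * a, h * b}) P"
    and h: "h ^ n \<in> ideal_gen {h * a, h * b}" "h \<noteq> 0"
  shows "height_eq P 1"
proof -
  have pP: "prime_ideal P" and sub: "ideal_gen {h * a, h * b} \<subseteq> P"
    and min: "\<And>Q. prime_ideal Q \<Longrightarrow> ideal_gen {h * a, h * b} \<subseteq> Q \<Longrightarrow> Q \<subseteq> P \<Longrightarrow> Q = P"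
    using P unfolding minimal_prime_over_def by blast+
  have "h \<in> P" using prime_ideal_power[OF pP] h(1) sub by blast
  from poly4_prime_in_prime_ideal[OF pP this h(2)]
  obtain q where q: "prime_elem q" "q \<in> P" "q dvd h" .
  have "ideal_gen {h * a, h * b} \<subseteq> {r. q dvd r}"
    unfolding ideal_gen_pair using q(3) by (auto intro!: dvd_add dvd_mult[OF dvd_mult2])
  moreover have "{r. q dvd r} \<subseteq> P"
  proof
    fix x assume "x \<in> {r. q dvd r}"
    then have "q dvd x" by simp
    then obtain s where "x = q * s" by (rule dvdE)
    then show "x \<in> P" using prime_idealD(3)[OF pP q(2), of s] by (simp add: mult.commute)
  qed
  ultimately have "{r. q dvd r} = P" using min[OF prime_ideal_principal[OF q(1)]] by blast
  then show ?thesis using height_principal_prime[OF q(1)] by simp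
qed

section \<open>Initial forms of a two-generated ideal\<close>

text \<open>Cancellation among the lowest terms of \<open>\<alpha> f + \<beta> g\<close> is a multiple of the Koszul relation
  between the coprime parts of the lowest components; it can be undone at the cost of
  multiplying by the common factor \<open>h\<close> once.\<close>

lemma initial_form_power_multiple_aux:
  fixes f g :: "'m::{ordered_cancel_comm_monoid_add, linorder} \<Rightarrow>\<^sub>0 'a::idom"
  assumes w: "weight \<omega>"
    and f: "low \<omega> i f" "part (\<lambda>m. \<omega> m = i) f = h * f1"
    and g: "low \<omega> j g" "part (\<lambda>m. \<omega> m = j) g = h * g1"
    and nz: "h * f1 \<noteq> 0" "h * g1 \<noteq> 0"
    and cop: "\<And>u v. f1 * u = g1 * v \<Longrightarrow> g1 dvd u"
    and "low \<omega> (l - i) \<alpha>" "low \<omega> (l - j) \<beta>" "low \<omega> s (\<alpha> * f + \<beta> * g)" "l \<le> s"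
  shows "\<exists>n u v. h ^ n * part (\<lambda>m. \<omega> m = s) (\<alpha> * f + \<beta> * g) = u * (h * f1) + v * (h * g1)"
  using assms(9-)
\<comment> \<open>The gap between the bound \<open>l\<close>, valid for each summand, and the bound
  \<open>s\<close> for the sum measures the cancellation still to be undone.\<close>
proof (induction "nat (s - l)" arbitrary: l \<alpha> \<beta> s rule: less_induct)
  case less
  have part_sum: "part (\<lambda>m. \<omega> m = l) (\<alpha> * f + \<beta> * g) =
      part (\<lambda>m. \<omega> m = l - i) \<alpha> * (h * f1) + part (\<lambda>m. \<omega> m = l - j) \<beta> * (h * g1)"
    using part_mult_low[OF w less.prems(1) f(1)] part_mult_low[OF w less.prems(2) g(1)]
    by (simp add: part_add f(2) g(2))
  show ?case
  proof (cases "l = s")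
    case True
    then show ?thesis using part_sum by (metis power_0 mult_1)
  next
    case False
    define \<alpha>0 where "\<alpha>0 = part (\<lambda>m. \<omega> m = l - i) \<alpha>"
    define \<beta>0 where "\<beta>0 = part (\<lambda>m. \<omega> m = l - j) \<beta>"
    obtain \<alpha>' where \<alpha>': "\<alpha> = \<alpha>0 + \<alpha>'" "low \<omega> (l - i + 1) \<alpha>'"
      using low_split[OF less.prems(1)] unfolding \<alpha>0_def .
    obtain \<beta>' where \<beta>': "\<beta> = \<beta>0 + \<beta>'" "low \<omega> (l - j + 1) \<beta>'"
      using low_split[OF less.prems(2)] unfolding \<beta>0_def .
    obtain f' where f': "f = h * f1 + f'" "low \<omega> (i + 1) f'" using low_split[OF f(1)] unfolding f(2) .
    obtain g' where g': "g = h * g1 + g'" "low \<omega> (j + 1) g'" using low_split[OF g(1)] unfolding g(2) .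
    have "pure \<omega> i (h * f1)" "pure \<omega> j (h * g1)" by (simp_all add: pure_part flip: f(2) g(2))
    obtain e p where e: "pure \<omega> e h" "pure \<omega> p f1" "e + p = i"
      by (rule pure_factors[OF w \<open>pure \<omega> i (h * f1)\<close> nz(1)])
    obtain e' q where "pure \<omega> e' h" "pure \<omega> q g1" "e' + q = j"
      by (rule pure_factors[OF w \<open>pure \<omega> j (h * g1)\<close> nz(2)])
    moreover have "h \<noteq> 0" "f1 \<noteq> 0" "g1 \<noteq> 0" using nz by auto
    ultimately have q: "pure \<omega> q g1" "e + q = j" using pure_unique[OF e(1)] by auto
    \<comment> \<open>As \<open>l < s\<close>, the terms of weight \<open>l\<close> cancel. Dividing
      by \<open>h\<close> leaves a relation between \<open>f1\<close> and \<open>g1\<close>, which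
      is \<open>\<kappa>\<close> times the Koszul relation.\<close>
    have "part (\<lambda>m. \<omega> m = l) (\<alpha> * f + \<beta> * g) = 0"
      using part_of_low[OF less.prems(3)] less.prems(4) False by simp
    then have "h * (f1 * \<alpha>0 + g1 * \<beta>0) = 0"
      unfolding part_sum \<alpha>0_def \<beta>0_def by (simp add: algebra_simps)
    then have "f1 * \<alpha>0 + g1 * \<beta>0 = 0" using \<open>h \<noteq> 0\<close> by simp
    then have rel: "f1 * \<alpha>0 = g1 * (- \<beta>0)" by (simp add: add_eq_0_iff)
    from cop[OF this] obtain \<kappa> where \<kappa>: "\<alpha>0 = g1 * \<kappa>" by (rule dvdE)
    have "g1 * (- \<beta>0) = g1 * (f1 * \<kappa>)" using rel \<kappa> by (simp add: mult.left_commute)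
    then have \<beta>0: "\<beta>0 = - (f1 * \<kappa>)" using \<open>g1 \<noteq> 0\<close> by (metis minus_minus mult_cancel_left)
    have pure\<kappa>: "pure \<omega> (l - i - q) \<kappa>"
    proof (cases "\<kappa> = 0")
      case False
      have "pure \<omega> (l - i) (g1 * \<kappa>)" unfolding \<kappa>[symmetric] \<alpha>0_def by (rule pure_part)
      from pure_factors[OF w this] False \<open>g1 \<noteq> 0\<close>
      obtain a b where "pure \<omega> a g1" "pure \<omega> b \<kappa>" "a + b = l - i" by auto
      moreover from this have "a = q" using pure_unique q(1) \<open>g1 \<noteq> 0\<close> by blast
      moreover have "b = l - i - q" using calculation by linarith
      ultimately show ?thesis by simp
    qed simp
    \<comment> \<open>Times \<open>h\<close>, the cancelling terms contribute
      \<open>\<kappa> * (h * g1 * f - h * f1 * g)\<close>. Substituting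
      \<open>h * g1 = g - g'\<close> and \<open>h * f1 = f - f'\<close> turns this into
      \<open>\<kappa> * (f' * g - g' * f)\<close>, whose coefficients have higher weight.\<close>
    define A where "A = h * \<alpha>' - \<kappa> * g'"
    define B where "B = h * \<beta>' + \<kappa> * f'"
    \<comment> \<open>Multiplication by \<open>h\<close> shifts weights by \<open>e\<close>, and
      removing the cancelling terms gains 1. The target only moves to \<open>e + s\<close>, so the
      gap shrinks by one.\<close>
    define l' where "l' = l + 1 + e"
    have eq: "A * f + B * g = h * (\<alpha> * f + \<beta> * g)"
    proof -
      have "h * (\<alpha> * f + \<beta> * g) - (h * \<alpha>' * f + h * \<beta>' * g) = \<kappa> * ((h * g1) * f - (h * f1) * g)"
        unfolding \<alpha>'(1) \<beta>'(1) \<kappa> \<beta>0 by (simp add: algebra_simps)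
      also have "h * g1 = g - g'" using g'(1) by (metis add_diff_cancel_right')
      also have "h * f1 = f - f'" using f'(1) by (metis add_diff_cancel_right')
      finally show ?thesis unfolding A_def B_def by (simp add: algebra_simps)
    qed
    have "low \<omega> (l' - i) A" unfolding A_def
    proof (rule low_diff)
      show "low \<omega> (l' - i) (h * \<alpha>')"
        using low_mult[OF w pure_imp_low[OF e(1)] \<alpha>'(2)] by (simp add: l'_def algebra_simps)
      show "low \<omega> (l' - i) (\<kappa> * g')"
        using low_mult[OF w pure_imp_low[OF pure\<kappa>] g'(2)]
        by (rule low_mono) (use q(2) in \<open>simp add: l'_def algebra_simps\<close>)
    qed
    moreover have "low \<omega> (l' - j) B" unfolding B_def
    proof (rule low_add)
      show "low \<omega> (l' - j) (h * \<beta>')"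
        using low_mult[OF w pure_imp_low[OF e(1)] \<beta>'(2)] by (simp add: l'_def algebra_simps)
      show "low \<omega> (l' - j) (\<kappa> * f')"
        using low_mult[OF w pure_imp_low[OF pure\<kappa>] f'(2)]
        by (rule low_mono) (use q(2) in \<open>simp add: l'_def algebra_simps\<close>)
    qed
    moreover have "low \<omega> (e + s) (A * f + B * g)"
      unfolding eq by (rule low_mult[OF w pure_imp_low[OF e(1)] less.prems(3)])
    moreover have "l' \<le> e + s" "nat (e + s - l') < nat (s - l)"
      using less.prems(4) False by (auto simp: l'_def)
    ultimately obtain n u v where
      "h ^ n * part (\<lambda>m. \<omega> m = e + s) (A * f + B * g) = u * (h * f1) + v * (h * g1)"
      using less.hyps by blast
    moreover have "part (\<lambda>m. \<omega> m = e + s) (A * f + B * g) = h * part (\<lambda>m. \<omega> m = s) (\<alpha> * f + \<beta> * g)"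
      unfolding eq part_mult_low[OF w pure_imp_low[OF e(1)] less.prems(3)]
      using part_of_pure[OF e(1), of e] by simp
    ultimately have "h ^ Suc n * part (\<lambda>m. \<omega> m = s) (\<alpha> * f + \<beta> * g) = u * (h * f1) + v * (h * g1)"
      by (simp add: ac_simps)
    then show ?thesis by blast
  qed
qed

lemma low_exists: "\<exists>l0. \<forall>l\<le>l0. low \<omega> l f"
proof (cases "f = 0")
  case False
  obtain i where "low \<omega> i f" by (rule lowest_component[OF False])
  then show ?thesis using low_mono by blast
qed simp

lemma initial_form_power_multiple:
  fixes f g :: "'m::{ordered_cancel_comm_monoid_add, linorder} \<Rightarrow>\<^sub>0 'a::idom"
  assumes w: "weight \<omega>"
    and f: "low \<omega> i f" "part (\<lambda>m. \<omega> m = i) f = h * f1"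
    and g: "low \<omega> j g" "part (\<lambda>m. \<omega> m = j) g = h * g1"
    and nz: "h * f1 \<noteq> 0" "h * g1 \<noteq> 0"
    and cop: "\<And>u v. f1 * u = g1 * v \<Longrightarrow> g1 dvd u"
    and a: "a \<in> ideal_gen {f, g}" "low \<omega> s a"
  shows "\<exists>n. h ^ n * part (\<lambda>m. \<omega> m = s) a \<in> ideal_gen {h * f1, h * g1}"
proof -
  obtain \<alpha> \<beta> where ab: "a = \<alpha> * f + \<beta> * g" using a(1) unfolding ideal_gen_pair by blast
  obtain l1 where l1: "\<And>l. l \<le> l1 \<Longrightarrow> low \<omega> l \<alpha>" using low_exists by blast
  obtain l2 where l2: "\<And>l. l \<le> l2 \<Longrightarrow> low \<omega> l \<beta>" using low_exists by blast
  \<comment> \<open>Any \<open>l\<close> this small bounds both summands from below, so the descent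
    can start.\<close>
  define l where "l = min s (min (l1 + i) (l2 + j))"
  have l: "low \<omega> (l - i) \<alpha>" "low \<omega> (l - j) \<beta>" "l \<le> s" by (auto simp: l_def intro!: l1 l2)
  have "\<exists>n u v. h ^ n * part (\<lambda>m. \<omega> m = s) (\<alpha> * f + \<beta> * g) = u * (h * f1) + v * (h * g1)"
    by (rule initial_form_power_multiple_aux[OF w f g nz _ l(1,2) _ l(3)])
      (use cop a(2) in \<open>simp_all add: ab\<close>)
  then show ?thesis unfolding ab ideal_gen_pair by simp
qed

section \<open>Bihomogeneous polynomials and Macaulay's curve\<close>

definition w1 :: "mon4 \<Rightarrow> int" where "w1 m = int (bideg1 m)"
definition w2 :: "mon4 \<Rightarrow> int" where "w2 m = int (bideg2 m)"
definition wt :: "mon4 \<Rightarrow> int" where "wt m = int (tdeg m)"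

lemma weight_w1: "weight w1"
  by (auto simp: weight_def w1_def)

lemma weight_wt: "weight wt"
  by (auto simp: weight_def wt_def)

lemma w1_w2: "w1 m + w2 m = 4 * wt m"
  by (cases m) (simp add: w1_def w2_def wt_def)

text \<open>The value at w = x = y = z = 1, the point of the curve with s = t = 1.\<close>

definition eps :: "'k::comm_ring_1 poly4 \<Rightarrow> 'k" where
  "eps f = (\<Sum>m\<in>keys f. lookup f m)"

lemma eps_superset: "finite A \<Longrightarrow> keys f \<subseteq> A \<Longrightarrow> eps f = (\<Sum>m\<in>A. lookup f m)"
  unfolding eps_def by (rule sum.mono_neutral_left) (auto simp: in_keys_iff)

lemma eps_0 [simp]: "eps 0 = 0"
  by (simp add: eps_def)

lemma eps_single [simp]: "eps (Poly_Mapping.single m c) = c"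
  by (subst eps_superset[of "{m}"]) auto

lemma eps_add [simp]: "eps (f + g) = eps f + eps g"
proof -
  have "keys (f + g) \<subseteq> keys f \<union> keys g" by (rule keys_add)
  then show ?thesis
    by (simp add: eps_superset[of "keys f \<union> keys g"] lookup_add sum.distrib)
qed

lemma eps_mult [simp]: "eps (f * g) = eps f * eps g"
proof (induction f rule: poly_mapping_induct)
  case (single m c)
  show ?case
    by (induction g rule: poly_mapping_induct) (simp_all add: mult_single distrib_left)
qed (simp_all add: distrib_right)

lemma eps_1 [simp]: "eps 1 = 1"
  using eps_single[of 0 1] by simp

lemma eps_power [simp]: "eps (f ^ n) = eps f ^ n"
  by (induction n) simp_all

lemma eps_uminus [simp]: "eps (- f) = - eps f"
  using eps_add[of f "- f"] by (simp add: eq_neg_iff_add_eq_0 add.commute del: eps_add)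

lemma eps_diff [simp]: "eps (f - g) = eps f - eps g"
  using eps_add[of f "- g"] by simp

section \<open>Vanishing on the curve\<close>

lemma eval4_parametrization:
  "eval4 f (s ^ 4) (s ^ 3 * t) (s * t ^ 3) (t ^ 4) =
    (\<Sum>m\<in>keys f. lookup f m * (s ^ bideg1 m * t ^ bideg2 m))"
  unfolding eval4_def
  by (rule sum.cong) (auto simp: power_mult_distrib power_add ac_simps simp flip: power_mult)

text \<open>On the parametrization a bihomogeneous polynomial becomes a single monomial in s and t
  with coefficient \<open>eps f\<close>, so one point of the torus decides.\<close>

lemma bihomogeneous_in_macaulay_ideal_iff:
  assumes "pure w1 i f" "pure w2 j f"
  shows "f \<in> macaulay_ideal \<longleftrightarrow> eps f = 0"
proof
  assume "f \<in> macaulay_ideal"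
  then have "eval4 f (1 ^ 4) (1 ^ 3 * 1) (1 * 1 ^ 3) (1 ^ 4) = 0"
    unfolding macaulay_ideal_def by blast
  then show "eps f = 0" unfolding eval4_parametrization eps_def by simp
next
  assume 0: "eps f = 0"
  have "eval4 f (s ^ 4) (s ^ 3 * t) (s * t ^ 3) (t ^ 4) = eps f * (s ^ nat i * t ^ nat j)" for s t
    unfolding eval4_parametrization eps_def sum_distrib_right
    by (rule sum.cong) (use assms in \<open>force simp: pure_def w1_def w2_def simp del: bideg1.simps bideg2.simps\<close>)+
  then show "f \<in> macaulay_ideal" unfolding macaulay_ideal_def 0 by simp
qed

text \<open>Factors of the degree 0 form 1 are homogeneous, and their nonnegative degrees add up to
  0.\<close>

lemma unit_poly4:
  fixes u :: "'k::field poly4"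
  assumes "u dvd 1"
  shows "u = coef (lookup u 0)"
proof -
  obtain c where c: "1 = u * c" using assms by (rule dvdE)
  have "pure wt 0 (1 :: 'k poly4)" by (simp add: pure_def weight_0[OF weight_wt])
  then obtain i j where ij: "pure wt i u" "pure wt j c" "i + j = 0"
    unfolding c by (rule pure_factors[OF weight_wt]) (simp flip: c)
  have "u \<noteq> 0" "c \<noteq> 0" using c by auto
  then obtain m n where m: "m \<in> keys u" "n \<in> keys c" by (metis ex_in_conv keys_eq_empty)
  have "wt m \<ge> 0" "wt n \<ge> 0" by (simp_all add: wt_def)
  with m ij have "i = 0" by (auto simp: pure_def)
  have "k = 0" if "k \<in> keys u" for k
    using that ij(1) \<open>i = 0\<close> by (cases k) (auto simp: pure_def wt_def zero_prod_def)
  then have "part (\<lambda>k. k = 0) u = u" by (intro part_eq_self)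
  moreover have "part (\<lambda>k. k = 0) u = coef (lookup u 0)"
    by (rule poly_mapping_eqI) (simp add: lookup_part lookup_single when_def)
  ultimately show ?thesis by simp
qed

lemma dvd_mon:
  fixes u :: "'m::cancel_comm_monoid_add \<Rightarrow>\<^sub>0 'a::comm_ring_1"
  assumes "\<And>k. k \<in> keys u \<Longrightarrow> \<exists>k'. k = n + k'"
  shows "mon n dvd u"
proof -
  have "mon n dvd Poly_Mapping.single k (lookup u k)" if "k \<in> keys u" for k
  proof -
    obtain k' where "k = n + k'" using assms \<open>k \<in> keys u\<close> by blast
    then have "Poly_Mapping.single k (lookup u k) = mon n * Poly_Mapping.single k' (lookup u k)"
      by (simp add: mult_single)
    then show ?thesis by (rule dvdI)
  qed
  then have "mon n dvd (\<Sum>k\<in>keys u. Poly_Mapping.single k (lookup u k))" by (rule dvd_sum)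
  then show ?thesis by (simp flip: poly_mapping_eq_sum_single)
qed

lemma keys_mon_mult: "k \<in> keys (mon n * u) \<Longrightarrow> \<exists>k'\<in>keys u. k = n + k'"
  using keys_multD[of k "mon n" u] by (auto split: if_splits)

section \<open>Multiplication matrices over \<open>k[w,z]\<close>\<close>

declare One_nat_def [simp del] \<comment> \<open>so that the exponent vectors of the variables keep their literal form\<close>

abbreviation vW :: "'k::zero_neq_one poly4" where "vW \<equiv> mon (1, 0, 0, 0)"
abbreviation vX :: "'k::zero_neq_one poly4" where "vX \<equiv> mon (0, 1, 0, 0)"
abbreviation vY :: "'k::zero_neq_one poly4" where "vY \<equiv> mon (0, 0, 1, 0)"
abbreviation vZ :: "'k::zero_neq_one poly4" where "vZ \<equiv> mon (0, 0, 0, 1)"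

fun degxy :: "mon4 \<Rightarrow> nat" where "degxy (a, b, c, d) = b + c"

text \<open>The sign makes the lowest component for \<open>wxy\<close> the part of top degree in x
  and y.\<close>

definition wxy :: "mon4 \<Rightarrow> int" where "wxy m = - int (degxy m)"

lemma weight_wxy: "weight wxy"
  by (auto simp: weight_def wxy_def)

text \<open>The subring k[w,z].\<close>

definition base_ring :: "'k::zero poly4 set" where
  "base_ring = {s. \<forall>m\<in>keys s. degxy m = 0}"

text \<open>The monomial ideal generated by w^2 and z^2; wz survives modulo it.\<close>

definition sq_ideal :: "'k::zero poly4 set" where
  "sq_ideal = {s. \<forall>(a, b, c, d)\<in>keys s. 2 \<le> a \<or> 2 \<le> d}"

lemma base_ring_0: "0 \<in> base_ring" and base_ring_1: "1 \<in> base_ring"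
  by (auto simp: base_ring_def zero_prod_def)

lemma base_ring_add: "s \<in> base_ring \<Longrightarrow> t \<in> base_ring \<Longrightarrow> s + t \<in> base_ring"
  unfolding base_ring_def by (auto dest!: keys_addD)

lemma base_ring_diff: "s \<in> base_ring \<Longrightarrow> t \<in> base_ring \<Longrightarrow> s - t \<in> base_ring"
  for s :: "'k::ab_group_add poly4"
  unfolding base_ring_def by (auto dest!: keys_diffD)

lemma degxy_add: "degxy (m + n) = degxy m + degxy n"
  by (cases m; cases n) simp

lemma base_ring_mult: "s \<in> base_ring \<Longrightarrow> t \<in> base_ring \<Longrightarrow> s * t \<in> base_ring"
proof -
  assume s: "s \<in> base_ring" and t: "t \<in> base_ring"
  have "degxy k = 0" if k: "k \<in> keys (s * t)" for k
  proof -
    from keys_multD[OF k] obtain i j where "i \<in> keys s" "j \<in> keys t" "k = i + j" by (elim bexE)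
    then show ?thesis using s t degxy_add[of i j] unfolding base_ring_def by simp
  qed
  then show "s * t \<in> base_ring" by (simp add: base_ring_def)
qed

lemma base_ring_single: "degxy m = 0 \<Longrightarrow> Poly_Mapping.single m r \<in> base_ring"
  by (simp add: base_ring_def)

lemma lookup_sq_ideal: "s \<in> sq_ideal \<Longrightarrow> lookup s (1, 0, 0, 1) = 0"
  unfolding sq_ideal_def by (rule ccontr) (auto simp flip: in_keys_iff)

lemma sq_ideal_0: "0 \<in> sq_ideal"
  by (simp add: sq_ideal_def)

lemma sq_ideal_add: "s \<in> sq_ideal \<Longrightarrow> t \<in> sq_ideal \<Longrightarrow> s + t \<in> sq_ideal"
  unfolding sq_ideal_def by (auto dest!: keys_addD)

lemma sq_ideal_mult: "t \<in> sq_ideal \<Longrightarrow> s * t \<in> sq_ideal"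
proof -
  assume t: "t \<in> sq_ideal"
  have "case k of (a, b, c, d) \<Rightarrow> 2 \<le> a \<or> 2 \<le> d" if k: "k \<in> keys (s * t)" for k
  proof -
    from keys_multD[OF k] obtain i j where "i \<in> keys s" "j \<in> keys t" "k = i + j" by (elim bexE)
    then show ?thesis using t by (cases i; cases j) (force simp: sq_ideal_def)
  qed
  then show "s * t \<in> sq_ideal" by (simp add: sq_ideal_def)
qed

lemma sq_ideal_sum: "(\<And>i. i \<in> A \<Longrightarrow> s i \<in> sq_ideal) \<Longrightarrow> sum s A \<in> sq_ideal"
  for s :: "'i \<Rightarrow> 'k::comm_monoid_add poly4"
  by (induction A rule: infinite_finite_induct) (auto simp: sq_ideal_0 sq_ideal_add)

lemma prod_cong_sq_ideal:
  fixes s t :: "'i \<Rightarrow> 'k::comm_ring_1 poly4"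
  assumes "finite A" and "\<And>i. i \<in> A \<Longrightarrow> s i - t i \<in> sq_ideal"
  shows "prod s A - prod t A \<in> sq_ideal"
  using assms
proof (induction A)
  case (insert i A)
  have "prod s (insert i A) - prod t (insert i A) =
      s i * (prod s A - prod t A) + prod t A * (s i - t i)"
    using insert.hyps by (simp add: algebra_simps)
  then show ?case using insert by (auto intro!: sq_ideal_add sq_ideal_mult)
qed (simp add: sq_ideal_0)

text \<open>The Leibniz formula is polynomial in the entries, so congruences pass to
  determinants.\<close>

lemma det_cong_sq_ideal:
  fixes A B :: "'k::comm_ring_1 poly4 mat"
  assumes "A \<in> carrier_mat n n" "B \<in> carrier_mat n n"
    and "\<And>i j. i < n \<Longrightarrow> j < n \<Longrightarrow> A $$ (i, j) - B $$ (i, j) \<in> sq_ideal"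
  shows "det A - det B \<in> sq_ideal"
proof -
  have "(\<Prod>i = 0..<n. A $$ (i, p i)) - (\<Prod>i = 0..<n. B $$ (i, p i)) \<in> sq_ideal"
    if p: "p permutes {0..<n}" for p
  proof (rule prod_cong_sq_ideal)
    fix i assume "i \<in> {0..<n}"
    then have "p i \<in> {0..<n}" using permutes_in_image[OF p] by blast
    then show "A $$ (i, p i) - B $$ (i, p i) \<in> sq_ideal" using assms(3) \<open>i \<in> {0..<n}\<close> by simp
  qed simp
  then show ?thesis
    unfolding det_def'[OF assms(1)] det_def'[OF assms(2)]
    by (simp flip: sum_subtractf right_diff_distrib) (intro sq_ideal_sum sq_ideal_mult, simp)
qed

lemma mon_powers: "vX ^ b * vY ^ e = (mon (0, b, e, 0) :: 'k::comm_ring_1 poly4)"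
proof -
  have "vX ^ b = (mon (0, b, 0, 0) :: 'k poly4)" by (induction b) (simp_all add: mult_single zero_prod_def plus_1_eq_Suc flip: single_one)
  moreover have "vY ^ e = (mon (0, 0, e, 0) :: 'k poly4)" by (induction e) (simp_all add: mult_single zero_prod_def plus_1_eq_Suc flip: single_one)
  ultimately show ?thesis by (simp add: mult_single)
qed

lemma vZ2: "vZ ^ 2 = (mon (0, 0, 0, 2) :: 'k::comm_ring_1 poly4)" and vW2: "vW ^ 2 = (mon (2, 0, 0, 0) :: 'k::comm_ring_1 poly4)"
  by (simp_all add: power2_eq_square mult_single)

lemma degxy_mult_less:
  fixes p q :: "'k::comm_ring_1 poly4"
  assumes "\<And>k. k \<in> keys p \<Longrightarrow> degxy k \<le> i" "\<And>k. k \<in> keys q \<Longrightarrow> degxy k < j" "k \<in> keys (p * q)"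
  shows "degxy k < i + j"
proof -
  from keys_multD[OF assms(3)] obtain a b where "a \<in> keys p" "b \<in> keys q" "k = a + b" by (elim bexE)
  then show ?thesis using assms(1)[of a] assms(2)[of b] by (simp add: degxy_add)
qed

lemma mon_neq_0: "mon k \<noteq> (0 :: 'k::comm_ring_1 poly4)"
proof
  assume "mon k = (0 :: 'k poly4)"
  then have "lookup (mon k :: 'k poly4) k = 0" by simp
  then show False by simp
qed

lemma lookup_mult_mon: "lookup (p * mon n) (k + n) = lookup (p :: 'k::comm_ring_1 poly4) k"
proof (induction p rule: poly_mapping_induct)
  case (single k' r)
  then show ?case by (simp add: mult_single lookup_single when_def)
qed (simp_all add: distrib_right lookup_add)

text \<open>The bounds on \<open>degxy\<close> make \<open>vY ^ c\<close> and \<open>vX ^ m\<close>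
  the top parts of \<open>f\<close> and \<open>g\<close> in x and y. The factors
  \<open>vZ ^ 2\<close> and \<open>vW ^ 2\<close> make the two generators pure powers modulo
  \<open>sq_ideal\<close>.\<close>

locale box_presentation =
  fixes f g f' g' :: "'k::field_char_0 poly4" and c m :: nat
  assumes f: "f = vY ^ c + vZ ^ 2 * f'" and g: "g = vX ^ m + vW ^ 2 * g'"
    and f'_deg: "\<And>k. k \<in> keys f' \<Longrightarrow> degxy k < c" and g'_deg: "\<And>k. k \<in> keys g' \<Longrightarrow> degxy k < m"
    and c_pos: "0 < c" and m_pos: "0 < m"
begin

section \<open>Coordinates over k[w,z] in the quotient by (f, g)\<close>

definition I :: "'k poly4 set" where "I = ideal_gen {f, g}"

lemma I_add: "a \<in> I \<Longrightarrow> b \<in> I \<Longrightarrow> a + b \<in> I" and I_mult: "a \<in> I \<Longrightarrow> r * a \<in> I" and I_0: "0 \<in> I"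
  unfolding I_def ideal_gen_def is_ideal_def by auto

lemma I_diff: "a \<in> I \<Longrightarrow> b \<in> I \<Longrightarrow> a - b \<in> I"
  using I_add[of a "(- 1) * b"] I_mult[of b "- 1"] by simp

lemma f_in_I: "f \<in> I" and g_in_I: "g \<in> I"
  unfolding I_def ideal_gen_def by auto

definition N :: nat where "N = m * c"

text \<open>The box of monomials x^b y^e is enumerated by \<open>b * c + e\<close>, so
  multiplication by xy raises the index by \<open>c + 1\<close> as long as it stays in the
  box.\<close>

definition bas :: "nat \<Rightarrow> 'k poly4" where "bas i = vX ^ (i div c) * vY ^ (i mod c)"

lemma bas_eq: "bas i = mon (0, i div c, i mod c, 0)"
  unfolding bas_def by (rule mon_powers)

lemma bas_index: "b < m \<Longrightarrow> e < c \<Longrightarrow> b * c + e < N \<and> bas (b * c + e) = vX ^ b * vY ^ e"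
proof -
  assume "b < m" "e < c"
  then have "b * c + e < b * c + c" by simp
  also have "b * c + c \<le> m * c" using \<open>b < m\<close> by (metis Suc_leI add.commute mult_Suc mult_le_mono1)
  finally show ?thesis using \<open>e < c\<close> by (simp add: N_def bas_def)
qed

lemma index_bounds: "i < N \<Longrightarrow> i div c < m \<and> i mod c < c"
  using c_pos by (simp add: N_def less_mult_imp_div_less)

text \<open>A relation, since existence (\<open>bas\<close> generates) and uniqueness
  (\<open>bas\<close> is independent modulo \<open>I\<close>) have separate proofs.\<close>

definition is_coords :: "'k poly4 \<Rightarrow> (nat \<Rightarrow> 'k poly4) \<Rightarrow> bool" where
  "is_coords r s \<longleftrightarrow> (\<forall>i<N. s i \<in> base_ring) \<and> r - (\<Sum>i<N. s i * bas i) \<in> I"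

lemma is_coords_add:
  assumes "is_coords r s" "is_coords r' s'"
  shows "is_coords (r + r') (\<lambda>i. s i + s' i)"
proof -
  have "r + r' - (\<Sum>i<N. (s i + s' i) * bas i) =
      (r - (\<Sum>i<N. s i * bas i)) + (r' - (\<Sum>i<N. s' i * bas i))"
    by (simp add: distrib_right sum.distrib)
  also have "\<dots> \<in> I" by (rule I_add) (use assms in \<open>simp_all add: is_coords_def\<close>)
  finally show ?thesis using assms unfolding is_coords_def by (simp add: base_ring_add)
qed

lemma is_coords_mult:
  assumes "is_coords r s" "t \<in> base_ring"
  shows "is_coords (t * r) (\<lambda>i. t * s i)"
proof -
  have "t * r - (\<Sum>i<N. (t * s i) * bas i) = t * (r - (\<Sum>i<N. s i * bas i))"
    by (simp add: right_diff_distrib sum_distrib_left mult.assoc)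
  then show ?thesis using assms unfolding is_coords_def by (auto intro: base_ring_mult I_mult)
qed

lemma is_coords_cong:
  assumes "is_coords r s" "r' - r \<in> I"
  shows "is_coords r' s"
proof -
  have "r' - (\<Sum>i<N. s i * bas i) = (r' - r) + (r - (\<Sum>i<N. s i * bas i))" by simp
  moreover have "(r' - r) + (r - (\<Sum>i<N. s i * bas i)) \<in> I"
    using assms unfolding is_coords_def by (intro I_add) simp_all
  ultimately show ?thesis using assms unfolding is_coords_def by simp
qed

lemma is_coords_sum:
  assumes "\<And>j. j \<in> A \<Longrightarrow> is_coords (r j) (s j)"
  shows "is_coords (\<Sum>j\<in>A. r j) (\<lambda>i. \<Sum>j\<in>A. s j i)"
proof (cases "finite A")
  case True
  then show ?thesis using assms
  proof (induction A)
    case empty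
    show ?case by (simp add: is_coords_def I_0 base_ring_0)
  next
    case (insert x A)
    then show ?case using is_coords_add[of "r x" "s x" "sum r A"] by simp
  qed
qed (simp add: is_coords_def I_0 base_ring_0)

lemma is_coords_bas: "i < N \<Longrightarrow> is_coords (bas i) (\<lambda>j. if j = i then 1 else 0)"
  unfolding is_coords_def by (simp add: base_ring_0 base_ring_1 I_0 sum.delta' if_distrib[of "\<lambda>x. x * _"] cong: if_cong)

lemma single_split: "Poly_Mapping.single (a, b, e, d) r =
    Poly_Mapping.single (a, 0, 0, d) r * (vX ^ b * vY ^ e :: 'k poly4)"
  unfolding mon_powers by (simp add: mult_single)

text \<open>Coordinates are k[w,z]-linear, so the monomials in x and y alone suffice.\<close>

lemma coords_exist_aux:
  "(\<forall>b e. b + e < n \<longrightarrow> (\<exists>s. is_coords (vX ^ b * vY ^ e) s)) \<Longrightarrow>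
   (\<And>k. k \<in> keys p \<Longrightarrow> degxy k < n) \<Longrightarrow> \<exists>s. is_coords p s"
proof -
  assume mon: "\<forall>b e. b + e < n \<longrightarrow> (\<exists>s. is_coords (vX ^ b * vY ^ e) s)"
    and p: "\<And>k. k \<in> keys p \<Longrightarrow> degxy k < n"
  have "\<exists>s. is_coords (Poly_Mapping.single k (lookup p k)) s" if k: "k \<in> keys p" for k
  proof -
    obtain a b e d where abed: "k = (a, b, e, d)" by (cases k)
    with p[OF k] mon obtain s where "is_coords (vX ^ b * vY ^ e) s" by auto
    then have "is_coords (Poly_Mapping.single k (lookup p k))
        (\<lambda>i. Poly_Mapping.single (a, 0, 0, d) (lookup p k) * s i)"
      unfolding abed single_split[of a b e d] by (rule is_coords_mult) (simp add: base_ring_single)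
    then show ?thesis by blast
  qed
  then have "\<forall>k\<in>keys p. \<exists>s. is_coords (Poly_Mapping.single k (lookup p k)) s" by simp
  from bchoice[OF this] obtain s
    where s: "\<forall>k\<in>keys p. is_coords (Poly_Mapping.single k (lookup p k)) (s k)" by (elim exE)
  have "is_coords (\<Sum>k\<in>keys p. Poly_Mapping.single k (lookup p k)) (\<lambda>i. \<Sum>k\<in>keys p. s k i)"
    by (rule is_coords_sum) (use s in simp)
  then show ?thesis unfolding poly_mapping_eq_sum_single[symmetric] by (intro exI)
qed

text \<open>Outside the box, y^c is replaced by \<open>- (vZ ^ 2 * f')\<close> or x^m by
  \<open>- (vW ^ 2 * g')\<close>; either step lowers the degree in x and y.\<close>

lemma coords_exist_mon: "\<exists>s. is_coords (vX ^ b * vY ^ e) s"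
proof (induction "b + e" arbitrary: b e rule: less_induct)
  case less
  have mon: "\<forall>b' e'. b' + e' < b + e \<longrightarrow> (\<exists>s. is_coords (vX ^ b' * vY ^ e') s)"
    using less by blast
  consider "b < m" "e < c" | "c \<le> e" | "m \<le> b" by linarith
  then show ?case
  proof cases
    case 1
    then show ?thesis using bas_index[OF 1] is_coords_bas by metis
  next
    case 2
    let ?p = "mon (0, b, e - c, 2) * f'"
    have "vX ^ b * vY ^ e = (mon (0, b, e - c, 0) * vY ^ c :: 'k poly4)"
      unfolding mon_powers[of b "e - c", symmetric] using 2 by (simp add: mult.assoc flip: power_add)
    moreover have "?p = mon (0, b, e - c, 0) * (vZ ^ 2 * f')"
      unfolding vZ2 mult.assoc[symmetric] by (simp add: mult_single numeral_2_eq_2)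
    ultimately have "vX ^ b * vY ^ e - (- ?p) = mon (0, b, e - c, 0) * f"
      unfolding f by (simp add: distrib_left)
    then have cong: "vX ^ b * vY ^ e - (- ?p) \<in> I" using I_mult[OF f_in_I] by simp
    have "degxy k < b + e" if "k \<in> keys (- ?p)" for k
      using degxy_mult_less[of "mon (0, b, e - c, 2)" "b + (e - c)" f' c k] f'_deg that 2
      by (auto simp: in_keys_iff split: if_splits)
    from coords_exist_aux[OF mon this] obtain s where "is_coords (- ?p) s" by blast
    from is_coords_cong[OF this cong] show ?thesis by blast
  next
    case 3
    let ?p = "mon (2, b - m, e, 0) * g'"
    have "vX ^ b * vY ^ e = (mon (0, b - m, e, 0) * vX ^ m :: 'k poly4)"
      unfolding mon_powers[of "b - m" e, symmetric] using 3
      by (simp add: mult.commute[of _ "vX ^ m"] flip: power_add mult.assoc)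
    moreover have "?p = mon (0, b - m, e, 0) * (vW ^ 2 * g')"
      unfolding vW2 mult.assoc[symmetric] by (simp add: mult_single numeral_2_eq_2)
    ultimately have "vX ^ b * vY ^ e - (- ?p) = mon (0, b - m, e, 0) * g"
      unfolding g by (simp add: distrib_left)
    then have cong: "vX ^ b * vY ^ e - (- ?p) \<in> I" using I_mult[OF g_in_I] by simp
    have "degxy k < b + e" if "k \<in> keys (- ?p)" for k
      using degxy_mult_less[of "mon (2, b - m, e, 0)" "(b - m) + e" g' m k] g'_deg that 3
      by (auto simp: in_keys_iff split: if_splits)
    from coords_exist_aux[OF mon this] obtain s where "is_coords (- ?p) s" by blast
    from is_coords_cong[OF this cong] show ?thesis by blast
  qed
qed

lemma coords_exist: "\<exists>s. is_coords p s"
proof -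
  have "degxy k < Suc (Max (degxy ` keys p))" if "k \<in> keys p" for k
    using that by (simp add: le_imp_less_Suc)
  with coords_exist_aux[of "Suc (Max (degxy ` keys p))" p] coords_exist_mon show ?thesis by blast
qed

text \<open>The factor 1 takes the place of the common factor \<open>h\<close> in
  \<open>initial_form_power_multiple\<close>.\<close>

lemma low_f: "low wxy (- int c) f" "part (\<lambda>k. wxy k = - int c) f = 1 * vY ^ c"
proof -
  have deg: "degxy k < c" if "k \<in> keys (vZ ^ 2 * f')" for k
    using degxy_mult_less[of "vZ ^ 2" 0 f' c k] f'_deg that by (auto simp: vZ2)
  have "vY ^ c = (mon (0, 0, c, 0) :: 'k poly4)" using mon_powers[of 0 c] by simp
  then have p: "pure wxy (- int c) (vY ^ c :: 'k poly4)" by (simp add: pure_single wxy_def)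
  have l: "low wxy (- int c + 1) (vZ ^ 2 * f')" using deg by (force simp: low_def wxy_def)
  show "low wxy (- int c) f"
    unfolding f by (intro low_add pure_imp_low[OF p] low_mono[OF l]) simp
  show "part (\<lambda>k. wxy k = - int c) f = 1 * vY ^ c"
    unfolding f part_add using part_of_pure[OF p] part_of_low[OF l] by simp
qed

lemma low_g: "low wxy (- int m) g" "part (\<lambda>k. wxy k = - int m) g = 1 * vX ^ m"
proof -
  have deg: "degxy k < m" if "k \<in> keys (vW ^ 2 * g')" for k
    using degxy_mult_less[of "vW ^ 2" 0 g' m k] g'_deg that by (auto simp: vW2)
  have "vX ^ m = (mon (0, m, 0, 0) :: 'k poly4)" using mon_powers[of m 0] by simp
  then have p: "pure wxy (- int m) (vX ^ m :: 'k poly4)" by (simp add: pure_single wxy_def)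
  have l: "low wxy (- int m + 1) (vW ^ 2 * g')" using deg by (force simp: low_def wxy_def)
  show "low wxy (- int m) g"
    unfolding g by (intro low_add pure_imp_low[OF p] low_mono[OF l]) simp
  show "part (\<lambda>k. wxy k = - int m) g = 1 * vX ^ m"
    unfolding g part_add using part_of_pure[OF p] part_of_low[OF l] by simp
qed

lemma vY_vX_coprime: "vY ^ c * u = vX ^ m * v \<Longrightarrow> vX ^ m dvd (u :: 'k poly4)"
proof -
  assume eq: "vY ^ c * u = vX ^ m * v"
  have Y: "vY ^ c = (mon (0, 0, c, 0) :: 'k poly4)" and X: "vX ^ m = (mon (0, m, 0, 0) :: 'k poly4)"
    using mon_powers[of 0 c] mon_powers[of m 0] by simp_all
  show ?thesis unfolding X
  proof (rule dvd_mon)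
    fix k assume k: "k \<in> keys u"
    then have "k + (0, 0, c, 0) \<in> keys (u * mon (0, 0, c, 0))"
      using lookup_mult_mon[of u "(0, 0, c, 0)" k] by (simp add: in_keys_iff)
    also have "u * mon (0, 0, c, 0) = mon (0, m, 0, 0) * v" using eq unfolding X Y by (simp add: mult.commute)
    finally obtain k' where "k + (0, 0, c, 0) = (0, m, 0, 0) + k'" using keys_mon_mult by blast
    then have "k = (0, m, 0, 0) + (fst k', fst (snd k') , fst (snd (snd k')) - c, snd (snd (snd k')))"
      by (cases k; cases k') auto
    then show "\<exists>k'. k = (0, m, 0, 0) + k'" by blast
  qed
qed

lemma base_ring_keys: "s \<in> base_ring \<Longrightarrow> k \<in> keys s \<Longrightarrow> \<exists>a d. k = (a, 0, 0, d)"
  unfolding base_ring_def by (cases k) auto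

text \<open>Powers of x and y are coprime, so the part of top degree in x and y of any element of
  \<open>I\<close> lies in the ideal of x^m and y^c. No monomial of the sum is divisible by either,
  so the sum is zero as a polynomial.\<close>

lemma coords_zero:
  assumes t: "\<And>i. i < N \<Longrightarrow> t i \<in> base_ring" and r: "(\<Sum>i<N. t i * bas i) \<in> I" and i: "i < N"
  shows "t i = 0"
proof -
  define r0 where "r0 = (\<Sum>i<N. t i * bas i)"
  have "r0 = 0"
  proof (rule ccontr)
    assume "r0 \<noteq> 0"
    then obtain l where l: "low wxy l r0" "part (\<lambda>k. wxy k = l) r0 \<noteq> 0" by (rule lowest_component)
    have nz: "1 * vY ^ c \<noteq> (0 :: 'k poly4)" "1 * vX ^ m \<noteq> (0 :: 'k poly4)"
      by (simp_all add: mon_neq_0)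
    have "\<exists>n. 1 ^ n * part (\<lambda>k. wxy k = l) r0 \<in> ideal_gen {1 * vY ^ c, 1 * vX ^ m}"
      by (rule initial_form_power_multiple[OF weight_wxy low_f low_g nz _ _ l(1)])
        (use r vY_vX_coprime in \<open>simp_all add: I_def r0_def\<close>)
    then obtain u v where uv: "part (\<lambda>k. wxy k = l) r0 = u * vY ^ c + v * vX ^ m"
      unfolding ideal_gen_pair by auto
    obtain k where k: "k \<in> keys (part (\<lambda>k. wxy k = l) r0)" using l(2) by (metis ex_in_conv keys_eq_empty)
    then have "k \<in> keys r0" by (simp add: keys_part)
    then have "lookup r0 k \<noteq> 0" by (simp add: in_keys_iff)
    then obtain j where j: "j < N" "lookup (t j * bas j) k \<noteq> 0"
      unfolding r0_def lookup_sum by (metis (no_types, lifting) lessThan_iff sum.neutral)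
    then have "k \<in> keys (bas j * t j)" by (simp add: in_keys_iff mult.commute)
    then obtain k' where "k' \<in> keys (t j)" "k = (0, j div c, j mod c, 0) + k'"
      unfolding bas_eq using keys_mon_mult by blast
    then obtain a d where kk: "k = (a, j div c, j mod c, d)" using base_ring_keys[OF t[OF j(1)]] by fastforce
    have Y: "vY ^ c = (mon (0, 0, c, 0) :: 'k poly4)" and X: "vX ^ m = (mon (0, m, 0, 0) :: 'k poly4)"
      using mon_powers[of 0 c] mon_powers[of m 0] by simp_all
    from k have "k \<in> keys (mon (0, 0, c, 0) * u) \<or> k \<in> keys (mon (0, m, 0, 0) * v)"
      unfolding uv X Y using keys_addD by (metis mult.commute)
    then have "(\<exists>k'. k = (0, 0, c, 0) + k') \<or> (\<exists>k'. k = (0, m, 0, 0) + k')"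
      using keys_mon_mult by blast
    then have "c \<le> j mod c \<or> m \<le> j div c" unfolding kk by auto
    then show False using index_bounds[OF j(1)] by linarith
  qed
  \<comment> \<open>Different basis monomials have different exponents in x and y, so the summands
    of the zero polynomial have disjoint supports.\<close>
  have "lookup (t i) k = 0" for k
  proof (cases "k \<in> keys (t i)")
    case True
    then obtain a d where k: "k = (a, 0, 0, d)" using base_ring_keys[OF t[OF i]] by blast
    let ?k = "k + (0, i div c, i mod c, 0)"
    have "lookup (t j * bas j) ?k = 0" if j: "j < N" "j \<noteq> i" for j
    proof (rule ccontr)
      assume "lookup (t j * bas j) ?k \<noteq> 0"
      then have "?k \<in> keys (bas j * t j)" by (simp add: in_keys_iff mult.commute)
      then obtain k' where k': "k' \<in> keys (t j)" "?k = (0, j div c, j mod c, 0) + k'"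
        unfolding bas_eq using keys_mon_mult by blast
      moreover obtain a' d' where "k' = (a', 0, 0, d')" using base_ring_keys[OF t[OF j(1)] k'(1)] by blast
      ultimately have "i div c = j div c" "i mod c = j mod c" using k by auto
      then show False using \<open>j \<noteq> i\<close> by (metis div_mult_mod_eq)
    qed
    then have "lookup r0 ?k = (\<Sum>j<N. if j = i then lookup (t i * bas i) ?k else 0)"
      unfolding r0_def lookup_sum by (intro sum.cong) auto
    also have "\<dots> = lookup (t i * bas i) ?k" using i by simp
    also have "\<dots> = lookup (t i) k" unfolding bas_eq by (rule lookup_mult_mon)
    finally show ?thesis using \<open>r0 = 0\<close> by simp
  qed (simp add: in_keys_iff)
  then show ?thesis by (intro poly_mapping_eqI) simp
qed

lemma coords_unique:
  assumes s: "is_coords r s" and s': "is_coords r s'" and i: "i < N"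
  shows "s i = s' i"
proof -
  have "(\<Sum>i<N. (s i - s' i) * bas i) = (r - (\<Sum>i<N. s' i * bas i)) - (r - (\<Sum>i<N. s i * bas i))"
    by (simp add: left_diff_distrib sum_subtractf)
  also have "\<dots> \<in> I" by (rule I_diff) (use s s' in \<open>simp_all add: is_coords_def\<close>)
  finally have "s i - s' i = 0"
    by (rule coords_zero[OF _ _ i, rotated]) (use s s' in \<open>simp add: is_coords_def base_ring_diff\<close>)
  then show ?thesis by simp
qed

section \<open>The determinant of multiplication by 1 + xy - wz\<close>

definition cf :: "'k poly4 \<Rightarrow> nat \<Rightarrow> 'k poly4" where "cf r = (SOME s. is_coords r s)"

lemma is_coords_cf: "is_coords r (cf r)"
  unfolding cf_def using coords_exist by (rule someI_ex)

lemma cf_eq: "is_coords r s \<Longrightarrow> i < N \<Longrightarrow> cf r i = s i"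
  using coords_unique[OF is_coords_cf] by blast

definition mult_mat :: "'k poly4 \<Rightarrow> 'k poly4 mat" where
  "mult_mat p = mat N N (\<lambda>(i, j). cf (p * bas i) j)"

lemma mult_mat_carrier: "mult_mat p \<in> carrier_mat N N"
  by (simp add: mult_mat_def)

lemma mult_mat_mult: "mult_mat p * mult_mat q = mult_mat (p * q)"
proof (rule eq_matI)
  fix i j assume "i < dim_row (mult_mat (p * q))" "j < dim_col (mult_mat (p * q))"
  then have ij: "i < N" "j < N" by (simp_all add: mult_mat_def)
  let ?s = "\<lambda>j. \<Sum>k<N. cf (p * bas i) k * cf (q * bas k) j"
  have base: "cf (p * bas i) k \<in> base_ring" if "k < N" for k
    using is_coords_cf that by (simp add: is_coords_def)
  have "is_coords (\<Sum>k<N. cf (p * bas i) k * (q * bas k)) ?s"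
    by (intro is_coords_sum is_coords_mult is_coords_cf base) simp
  moreover have "p * q * bas i - (\<Sum>k<N. cf (p * bas i) k * (q * bas k)) \<in> I"
  proof -
    have "p * q * bas i - (\<Sum>k<N. cf (p * bas i) k * (q * bas k)) =
        q * (p * bas i - (\<Sum>k<N. cf (p * bas i) k * bas k))"
      by (simp add: right_diff_distrib sum_distrib_left ac_simps)
    also have "\<dots> \<in> I"
      by (rule I_mult) (use is_coords_cf[of "p * bas i"] in \<open>simp add: is_coords_def\<close>)
    finally show ?thesis .
  qed
  ultimately have coords: "is_coords (p * q * bas i) ?s" by (rule is_coords_cong)
  show "(mult_mat p * mult_mat q) $$ (i, j) = mult_mat (p * q) $$ (i, j)"
    using ij cf_eq[OF coords ij(2)] by (simp add: mult_mat_def scalar_prod_def atLeast0LessThan)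
qed (simp_all add: mult_mat_def)

lemma mult_mat_one:
  assumes "p - 1 \<in> I"
  shows "mult_mat p = 1\<^sub>m N"
proof (rule eq_matI)
  fix i j assume "i < dim_row (1\<^sub>m N :: 'k poly4 mat)" "j < dim_col (1\<^sub>m N :: 'k poly4 mat)"
  then have ij: "i < N" "j < N" by simp_all
  have "p * bas i - bas i = bas i * (p - 1)" by (simp add: algebra_simps)
  also have "\<dots> \<in> I" by (rule I_mult[OF assms])
  finally have "is_coords (p * bas i) (\<lambda>j. if j = i then 1 else 0)"
    by (rule is_coords_cong[OF is_coords_bas[OF ij(1)]])
  from cf_eq[OF this ij(2)] show "mult_mat p $$ (i, j) = 1\<^sub>m N $$ (i, j)"
    using ij by (simp add: mult_mat_def)
qed (simp_all add: mult_mat_def)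

text \<open>The matrix of multiplication by 1 + xy - wz after reduction modulo w^2 and z^2: x^b y^e
  goes to (1 - wz) x^b y^e plus x^(b+1) y^(e+1), and the second term is dropped when it leaves the
  box.\<close>

definition tri_mat :: "'k poly4 mat" where
  "tri_mat = mat N N (\<lambda>(i, j). if i = j then 1 - vW * vZ
     else if j = i + c + 1 \<and> i mod c + 1 < c \<and> i div c + 1 < m then 1 else 0)"

lemma tri_mat_carrier: "tri_mat \<in> carrier_mat N N"
  by (simp add: tri_mat_def)

lemma det_tri_mat: "det tri_mat = (1 - vW * vZ) ^ N"
proof -
  have "upper_triangular tri_mat" by (auto simp: upper_triangular_def tri_mat_def)
  then have "det tri_mat = prod_list (diag_mat tri_mat)" by (rule det_upper_triangular[OF _ tri_mat_carrier])
  also have "diag_mat tri_mat = map (\<lambda>i. 1 - vW * vZ) [0..<N]"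
    unfolding diag_mat_def by (rule map_cong) (auto simp: tri_mat_def)
  also have "prod_list \<dots> = (1 - vW * vZ) ^ N" by (simp add: map_replicate_const)
  finally show ?thesis .
qed

lemma mult_mat_cong_tri_mat:
  assumes ij: "i < N" "j < N"
  shows "mult_mat (1 + (vX * vY - vW * vZ)) $$ (i, j) - tri_mat $$ (i, j) \<in> sq_ideal"
proof -
  define b e where "b = i div c" and "e = i mod c"
  let ?p = "1 + (vX * vY - vW * vZ) :: 'k poly4"
  let ?\<delta> = "\<lambda>i j. if j = i then 1 else 0 :: 'k poly4"
  have be: "b < m" "e < c" using index_bounds[OF ij(1)] by (simp_all add: b_def e_def)
  have i_eq: "i = b * c + e" by (simp add: b_def e_def)
  have base: "1 - vW * vZ \<in> (base_ring :: 'k poly4 set)" "vZ ^ 2 \<in> (base_ring :: 'k poly4 set)"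
    "vW ^ 2 \<in> (base_ring :: 'k poly4 set)"
    unfolding vZ2 vW2 by (auto intro!: base_ring_diff base_ring_1 base_ring_mult base_ring_single)
  have diag: "is_coords ((1 - vW * vZ) * bas i) (\<lambda>j. (1 - vW * vZ) * ?\<delta> i j)"
    by (intro is_coords_mult is_coords_bas ij base)
  have p: "?p * bas i = (1 - vW * vZ) * bas i + vX ^ (b + 1) * vY ^ (e + 1)"
    unfolding bas_def b_def e_def by (simp add: algebra_simps power_add)
  show ?thesis
  proof (cases "b + 1 < m \<and> e + 1 < c")
    case True
    have "(b + 1) * c + (e + 1) = i + c + 1" by (simp add: i_eq algebra_simps)
    with bas_index[of "b + 1" "e + 1"] True
    have "i + c + 1 < N" "bas (i + c + 1) = vX ^ (b + 1) * vY ^ (e + 1)" by metis+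
    with is_coords_add[OF diag is_coords_bas[of "i + c + 1"]]
    have "is_coords (?p * bas i) (\<lambda>j. (1 - vW * vZ) * ?\<delta> i j + ?\<delta> (i + c + 1) j)"
      unfolding p by simp
    from cf_eq[OF this ij(2)] show ?thesis
      using ij True by (auto simp: mult_mat_def tri_mat_def b_def e_def sq_ideal_0)
  next
    case False
    \<comment> \<open>A monomial leaving the box contains y^c or x^m, which \<open>f\<close> or
      \<open>g\<close> turns into a multiple of z^2 or w^2.\<close>
    have "\<exists>q t. (q = vZ ^ 2 \<or> q = vW ^ 2) \<and> vX ^ (b + 1) * vY ^ (e + 1) - q * t \<in> I"
    proof (cases "e + 1 = c")
      case True
      have "vX ^ (b + 1) * vY ^ (e + 1) - vZ ^ 2 * (- (vX ^ (b + 1) * f')) = vX ^ (b + 1) * f"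
        unfolding f True by (simp add: algebra_simps)
      then have "vX ^ (b + 1) * vY ^ (e + 1) - vZ ^ 2 * (- (vX ^ (b + 1) * f')) \<in> I"
        using I_mult[OF f_in_I] by simp
      then show ?thesis by blast
    next
      case e: False
      with False be have m: "b + 1 = m" by linarith
      have "vX ^ (b + 1) * vY ^ (e + 1) - vW ^ 2 * (- (vY ^ (e + 1) * g')) = vY ^ (e + 1) * g"
        unfolding g m by (simp add: algebra_simps)
      then have "vX ^ (b + 1) * vY ^ (e + 1) - vW ^ 2 * (- (vY ^ (e + 1) * g')) \<in> I"
        using I_mult[OF g_in_I] by simp
      then show ?thesis by blast
    qed
    then obtain q t where q: "q = vZ ^ 2 \<or> q = vW ^ 2" "vX ^ (b + 1) * vY ^ (e + 1) - q * t \<in> I" by blast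
    have "is_coords (q * t) (\<lambda>j. q * cf t j)" by (rule is_coords_mult[OF is_coords_cf]) (use q base in auto)
    from is_coords_add[OF diag is_coords_cong[OF this q(2)]]
    have "cf (?p * bas i) j = (1 - vW * vZ) * ?\<delta> i j + q * cf t j"
      unfolding p by (rule cf_eq[OF _ ij(2)])
    moreover have "q \<in> sq_ideal" using q(1) unfolding vZ2 vW2 by (auto simp: sq_ideal_def)
    then have "q * cf t j \<in> sq_ideal" using sq_ideal_mult[of q "cf t j"] by (simp add: mult.commute)
    ultimately show ?thesis
      using ij False by (auto simp: mult_mat_def tri_mat_def b_def e_def)
  qed
qed

text \<open>Only the linear term in wz of the binomial expansion survives, because (wz)^2 lies in
  \<open>sq_ideal\<close>.\<close>

lemma power_one_minus_cong:
  "(1 - vW * vZ) ^ n - (1 - Poly_Mapping.single (1, 0, 0, 1) (of_nat n)) \<in> (sq_ideal :: 'k poly4 set)"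
proof (induction n)
  case 0
  then show ?case by (simp add: sq_ideal_0)
next
  case (Suc n)
  let ?q = "vW * vZ :: 'k poly4"
  let ?s = "\<lambda>n. Poly_Mapping.single (1, 0, 0, 1) (of_nat n) :: 'k poly4"
  have q: "?q = ?s 1" by (simp add: mult_single)
  have "?s (Suc n) = ?s n + ?q" by (simp add: q add.commute flip: single_add)
  then have "(1 - ?q) ^ Suc n - (1 - ?s (Suc n)) =
      (1 - ?q) * ((1 - ?q) ^ n - (1 - ?s n)) + ?q * ?s n"
    by (simp add: algebra_simps)
  moreover have "?q * ?s n \<in> sq_ideal" by (auto simp: mult_single sq_ideal_def)
  ultimately show ?case using Suc by (auto intro!: sq_ideal_add sq_ideal_mult)
qed

text \<open>Multiplication by \<open>1 + (xy - wz)\<close> is invertible on the free \<open>k[w,z]\<close>-module \<open>R/(f,g)\<close> when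
  \<open>xy - wz\<close> is nilpotent there, so its determinant is a nonzero constant; but modulo
  \<open>(w\<^sup>2, z\<^sup>2)\<close> this determinant is \<open>1 - c m w z\<close>.\<close>

theorem not_nilpotent: "(vX * vY - vW * vZ) ^ n \<notin> I"
proof
  define e where "e = (vX * vY - vW * vZ :: 'k poly4)"
  assume "(vX * vY - vW * vZ) ^ n \<in> I"
  then have en: "e ^ n \<in> I" by (simp add: e_def)
  \<comment> \<open>The finite geometric series, an inverse of \<open>1 + e\<close> modulo
    \<open>I\<close>.\<close>
  define q where "q = (\<Sum>k<n. (- e) ^ k)"
  have "1 - (- e) ^ n = (1 + e) * q" using one_diff_power_eq[of "- e" n] by (simp add: q_def)
  then have "(1 + e) * q - 1 = - ((- e) ^ n)" by (simp add: algebra_simps)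
  also have "\<dots> = (- ((- 1) ^ n)) * e ^ n" using power_minus[of e n] by simp
  also have "\<dots> \<in> I" by (rule I_mult[OF en])
  finally have "mult_mat (1 + e) * mult_mat q = 1\<^sub>m N" unfolding mult_mat_mult by (rule mult_mat_one)
  then have "det (mult_mat (1 + e)) * det (mult_mat q) = 1"
    using det_mult[OF mult_mat_carrier mult_mat_carrier] by (metis det_one)
  then have "det (mult_mat (1 + e)) dvd 1" by (metis dvd_triv_left)
  then obtain r where r: "det (mult_mat (1 + e)) = coef r" using unit_poly4 by blast
  have "det (mult_mat (1 + e)) - det tri_mat \<in> sq_ideal"
    unfolding e_def
    by (rule det_cong_sq_ideal[OF mult_mat_carrier tri_mat_carrier mult_mat_cong_tri_mat])
  then have "(coef r - (1 - vW * vZ) ^ N) + ((1 - vW * vZ) ^ N - (1 - Poly_Mapping.single (1, 0, 0, 1) (of_nat N)))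
      \<in> sq_ideal"
    unfolding r det_tri_mat by (rule sq_ideal_add[OF _ power_one_minus_cong])
  then have "coef r - 1 + Poly_Mapping.single (1, 0, 0, 1) (of_nat N) \<in> sq_ideal"
    by (simp add: algebra_simps)
  \<comment> \<open>The coefficient of wz is zero in the constant determinant and congruent to
    \<open>- of_nat N\<close>; characteristic zero rules this out.\<close>
  then have "lookup (coef r - 1 + Poly_Mapping.single (1, 0, 0, 1) (of_nat N) :: 'k poly4) (1, 0, 0, 1) = 0"
    by (rule lookup_sq_ideal)
  then have "(of_nat N :: 'k) = 0"
    by (simp add: lookup_add lookup_minus lookup_single lookup_one zero_prod_def)
  then show False using c_pos m_pos by (simp add: N_def)
qed

end

section \<open>Dimension of the homogeneous parts\<close>

context vector_space
begin

text \<open>A basis of the common subspace is extended to bases of both spaces; the finite set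
  \<open>F\<close> keeps all of them finite.\<close>

lemma dim_sum_bases:
  assumes U: "subspace U" and V: "subspace V" and W: "subspace W" "W \<subseteq> U" "W \<subseteq> V"
    and fin: "U \<subseteq> span F" "V \<subseteq> span F" "finite F"
  obtains B C D where "finite C" "finite D" "B \<subseteq> C" "B \<subseteq> D" "independent C" "independent D"
    "span B = W" "span C = U" "span D = V" "card B = dim W" "card C = dim U" "card D = dim V"
proof -
  obtain B where B: "B \<subseteq> W" "independent B" "W \<subseteq> span B" "card B = dim W" by (rule basis_exists)
  obtain C where C: "B \<subseteq> C" "C \<subseteq> U" "independent C" "U \<subseteq> span C"
    using maximal_independent_subset_extend[of B U] B(1,2) W(2) by auto
  obtain D where D: "B \<subseteq> D" "D \<subseteq> V" "independent D" "V \<subseteq> span D"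
    using maximal_independent_subset_extend[of B V] B(1,2) W(3) by auto
  show thesis
  proof (rule that[of C D B])
    show "finite C" using independent_span_bound[OF fin(3) C(3)] C(2) fin(1) by auto
    show "finite D" using independent_span_bound[OF fin(3) D(3)] D(2) fin(2) by auto
    show "span B = W" using B(1,3) span_minimal[OF _ W(1)] by auto
    show "span C = U" using C(2,4) span_minimal[OF _ U] by auto
    show "span D = V" using D(2,4) span_minimal[OF _ V] by auto
    show "card C = dim U" by (rule basis_card_eq_dim[OF C(2,4,3)])
    show "card D = dim V" by (rule basis_card_eq_dim[OF D(2,4,3)])
  qed (use B C D in auto)
qed

lemma dim_sum_le:
  assumes U: "subspace U" and V: "subspace V" and W: "subspace W" "W \<subseteq> U" "W \<subseteq> V"
    and fin: "U \<subseteq> span F" "V \<subseteq> span F" "finite F"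
  shows "dim {x + y | x y. x \<in> U \<and> y \<in> V} + dim W \<le> dim U + dim V"
proof -
  obtain B C D where *: "finite C" "finite D" "B \<subseteq> C" "B \<subseteq> D" "independent C" "independent D"
    "span B = W" "span C = U" "span D = V" "card B = dim W" "card C = dim U" "card D = dim V"
    by (rule dim_sum_bases[OF assms])
  have "D \<subseteq> span (C \<union> (D - B))" using *(3) span_superset[of "C \<union> (D - B)"] by blast
  then have "V \<subseteq> span (C \<union> (D - B))" unfolding *(9)[symmetric] by (rule span_minimal[OF _ subspace_span])
  moreover have "U \<subseteq> span (C \<union> (D - B))" unfolding *(8)[symmetric] by (rule span_mono) simp
  ultimately have "{x + y | x y. x \<in> U \<and> y \<in> V} \<subseteq> span (C \<union> (D - B))"
    by (auto intro: span_add)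
  then have "dim {x + y | x y. x \<in> U \<and> y \<in> V} \<le> card (C \<union> (D - B))"
    by (rule dim_le_card) (use * in simp)
  also have "\<dots> \<le> card C + card (D - B)" by (rule card_Un_le)
  also have "card (D - B) = card D - card B" using * by (intro card_Diff_subset) (auto intro: finite_subset)
  finally show ?thesis using card_mono[OF *(2,4)] *(10-12) by linarith
qed

lemma dim_sum_ge:
  assumes U: "subspace U" and V: "subspace V"
    and fin: "U \<subseteq> span F" "V \<subseteq> span F" "finite F"
  shows "dim U + dim V \<le> dim {x + y | x y. x \<in> U \<and> y \<in> V} + dim (U \<inter> V)"
proof -
  let ?S = "{x + y | x y. x \<in> U \<and> y \<in> V}"
  obtain B C D where *: "finite C" "finite D" "B \<subseteq> C" "B \<subseteq> D" "independent C" "independent D"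
    "span B = U \<inter> V" "span C = U" "span D = V" "card B = dim (U \<inter> V)" "card C = dim U" "card D = dim V"
    by (rule dim_sum_bases[OF U V subspace_inter[OF U V] _ _ fin]) auto
  have finB: "finite B" using *(1,3) by (rule rev_finite_subset)
  \<comment> \<open>The relation puts its part over \<open>D - B\<close> into both \<open>U\<close>
    and \<open>V\<close>, hence into the span of \<open>B\<close>. Expanding it there gives a
    relation within \<open>D\<close>, so the coefficients \<open>e\<close> vanish, and then
    \<open>c\<close> by independence of \<open>C\<close>.\<close>
  have zero: "(\<forall>x\<in>C. c x = 0) \<and> (\<forall>x\<in>D - B. e x = 0)"
    if 0: "(\<Sum>x\<in>C. c x *s x) + (\<Sum>x\<in>D - B. e x *s x) = 0" for c e
  proof -
    let ?t = "\<Sum>x\<in>D - B. e x *s x"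
    have "?t \<in> span D" by (intro span_sum span_scale span_base) auto
    moreover have "(\<Sum>x\<in>C. c x *s x) \<in> span C" by (intro span_sum span_scale span_base) auto
    then have "- (\<Sum>x\<in>C. c x *s x) \<in> span C" by (rule span_neg)
    moreover have "?t = - (\<Sum>x\<in>C. c x *s x)" using 0 by (simp add: eq_neg_iff_add_eq_0 add.commute)
    ultimately have "?t \<in> span B" unfolding *(7-9) by simp
    then obtain b where b: "?t = (\<Sum>x\<in>B. b x *s x)" unfolding span_finite[OF finB] by auto
    have "(\<Sum>x\<in>D. (if x \<in> B then - b x else e x) *s x) =
        (\<Sum>x\<in>B. (if x \<in> B then - b x else e x) *s x) + (\<Sum>x\<in>D - B. (if x \<in> B then - b x else e x) *s x)"
      using sum.subset_diff[OF *(4,2), of "\<lambda>x. (if x \<in> B then - b x else e x) *s x"]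
      by (simp only: add.commute)
    also have "(\<Sum>x\<in>B. (if x \<in> B then - b x else e x) *s x) = - (\<Sum>x\<in>B. b x *s x)"
      unfolding sum_negf[symmetric] by (rule sum.cong) auto
    also have "(\<Sum>x\<in>D - B. (if x \<in> B then - b x else e x) *s x) = ?t"
      by (rule sum.cong) auto
    finally have D0: "(\<Sum>x\<in>D. (if x \<in> B then - b x else e x) *s x) = 0" using b by simp
    have e0: "e x = 0" if x: "x \<in> D - B" for x
      using independentD[OF *(6,2) subset_refl D0, of x] x by auto
    then have "?t = 0" by (intro sum.neutral) auto
    with 0 have "(\<Sum>x\<in>C. c x *s x) = 0" by simp
    then have "\<forall>x\<in>C. c x = 0" using independentD[OF *(5,1) subset_refl] by blast
    with e0 show ?thesis by blast
  qed
  have disj: "C \<inter> (D - B) = {}"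
  proof (rule ccontr)
    assume "C \<inter> (D - B) \<noteq> {}"
    then obtain y where y: "y \<in> C" "y \<in> D - B" by blast
    have "(\<Sum>x\<in>C. (if x = y then 1 else 0) *s x) = y" "(\<Sum>x\<in>D - B. (if x = y then - 1 else 0) *s x) = - y"
      using y *(1,2) by (simp_all add: if_distrib[of "\<lambda>a. a *s _"] cong: if_cong)
    then have "(\<Sum>x\<in>C. (if x = y then 1 else 0) *s x) + (\<Sum>x\<in>D - B. (if x = y then - 1 else 0) *s x) = 0"
      by simp
    from zero[OF this] y(1) show False by auto
  qed
  have ind: "independent (C \<union> (D - B))"
  proof (rule independent_if_scalars_zero)
    show "finite (C \<union> (D - B))" using * by simp
    fix a x assume "(\<Sum>x\<in>C \<union> (D - B). a x *s x) = 0" and x: "x \<in> C \<union> (D - B)"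
    then have "(\<Sum>x\<in>C. a x *s x) + (\<Sum>x\<in>D - B. a x *s x) = 0"
      using sum.union_disjoint[OF *(1) _ disj, of "\<lambda>x. a x *s x"] *(2) by simp
    from zero[OF this] x show "a x = 0" by blast
  qed
  have sub: "C \<union> (D - B) \<subseteq> ?S"
  proof
    fix x assume "x \<in> C \<union> (D - B)"
    then have "x \<in> U \<or> x \<in> V" using span_superset[of C] span_superset[of D] *(8,9) by blast
    then show "x \<in> ?S"
    proof
      assume "x \<in> U"
      then have "x = x + 0 \<and> x \<in> U \<and> 0 \<in> V" using subspace_0[OF V] by simp
      then show ?thesis by blast
    next
      assume "x \<in> V"
      then have "x = 0 + x \<and> 0 \<in> U \<and> x \<in> V" using subspace_0[OF U] by simp
      then show ?thesis by blast
    qed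
  qed
  have "?S \<subseteq> span (C \<union> (D - B))"
  proof
    fix z assume "z \<in> ?S"
    then obtain x y where z: "z = x + y" "x \<in> U" "y \<in> V" by blast
    have "D \<subseteq> span (C \<union> (D - B))" using *(3) span_superset[of "C \<union> (D - B)"] by blast
    then have "V \<subseteq> span (C \<union> (D - B))" unfolding *(9)[symmetric] by (rule span_minimal[OF _ subspace_span])
    moreover have "U \<subseteq> span (C \<union> (D - B))" unfolding *(8)[symmetric] by (rule span_mono) simp
    ultimately show "z \<in> span (C \<union> (D - B))" using z by (auto intro: span_add)
  qed
  from basis_card_eq_dim[OF sub this ind]
  have "dim ?S = card C + card (D - B)" using card_Un_disjoint[OF *(1) _ disj] *(2) by simp
  moreover have "card (D - B) = card D - card B" using finB *(4) by (rule card_Diff_subset)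
  ultimately show ?thesis using *(10-12) by linarith
qed

end

interpretation pm: vector_space "\<lambda>(c :: 'k::field) (p :: 'k poly4). coef c * p"
  by unfold_locales (simp_all add: distrib_left distrib_right mult_single single_add flip: mult.assoc)

definition mons :: "nat \<Rightarrow> mon4 set" where "mons n = {m. tdeg m = n}"

definition hom :: "nat \<Rightarrow> 'k::field poly4 set" where "hom n = {p. pure wt (int n) p}"

lemma finite_mons: "finite (mons n)"
proof -
  have "mons n \<subseteq> {..n} \<times> {..n} \<times> {..n} \<times> {..n}" by (auto simp: mons_def)
  then show ?thesis by (rule finite_subset) simp
qed

lemma card_mons: "card (mons n) = (n + 3) choose 3"
proof -
  let ?f = "\<lambda>(a, b, c, d). [a, b, c, d :: nat]"
  have "?f ` mons n = {l. length l = 4 \<and> sum_list l = n}"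
  proof
    show "{l. length l = 4 \<and> sum_list l = n} \<subseteq> ?f ` mons n"
    proof
      fix l :: "nat list" assume "l \<in> {l. length l = 4 \<and> sum_list l = n}"
      then have l: "length l = Suc (Suc (Suc (Suc 0)))" "sum_list l = n" by simp_all
      then obtain a b c d where abcd: "l = [a, b, c, d]" by (auto simp: length_Suc_conv)
      show "l \<in> ?f ` mons n"
        by (rule image_eqI[of _ _ "(a, b, c, d)"]) (use l(2) abcd in \<open>simp_all add: mons_def\<close>)
    qed
  qed (auto simp: mons_def)
  moreover have "inj_on ?f (mons n)" by (rule inj_onI) auto
  ultimately have "card (mons n) = card {l :: nat list. length l = 4 \<and> sum_list l = n}"
    using card_image[of ?f "mons n"] by simp
  also have "\<dots> = (n + 4 - 1) choose n" by (rule card_length_sum_list)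
  also have "n + 4 - 1 = n + 3" by simp
  also have "(n + 3) choose n = (n + 3) choose 3" using binomial_symmetric[of n "n + 3"] by simp
  finally show ?thesis .
qed

text \<open>The Hilbert polynomial of the polynomial ring, with denominators cleared.\<close>

lemma real_card_mons: "6 * real (card (mons n)) = (real n + 1) * (real n + 2) * (real n + 3)"
proof -
  have two: "2 * real (k + 3 choose 2) = (real k + 3) * (real k + 2)" for k
  proof -
    have "even ((k + 3) * (k + 2))" by simp
    moreover have "k + 3 - 1 = k + 2" by simp
    ultimately have "2 * (k + 3 choose 2) = (k + 3) * (k + 2)" unfolding choose_two by simp
    then have "real (2 * (k + 3 choose 2)) = real ((k + 3) * (k + 2))" by (rule arg_cong)
    then show ?thesis by (simp only: of_nat_mult of_nat_add of_nat_numeral)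
  qed
  have "6 * real (n + 3 choose 3) = (real n + 1) * (real n + 2) * (real n + 3)"
  proof (induction n)
    case (Suc n)
    have "Suc (n + 3) choose Suc 2 = (n + 3 choose 2) + (n + 3 choose Suc 2)" by (rule binomial_Suc_Suc)
    moreover have "Suc 2 = (3 :: nat)" "Suc (n + 3) = Suc n + 3" by simp_all
    ultimately have "real (Suc n + 3 choose 3) = real (n + 3 choose 2) + real (n + 3 choose 3)"
      by (simp only: of_nat_add)
    then have "6 * real (Suc n + 3 choose 3) = 3 * (2 * real (n + 3 choose 2)) + 6 * real (n + 3 choose 3)"
      by linarith
    also have "\<dots> = (real (Suc n) + 1) * (real (Suc n) + 2) * (real (Suc n) + 3)"
      unfolding two Suc of_nat_Suc by (simp add: algebra_simps)
    finally show ?case .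
  next
    case 0
    have "(0 + 3 choose 3 :: nat) = 1" by (simp only: add_0 binomial_n_n)
    then show ?case by simp
  qed
  then show ?thesis unfolding card_mons .
qed

lemma hom_multiples:
  fixes F :: "'k::field poly4"
  assumes "F \<noteq> 0"
  shows "pm.subspace {F * u | u. u \<in> hom n}" "pm.dim {F * u | u. u \<in> hom n} = card (mons n)"
proof -
  let ?V = "{F * u | u. u \<in> hom n}" and ?B = "(\<lambda>m. F * mon m) ` mons n"
  show sub: "pm.subspace ?V"
  proof (rule pm.subspaceI)
    have "0 = F * 0" "0 \<in> hom n" by (simp_all add: hom_def)
    then show "0 \<in> ?V" by blast
    fix x y assume "x \<in> ?V" "y \<in> ?V"
    then obtain u v where "x = F * u" "y = F * v" "u \<in> hom n" "v \<in> hom n" by blast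
    then have "x + y = F * (u + v)" "u + v \<in> hom n" by (simp_all add: distrib_left hom_def pure_add)
    then show "x + y \<in> ?V" by blast
  next
    fix c x assume "x \<in> ?V"
    then obtain u where "x = F * u" "u \<in> hom n" by blast
    then have "coef c * x = F * (coef c * u)" "coef c * u \<in> hom n"
      by (simp_all add: mult.left_commute hom_def pure_def in_keys_iff)
    then show "coef c * x \<in> ?V" by blast
  qed
  have inj: "inj_on (\<lambda>m. F * mon m) (mons n)"
  proof (rule inj_onI)
    fix k l assume "F * mon k = F * mon l"
    then have "mon k = (mon l :: 'k poly4)" using assms by simp
    then have "lookup (mon k :: 'k poly4) l = 1" by simp
    then show "k = l" by (simp add: lookup_single when_def split: if_splits)
  qed
  have "?B \<subseteq> ?V"
  proof
    fix x assume "x \<in> ?B"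
    then obtain k where "x = F * mon k" "k \<in> mons n" by blast
    moreover from this have "mon k \<in> hom n" by (simp add: hom_def mons_def pure_single wt_def)
    ultimately show "x \<in> ?V" by blast
  qed
  moreover have "?V \<subseteq> pm.span ?B"
  proof
    fix x assume "x \<in> ?V"
    then obtain u where u: "x = F * u" "u \<in> hom n" by blast
    have "x = F * (\<Sum>k\<in>keys u. Poly_Mapping.single k (lookup u k))"
      unfolding u(1) by (subst poly_mapping_eq_sum_single) (rule refl)
    also have "\<dots> = (\<Sum>k\<in>keys u. coef (lookup u k) * (F * mon k))"
      by (simp add: sum_distrib_left mult.left_commute[of "coef _"] mult_single)
    also have "\<dots> \<in> pm.span ?B"
      by (intro pm.span_sum pm.span_scale pm.span_base)
        (use u(2) in \<open>auto simp: hom_def pure_def mons_def wt_def\<close>)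
    finally show "x \<in> pm.span ?B" .
  qed
  moreover have "pm.independent ?B"
  proof (rule pm.independent_if_scalars_zero)
    show "finite ?B" by (simp add: finite_mons)
    fix c x assume 0: "(\<Sum>x\<in>?B. coef (c x) * x) = 0" and x: "x \<in> ?B"
    have "(\<Sum>x\<in>?B. coef (c x) * x) = F * (\<Sum>k\<in>mons n. Poly_Mapping.single k (c (F * mon k)))"
      by (simp add: sum.reindex[OF inj] sum_distrib_left mult.left_commute[of "coef _"] mult_single)
    with 0 assms have "(\<Sum>k\<in>mons n. Poly_Mapping.single k (c (F * mon k))) = 0" by simp
    then have sum0: "lookup (\<Sum>k\<in>mons n. Poly_Mapping.single k (c (F * mon k))) l = 0" for l by simp
    have "c (F * mon l) = 0" if "l \<in> mons n" for l
      using sum0[of l] that by (simp add: lookup_sum lookup_single when_def finite_mons)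
    then show "c x = 0" using x by blast
  qed
  ultimately have "card ?B = pm.dim ?V" by (rule pm.basis_card_eq_dim)
  then show "pm.dim ?V = card (mons n)" using card_image[OF inj] by simp
qed

lemma hom_subset_span: "hom n \<subseteq> pm.span (mon ` mons n :: 'k::field poly4 set)"
proof
  fix u :: "'k poly4" assume u: "u \<in> hom n"
  have "(\<Sum>k\<in>keys u. coef (lookup u k) * mon k) \<in> pm.span (mon ` mons n)"
    by (intro pm.span_sum pm.span_scale pm.span_base) (use u in \<open>auto simp: hom_def pure_def mons_def wt_def\<close>)
  then show "u \<in> pm.span (mon ` mons n)" by (simp add: mult_single flip: poly_mapping_eq_sum_single)
qed

lemma hom_mult: "u \<in> hom a \<Longrightarrow> v \<in> hom b \<Longrightarrow> u * v \<in> hom (a + b)"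
  unfolding hom_def using pure_mult[OF weight_wt, of "int a" u "int b" v] by simp

text \<open>Pairs of forms: the Koszul relations bound the dimension of the degree \<open>n\<close> part of \<open>(F, G)\<close>
  from above, with equality when they are the only relations.\<close>

lemma dim_two_generated_le:
  fixes F G :: "'k::field poly4"
  assumes F: "F \<in> hom a" "F \<noteq> 0" and G: "G \<in> hom b" "G \<noteq> 0" and n: "a + b \<le> n"
  shows "pm.dim {F * u + G * v | u v. u \<in> hom (n - a) \<and> v \<in> hom (n - b)} + card (mons (n - (a + b)))
    \<le> card (mons (n - a)) + card (mons (n - b))"
proof -
  let ?U = "{F * u | u. u \<in> hom (n - a)}" and ?V = "{G * u | u. u \<in> hom (n - b)}"
  let ?W = "{(F * G) * u | u. u \<in> hom (n - (a + b))}"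
  have WU: "?W \<subseteq> ?U"
  proof
    fix x assume "x \<in> ?W"
    then obtain u where u: "x = (F * G) * u" "u \<in> hom (n - (a + b))" by blast
    have "G * u \<in> hom (n - a)" using hom_mult[OF G(1) u(2)] n by simp
    then show "x \<in> ?U" using u(1) by (auto simp: mult.assoc)
  qed
  have WV: "?W \<subseteq> ?V"
  proof
    fix x assume "x \<in> ?W"
    then obtain u where u: "x = (F * G) * u" "u \<in> hom (n - (a + b))" by blast
    have "F * u \<in> hom (n - b)" using hom_mult[OF F(1) u(2)] n by simp
    moreover have "x = G * (F * u)" using u(1) by (simp only: ac_simps)
    ultimately show "x \<in> ?V" by blast
  qed
  have U: "?U \<subseteq> pm.span (mon ` mons n)"
  proof
    fix x assume "x \<in> ?U"
    then obtain u where u: "x = F * u" "u \<in> hom (n - a)" by blast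
    then have "x \<in> hom n" using hom_mult[OF F(1) u(2)] n by simp
    then show "x \<in> pm.span (mon ` mons n)" using hom_subset_span by blast
  qed
  have V: "?V \<subseteq> pm.span (mon ` mons n)"
  proof
    fix x assume "x \<in> ?V"
    then obtain u where u: "x = G * u" "u \<in> hom (n - b)" by blast
    then have "x \<in> hom n" using hom_mult[OF G(1) u(2)] n by simp
    then show "x \<in> pm.span (mon ` mons n)" using hom_subset_span by blast
  qed
  have FG: "F * G \<noteq> 0" using F(2) G(2) by simp
  have "pm.dim {x + y | x y. x \<in> ?U \<and> y \<in> ?V} + pm.dim ?W \<le> pm.dim ?U + pm.dim ?V"
    by (rule pm.dim_sum_le[OF hom_multiples(1)[OF F(2)] hom_multiples(1)[OF G(2)]
          hom_multiples(1)[OF FG] WU WV U V]) (simp add: finite_mons)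
  moreover have "{x + y | x y. x \<in> ?U \<and> y \<in> ?V} = {F * u + G * v | u v. u \<in> hom (n - a) \<and> v \<in> hom (n - b)}"
    by blast
  ultimately show ?thesis
    using hom_multiples(2)[OF F(2)] hom_multiples(2)[OF G(2)] hom_multiples(2)[OF FG] by simp
qed

lemma dim_two_generated_ge:
  fixes F G :: "'k::field poly4"
  assumes F: "F \<in> hom a" "F \<noteq> 0" and G: "G \<in> hom b" "G \<noteq> 0" and n: "a + b \<le> n"
    and cop: "\<And>u v. F * u = G * v \<Longrightarrow> G dvd u"
  shows "card (mons (n - a)) + card (mons (n - b)) \<le>
    pm.dim {F * u + G * v | u v. u \<in> hom (n - a) \<and> v \<in> hom (n - b)} + card (mons (n - (a + b)))"
proof -
  let ?U = "{F * u | u. u \<in> hom (n - a)}" and ?V = "{G * u | u. u \<in> hom (n - b)}"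
  let ?W = "{(F * G) * u | u. u \<in> hom (n - (a + b))}"
  \<comment> \<open>In a common multiple \<open>F * u = G * v\<close>, coprimality makes
    \<open>u\<close> a multiple of \<open>G\<close>, and homogeneity fixes the degree of the
    cofactor.\<close>
  have sub: "?U \<inter> ?V \<subseteq> ?W"
  proof
    fix x assume "x \<in> ?U \<inter> ?V"
    then obtain u v where uv: "x = F * u" "u \<in> hom (n - a)" "x = G * v" by blast
    then have "G dvd u" using cop[of u v] by simp
    then obtain k where k: "u = G * k" by (rule dvdE)
    have "k \<in> hom (n - (a + b))"
    proof (cases "k = 0")
      case False
      have "pure wt (int (n - a)) (G * k)" using uv(2) unfolding k hom_def by simp
      then obtain p q where pq: "pure wt p G" "pure wt q k" "p + q = int (n - a)"
        by (rule pure_factors[OF weight_wt]) (use False G(2) in simp)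
      have "p = int b" using pure_unique[OF pq(1)] G by (simp add: hom_def)
      then have "q = int (n - (a + b))" using pq(3) n by linarith
      then show ?thesis using pq(2) by (simp add: hom_def)
    qed (simp add: hom_def)
    moreover have "x = (F * G) * k" using uv(1) k by (simp only: ac_simps)
    ultimately show "x \<in> ?W" by blast
  qed
  have FG: "F * G \<noteq> 0" using F(2) G(2) by simp
  have U: "?U \<subseteq> pm.span (mon ` mons n)"
  proof
    fix x assume "x \<in> ?U"
    then obtain u where u: "x = F * u" "u \<in> hom (n - a)" by blast
    then have "x \<in> hom n" using hom_mult[OF F(1) u(2)] n by simp
    then show "x \<in> pm.span (mon ` mons n)" using hom_subset_span by blast
  qed
  have V: "?V \<subseteq> pm.span (mon ` mons n)"
  proof
    fix x assume "x \<in> ?V"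
    then obtain u where u: "x = G * u" "u \<in> hom (n - b)" by blast
    then have "x \<in> hom n" using hom_mult[OF G(1) u(2)] n by simp
    then show "x \<in> pm.span (mon ` mons n)" using hom_subset_span by blast
  qed
  have "pm.dim ?U + pm.dim ?V \<le> pm.dim {x + y | x y. x \<in> ?U \<and> y \<in> ?V} + pm.dim (?U \<inter> ?V)"
    by (rule pm.dim_sum_ge[OF hom_multiples(1)[OF F(2)] hom_multiples(1)[OF G(2)] U V]) (simp add: finite_mons)
  moreover have "pm.dim (?U \<inter> ?V) \<le> card ((\<lambda>m. (F * G) * mon m) ` mons (n - (a + b)))"
  proof (rule pm.dim_le_card)
    show "?U \<inter> ?V \<subseteq> pm.span ((\<lambda>m. (F * G) * mon m) ` mons (n - (a + b)))"
    proof (rule subset_trans[OF sub], rule subsetI)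
      fix x assume "x \<in> ?W"
      then obtain u where u: "x = (F * G) * u" "u \<in> hom (n - (a + b))" by blast
      have "x = (F * G) * (\<Sum>k\<in>keys u. Poly_Mapping.single k (lookup u k))"
        unfolding u(1) by (subst poly_mapping_eq_sum_single) (rule refl)
      also have "\<dots> = (\<Sum>k\<in>keys u. coef (lookup u k) * ((F * G) * mon k))"
        by (simp add: sum_distrib_left mult.left_commute[of "coef _"] mult_single)
      also have "\<dots> \<in> pm.span ((\<lambda>m. (F * G) * mon m) ` mons (n - (a + b)))"
        by (intro pm.span_sum pm.span_scale pm.span_base)
          (use u(2) in \<open>auto simp: hom_def pure_def mons_def wt_def\<close>)
      finally show "x \<in> pm.span ((\<lambda>m. (F * G) * mon m) ` mons (n - (a + b)))" .
    qed
  qed (simp add: finite_mons)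
  moreover have "card ((\<lambda>m. (F * G) * mon m) ` mons (n - (a + b))) \<le> card (mons (n - (a + b)))"
    by (rule card_image_le[OF finite_mons])
  moreover have "{x + y | x y. x \<in> ?U \<and> y \<in> ?V} = {F * u + G * v | u v. u \<in> hom (n - a) \<and> v \<in> hom (n - b)}"
    by blast
  ultimately show ?thesis using hom_multiples(2)[OF F(2)] hom_multiples(2)[OF G(2)] by simp
qed

section \<open>Comparing the pair with its lowest components\<close>

lemma part_sum: "part P (sum f A) = (\<Sum>x\<in>A. part P (f x :: 'm \<Rightarrow>\<^sub>0 'a::comm_monoid_add))"
  by (rule poly_mapping_eqI) (simp add: lookup_part lookup_sum)

lemma part_coef_mult: "part P (coef c * p) = coef c * part P (p :: 'm::monoid_add \<Rightarrow>\<^sub>0 'a::comm_ring_1)"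
  by (rule poly_mapping_eqI) (simp add: lookup_part)

lemma part_power:
  fixes a :: "'m::comm_monoid_add \<Rightarrow>\<^sub>0 'a::comm_ring_1"
  assumes w: "weight \<omega>" and a: "low \<omega> i a"
  shows "low \<omega> (int n * i) (a ^ n) \<and> part (\<lambda>m. \<omega> m = int n * i) (a ^ n) = part (\<lambda>m. \<omega> m = i) a ^ n"
proof (induction n)
  case 0
  have 1: "pure \<omega> 0 (1 :: 'm \<Rightarrow>\<^sub>0 'a)" using weight_0[OF w] by (auto simp: pure_def)
  then show ?case using part_of_pure[OF 1, of 0] pure_imp_low[OF 1] by simp
next
  case (Suc n)
  have "int (Suc n) * i = i + int n * i" by (simp add: algebra_simps)
  with Suc show ?case
    using low_mult[OF w a, of "int n * i" "a ^ n"] part_mult_low[OF w a, of "int n * i" "a ^ n"]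
    by (simp del: of_nat_Suc)
qed

lemma part_mult_pure:
  fixes a :: "'m::comm_monoid_add \<Rightarrow>\<^sub>0 'a::comm_ring_1"
  assumes w: "weight \<omega>" and f: "pure \<omega> j f"
  shows "part (\<lambda>m. \<omega> m = i + j) (a * f) = part (\<lambda>m. \<omega> m = i) a * f"
proof (induction a rule: poly_mapping_induct)
  case zero
  have "part P (0 :: 'm \<Rightarrow>\<^sub>0 'a) = 0" for P by (rule part_eq_0) simp
  then show ?case by simp
next
  case (single k c)
  have s: "pure \<omega> (\<omega> k) (Poly_Mapping.single k c)" by (rule pure_single) simp
  show ?case
    using part_of_pure[OF pure_mult[OF w s f], of "i + j"] part_of_pure[OF s, of i] by simp
next
  case (add a b)
  then show ?case by (simp add: distrib_right part_add)
qed

lemma hom_factors: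
  fixes p q :: "'k::field poly4"
  assumes pq: "p * q \<in> hom n" "p * q \<noteq> 0"
  obtains a b where "p \<in> hom a" "q \<in> hom b" "a + b = n"
proof -
  have "pure wt (int n) (p * q)" using pq(1) by (simp add: hom_def)
  then obtain i j where ij: "pure wt i p" "pure wt j q" "i + j = int n"
    by (rule pure_factors[OF weight_wt _ pq(2)])
  have "\<exists>a. i = int a" if "pure wt i p" "p \<noteq> 0" for i and p :: "'k poly4"
  proof -
    have "keys p \<noteq> {}" using that(2) by simp
    then obtain k where "k \<in> keys p" by blast
    then have "i = int (tdeg k)" using that(1) by (simp add: pure_def wt_def)
    then show ?thesis by blast
  qed
  then obtain a b where "i = int a" "j = int b" using ij pq(2) by (metis mult_zero_left mult_zero_right)
  then show thesis using ij that[of a b] by (simp add: hom_def)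
qed

section \<open>Rewriting monomials modulo powers of equations of the curve\<close>

lemma hom_mon: "tdeg k = n \<Longrightarrow> mon k \<in> hom n"
  by (simp add: hom_def wt_def pure_single)

lemma hom_diff: "p \<in> hom n \<Longrightarrow> q \<in> hom n \<Longrightarrow> p - q \<in> hom n"
  by (simp add: hom_def pure_diff)

lemma hom_power: "p \<in> hom n \<Longrightarrow> p ^ k \<in> hom (k * n)"
  unfolding hom_def using pure_power[OF weight_wt, of "int n" p k] by simp

lemma mult_mem_subspace:
  assumes Z: "pm.subspace Z" and "\<And>k. k \<in> keys q \<Longrightarrow> \<phi> * mon k \<in> Z"
  shows "\<phi> * q \<in> Z"
proof -
  have "\<phi> * q = \<phi> * (\<Sum>k\<in>keys q. Poly_Mapping.single k (lookup q k))"
    by (subst poly_mapping_eq_sum_single) (rule refl)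
  also have "\<dots> = (\<Sum>k\<in>keys q. coef (lookup q k) * (\<phi> * mon k))"
    by (simp add: sum_distrib_left mult.left_commute[of "coef _"] mult_single)
  also have "\<dots> \<in> Z" by (intro pm.subspace_sum pm.subspace_scale Z assms(2))
  finally show ?thesis .
qed

text \<open>Two binomial equations of the curve whose top parts in x and y are pure powers of x and
  of y.\<close>

definition ex :: "'k::comm_ring_1 poly4" where "ex = mon (0, 4, 0, 0) - mon (3, 0, 0, 1)"
definition ey :: "'k::comm_ring_1 poly4" where "ey = mon (0, 0, 4, 0) - mon (1, 0, 0, 3)"

text \<open>\<open>mon a ^ N\<close> is the lowest component for \<open>wxy\<close> of the power, so
  the remainder has smaller degree in x and y.\<close>

lemma lead_power:
  fixes a b :: mon4
  assumes "degxy a = 4" "degxy b = 0" "tdeg a = 4" "tdeg b = 4"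
  obtains \<rho> :: "'k::field poly4"
  where "(mon a - mon b) ^ N = mon a ^ N + \<rho>" "low wxy (- int (4 * N) + 1) \<rho>" "\<rho> \<in> hom (4 * N)"
proof -
  let ?e = "mon a - mon b :: 'k poly4"
  have a: "pure wxy (- 4) (mon a :: 'k poly4)" and b: "pure wxy 0 (mon b :: 'k poly4)"
    using assms by (simp_all add: pure_single wxy_def)
  have l: "low wxy (- 4) ?e" using low_diff[OF pure_imp_low[OF a] low_mono[OF pure_imp_low[OF b]]] by simp
  have "part (\<lambda>m. wxy m = - 4) (mon a + coef (- 1) * mon b) = (mon a :: 'k poly4)"
    unfolding part_add part_coef_mult part_of_pure[OF a] part_of_pure[OF b] by simp
  moreover have "mon a + coef (- 1) * mon b = ?e" by (simp add: mult_single single_uminus)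
  ultimately have p: "part (\<lambda>m. wxy m = - 4) ?e = mon a" by simp
  have eq: "int N * - 4 = - int (4 * N)" by simp
  from part_power[OF weight_wxy l, of N] have lp: "low wxy (- int (4 * N)) (?e ^ N)"
    "part (\<lambda>m. wxy m = - int (4 * N)) (?e ^ N) = mon a ^ N" unfolding p eq by auto
  obtain \<rho> where \<rho>: "?e ^ N = mon a ^ N + \<rho>" "low wxy (- int (4 * N) + 1) \<rho>"
    using low_split[OF lp(1)] unfolding lp(2) .
  have "?e \<in> hom 4" using assms by (intro hom_diff hom_mon)
  then have "?e ^ N \<in> hom (4 * N)" using hom_power[of ?e 4 N] by (simp add: mult.commute)
  moreover have "mon a ^ N \<in> (hom (4 * N) :: 'k poly4 set)"
    using hom_power[OF hom_mon[OF assms(3)], of N] by (simp add: mult.commute)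
  moreover have "\<rho> = ?e ^ N - mon a ^ N" using \<rho>(1) by simp
  ultimately have "\<rho> \<in> hom (4 * N)" using hom_diff by simp
  with \<rho> show thesis by (rule that)
qed

text \<open>The monomials of degree \<open>k\<close> divisible by none of x^L, y^L and w^A z^D.
  Their number is bounded independently of \<open>k\<close>: the exponents of x, y and one of w, z
  are small, and the degree fixes the last one.\<close>

definition residual :: "nat \<Rightarrow> nat \<Rightarrow> nat \<Rightarrow> nat \<Rightarrow> mon4 set" where
  "residual L A D k = {(a, b, e, d). a + b + e + d = k \<and> b < L \<and> e < L \<and> (a < A \<or> d < D)}"

lemma residual_card: "finite (residual L A D k)" "card (residual L A D k) \<le> L * L * (A + D)"
proof -
  \<comment> \<open>The parameter \<open>t\<close> codes both cases: \<open>t < A\<close> is the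
    exponent of w, and \<open>t = A + d\<close> carries the exponent \<open>d\<close> of z.\<close>
  let ?\<phi> = "\<lambda>(b, e, t). if t < A then (t, b, e, k - t - b - e) else (k - (t - A) - b - e, b, e, t - A)"
  have sub: "residual L A D k \<subseteq> ?\<phi> ` ({..<L} \<times> {..<L} \<times> {..<A + D})"
  proof
    fix \<mu> assume "\<mu> \<in> residual L A D k"
    then obtain a b e d where \<mu>: "\<mu> = (a, b, e, d)" "a + b + e + d = k" "b < L" "e < L" "a < A \<or> d < D"
      unfolding residual_def by blast
    show "\<mu> \<in> ?\<phi> ` ({..<L} \<times> {..<L} \<times> {..<A + D})"
    proof (cases "a < A")
      case True
      then show ?thesis using \<mu> by (intro image_eqI[of _ _ "(b, e, a)"]) auto
    next
      case False
      then show ?thesis using \<mu> by (intro image_eqI[of _ _ "(b, e, A + d)"]) auto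
    qed
  qed
  show "finite (residual L A D k)" by (rule finite_subset[OF sub]) simp
  have "card (residual L A D k) \<le> card (?\<phi> ` ({..<L} \<times> {..<L} \<times> {..<A + D}))"
    by (rule card_mono[OF _ sub]) simp
  also have "\<dots> \<le> card ({..<L} \<times> {..<L} \<times> {..<A + D})" by (rule card_image_le) simp
  finally show "card (residual L A D k) \<le> L * L * (A + D)" by (simp add: mult.assoc)
qed

text \<open>Powers x^(4N) and y^(4N) are traded for terms of smaller degree in x and y through
  \<open>ex ^ N\<close> and \<open>ey ^ N\<close>; monomials divisible by w^A z^D are covered
  directly, and only residual ones remain.\<close>

lemma reduction:
  fixes \<phi> :: "'k::field poly4"
  assumes Z: "pm.subspace Z"
    and ex: "\<And>\<mu>. tdeg \<mu> + 4 * N = k \<Longrightarrow> \<phi> * (mon \<mu> * ex ^ N) \<in> Z"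
    and ey: "\<And>\<mu>. tdeg \<mu> + 4 * N = k \<Longrightarrow> \<phi> * (mon \<mu> * ey ^ N) \<in> Z"
    and wz: "\<And>\<mu>. tdeg \<mu> + (A + D) = k \<Longrightarrow> \<phi> * (mon \<mu> * mon (A, 0, 0, D)) \<in> Z"
    and res: "\<And>\<mu>. \<mu> \<in> residual (4 * N) A D k \<Longrightarrow> \<phi> * mon \<mu> \<in> Z"
  shows "tdeg \<mu> = k \<Longrightarrow> \<phi> * mon \<mu> \<in> Z"
proof (induction "degxy \<mu>" arbitrary: \<mu> rule: less_induct)
  case less
  have step: "\<phi> * mon (\<mu>' + \<nu>) \<in> Z"
    if tdeg: "tdeg \<mu>' + 4 * N = k" and deg: "degxy (\<mu>' + \<nu>) = degxy \<mu>" "degxy \<nu> = 4 * N"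
      and e: "e ^ N = mon \<nu> + \<rho>" "low wxy (- int (4 * N) + 1) \<rho>" "\<rho> \<in> hom (4 * N)"
      and eZ: "\<phi> * (mon \<mu>' * e ^ N) \<in> Z" for \<mu>' \<nu> and e \<rho> :: "'k poly4"
  proof -
    have "\<phi> * (mon \<mu>' * \<rho>) \<in> Z"
    proof (rule mult_mem_subspace[OF Z])
      fix \<kappa> assume "\<kappa> \<in> keys (mon \<mu>' * \<rho>)"
      then obtain \<kappa>' where \<kappa>': "\<kappa>' \<in> keys \<rho>" "\<kappa> = \<mu>' + \<kappa>'" using keys_mon_mult by blast
      have "degxy \<kappa>' < 4 * N" using \<kappa>'(1) e(2) by (force simp: low_def wxy_def)
      then have "degxy \<kappa> < degxy \<mu>" using deg unfolding \<kappa>'(2) degxy_add by linarith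
      moreover have "wt \<kappa>' = int (4 * N)" using \<kappa>'(1) e(3) by (simp add: hom_def pure_def)
      then have "wt \<kappa> = int k" using tdeg weight_add[OF weight_wt, of \<mu>' \<kappa>'] unfolding \<kappa>'(2)
        by (simp add: wt_def)
      then have "tdeg \<kappa> = k" by (simp add: wt_def)
      ultimately show "\<phi> * mon \<kappa> \<in> Z" by (rule less.hyps)
    qed
    moreover have "\<phi> * mon (\<mu>' + \<nu>) = \<phi> * (mon \<mu>' * e ^ N) - \<phi> * (mon \<mu>' * \<rho>)"
      unfolding e(1) by (simp add: distrib_left mult_single)
    ultimately show ?thesis using pm.subspace_diff[OF Z eZ] by simp
  qed
  obtain a b e d where \<mu>: "\<mu> = (a, b, e, d)" by (cases \<mu>)
  have k: "a + b + e + d = k" using less.prems \<mu> by simp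
  consider "4 * N \<le> b" | "4 * N \<le> e" | "b < 4 * N" "e < 4 * N" "A \<le> a" "D \<le> d"
    | "b < 4 * N" "e < 4 * N" "a < A \<or> d < D" by linarith
  then show ?case
  proof cases
    case 1
    let ?\<mu>' = "(a, b - 4 * N, e, d)" and ?\<nu> = "(0, 4 * N, 0, 0)"
    obtain \<rho> :: "'k poly4" where \<rho>: "(mon (0, 4, 0, 0) - mon (3, 0, 0, 1)) ^ N = mon (0, 4, 0, 0) ^ N + \<rho>"
      "low wxy (- int (4 * N) + 1) \<rho>" "\<rho> \<in> hom (4 * N)"
      by (rule lead_power[of "(0, 4, 0, 0)" "(3, 0, 0, 1)" N]) simp_all
    have "mon (0, 4, 0, 0) ^ N = (mon ?\<nu> :: 'k poly4)"
      using mon_powers[of 4 0, where ?'k = 'k] mon_powers[of "4 * N" 0, where ?'k = 'k] by (simp add: power_mult)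
    then have "\<phi> * mon (?\<mu>' + ?\<nu>) \<in> Z"
      using 1 k \<rho> by (intro step[of ?\<mu>' ?\<nu> ex \<rho>] ex) (simp_all add: \<mu> ex_def)
    then show ?thesis using 1 by (simp add: \<mu>)
  next
    case 2
    let ?\<mu>' = "(a, b, e - 4 * N, d)" and ?\<nu> = "(0, 0, 4 * N, 0)"
    obtain \<rho> :: "'k poly4" where \<rho>: "(mon (0, 0, 4, 0) - mon (1, 0, 0, 3)) ^ N = mon (0, 0, 4, 0) ^ N + \<rho>"
      "low wxy (- int (4 * N) + 1) \<rho>" "\<rho> \<in> hom (4 * N)"
      by (rule lead_power[of "(0, 0, 4, 0)" "(1, 0, 0, 3)" N]) simp_all
    have "mon (0, 0, 4, 0) ^ N = (mon ?\<nu> :: 'k poly4)"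
      using mon_powers[of 0 4, where ?'k = 'k] mon_powers[of 0 "4 * N", where ?'k = 'k] by (simp add: power_mult)
    then have "\<phi> * mon (?\<mu>' + ?\<nu>) \<in> Z"
      using 2 k \<rho> by (intro step[of ?\<mu>' ?\<nu> ey \<rho>] ey) (simp_all add: \<mu> ey_def)
    then show ?thesis using 2 by (simp add: \<mu>)
  next
    case 3
    have "\<phi> * (mon (a - A, b, e, d - D) * mon (A, 0, 0, D)) \<in> Z"
      by (rule wz) (use 3 k in simp)
    then show ?thesis using 3 by (simp add: \<mu> mult_single)
  next
    case 4
    then show ?thesis using k by (intro res) (simp add: \<mu> residual_def)
  qed
qed

section \<open>Excluding pairs of bihomogeneous generators\<close>

lemma lookup_mon_mult: "lookup (mon n * p) (n + k) = lookup (p :: 'k::comm_ring_1 poly4) k"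
  using lookup_mult_mon[of p n k] by (simp only: ac_simps)

lemma ideal_gen_pair_mult: "a \<in> ideal_gen {p, q} \<Longrightarrow> r * a \<in> ideal_gen {p, q}"
  and ideal_gen_pair_add: "a \<in> ideal_gen {p, q} \<Longrightarrow> b \<in> ideal_gen {p, q} \<Longrightarrow> a + b \<in> ideal_gen {p, q}"
  unfolding ideal_gen_def is_ideal_def by auto

text \<open>After scaling the coefficient at \<open>\<nu>\<close> to 1, all other terms are
  divisible by \<open>mon \<mu>\<close>. Since \<open>\<mu>\<close> uses up positive degree in w and
  z only, the cofactor has degree below \<open>c\<close> in x and y.\<close>

lemma pure_power_form_split:
  fixes F :: "'k::field poly4"
  assumes \<nu>: "\<nu> \<in> keys F" and hom: "F \<in> hom c" and deg: "tdeg \<nu> = c"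
    and other: "\<And>k. k \<in> keys F \<Longrightarrow> k \<noteq> \<nu> \<Longrightarrow> (\<exists>k'. k = \<mu> + k')" and \<mu>: "degxy \<mu> = 0" "0 < tdeg \<mu>"
  obtains F' r where "coef r * F = mon \<nu> + mon \<mu> * F'" "r \<noteq> 0" "\<And>k. k \<in> keys F' \<Longrightarrow> degxy k < c"
proof -
  define r where "r = inverse (lookup F \<nu>)"
  have "lookup F \<nu> \<noteq> 0" using \<nu> by (simp add: in_keys_iff)
  then have r: "r \<noteq> 0" "r * lookup F \<nu> = 1" by (simp_all add: r_def)
  define G where "G = coef r * F - mon \<nu>"
  have keysG: "k \<in> keys F \<and> k \<noteq> \<nu>" if "k \<in> keys G" for k
    using that r by (auto simp: G_def in_keys_iff lookup_minus lookup_single when_def split: if_splits)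
  have "mon \<mu> dvd G" by (rule dvd_mon) (use keysG other in blast)
  then obtain F' where F': "G = mon \<mu> * F'" by (rule dvdE)
  have "degxy k < c" if "k \<in> keys F'" for k
  proof -
    have "\<mu> + k \<in> keys G" using that by (simp add: F' in_keys_iff lookup_mon_mult)
    then have "\<mu> + k \<in> keys F" using keysG by blast
    then have "wt (\<mu> + k) = int c" using hom by (simp add: hom_def pure_def)
    then have "tdeg \<mu> + tdeg k = c" by (cases \<mu>; cases k) (simp add: wt_def)
    moreover have "degxy k \<le> tdeg k" by (cases k) simp
    ultimately show ?thesis using \<mu> by linarith
  qed
  moreover have "coef r * F = mon \<nu> + mon \<mu> * F'" using F' by (simp add: G_def algebra_simps)
  ultimately show thesis using r(1) that by blast
qed

lemma no_bihomogeneous_pair_aux: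
  fixes F G :: "'k::field_char_0 poly4"
  assumes F: "F \<in> hom c" "pure w1 s F" "(0, 0, c, 0) \<in> keys F" "0 < c"
    and G: "G \<in> hom m" "pure w1 t G" "(0, m, 0, 0) \<in> keys G" "0 < m"
  shows "(vX * vY - vW * vZ) ^ n \<notin> ideal_gen {F, G}"
proof
  assume mem: "(vX * vY - vW * vZ) ^ n \<in> ideal_gen {F, G}"
  \<comment> \<open>Having the degree and bidegree of y^c means \<open>d = 3 * a + 2 * b\<close>; so
    every other monomial has \<open>2 \<le> d\<close>. The argument for x^m and w^2 is
    symmetric.\<close>
  have kF: "\<exists>k'. k = (0, 0, 0, 2) + k'" if k: "k \<in> keys F" "k \<noteq> (0, 0, c, 0)" for k
  proof -
    obtain a b e d where abed: "k = (a, b, e, d)" by (cases k)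
    have "w1 k = w1 (0, 0, c, 0)" using F(2,3) k(1) by (simp add: pure_def)
    moreover have "wt k = int c" using F(1) k(1) by (simp add: hom_def pure_def)
    ultimately have "d = 3 * a + 2 * b" "a + b + e + d = c" by (simp_all add: abed w1_def wt_def)
    moreover have "a \<noteq> 0 \<or> b \<noteq> 0" using calculation k(2) by (auto simp: abed)
    ultimately have "2 \<le> d" by linarith
    then have "k = (0, 0, 0, 2) + (a, b, e, d - 2)" by (simp add: abed)
    then show ?thesis by blast
  qed
  have kG: "\<exists>k'. k = (2, 0, 0, 0) + k'" if k: "k \<in> keys G" "k \<noteq> (0, m, 0, 0)" for k
  proof -
    obtain a b e d where abed: "k = (a, b, e, d)" by (cases k)
    have "w1 k = w1 (0, m, 0, 0)" using G(2,3) k(1) by (simp add: pure_def)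
    moreover have "wt k = int m" using G(1) k(1) by (simp add: hom_def pure_def)
    ultimately have "a = 3 * d + 2 * e" "a + b + e + d = m" by (simp_all add: abed w1_def wt_def)
    moreover have "d \<noteq> 0 \<or> e \<noteq> 0" using calculation k(2) by (auto simp: abed)
    ultimately have "2 \<le> a" by linarith
    then have "k = (2, 0, 0, 0) + (a - 2, b, e, d)" by (simp add: abed)
    then show ?thesis by blast
  qed
  obtain F' r where F': "coef r * F = mon (0, 0, c, 0) + mon (0, 0, 0, 2) * F'" "r \<noteq> 0"
    "\<And>k. k \<in> keys F' \<Longrightarrow> degxy k < c"
    by (rule pure_power_form_split[OF F(3,1) _ kF]) simp_all
  obtain G' q where G': "coef q * G = mon (0, m, 0, 0) + mon (2, 0, 0, 0) * G'" "q \<noteq> 0"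
    "\<And>k. k \<in> keys G' \<Longrightarrow> degxy k < m"
    by (rule pure_power_form_split[OF G(3,1) _ kG]) simp_all
  interpret box_presentation "coef r * F" "coef q * G" F' G' c m
  proof
    show "coef r * F = vY ^ c + vZ ^ 2 * F'" using F'(1) mon_powers[of 0 c, where ?'k = 'k] by (simp add: vZ2)
    show "coef q * G = vX ^ m + vW ^ 2 * G'" using G'(1) mon_powers[of m 0, where ?'k = 'k] by (simp add: vW2)
  qed (use F' G' F(4) G(4) in auto)
  obtain u v where uv: "(vX * vY - vW * vZ) ^ n = u * F + v * G" using mem unfolding ideal_gen_pair by blast
  have "F = coef (inverse r) * (coef r * F)" "G = coef (inverse q) * (coef q * G)"
    using F'(2) G'(2) by (simp_all add: mult_single flip: mult.assoc)
  note FG = this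
  have "(vX * vY - vW * vZ) ^ n = (u * coef (inverse r)) * (coef r * F) + (v * coef (inverse q)) * (coef q * G)"
    unfolding mult.assoc FG[symmetric] by (rule uv)
  then have "(vX * vY - vW * vZ) ^ n \<in> I" unfolding I_def ideal_gen_pair by blast
  then show False using not_nilpotent by blast
qed

text \<open>For a nonnegative weight, taking the part of weight 0 is a ring homomorphism. It sends
  \<open>e ^ n\<close> to \<open>mon \<nu> ^ n\<close>, which is nonzero, so it cannot kill both
  generators.\<close>

lemma pure_power_in_generators:
  fixes F G :: "'k::field poly4"
  assumes w: "weight \<omega>" and nonneg: "\<And>k. 0 \<le> \<omega> k"
    and e: "part (\<lambda>m. \<omega> m = 0) e = mon \<nu>" and mem: "e ^ n \<in> ideal_gen {F, G}"
  obtains k where "\<omega> k = 0" "k \<in> keys F \<or> k \<in> keys G"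
proof -
  have low: "low \<omega> 0 p" for p :: "'k poly4" using nonneg by (simp add: low_def)
  obtain u v where uv: "e ^ n = u * F + v * G" using mem unfolding ideal_gen_pair by blast
  have "part (\<lambda>m. \<omega> m = 0) (e ^ n) = mon \<nu> ^ n" using part_power[OF w low, of n e] e by simp
  moreover have "mon \<nu> ^ n \<noteq> (0 :: 'k poly4)" using mon_neq_0[of \<nu>, where ?'k = 'k] by simp
  moreover have "part (\<lambda>m. \<omega> m = 0) (e ^ n) = part (\<lambda>m. \<omega> m = 0) u * part (\<lambda>m. \<omega> m = 0) F
      + part (\<lambda>m. \<omega> m = 0) v * part (\<lambda>m. \<omega> m = 0) G"
    unfolding uv part_add using part_mult_low[OF w low low, of u F] part_mult_low[OF w low low, of v G] by simp
  ultimately have "part (\<lambda>m. \<omega> m = 0) F \<noteq> 0 \<or> part (\<lambda>m. \<omega> m = 0) G \<noteq> 0" by auto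
  then have "keys (part (\<lambda>m. \<omega> m = 0) F) \<noteq> {} \<or> keys (part (\<lambda>m. \<omega> m = 0) G) \<noteq> {}" by simp
  then show thesis using that by (auto simp: keys_part)
qed

text \<open>Weight 0 singles out the powers of y, and for \<open>off_x\<close> the powers of
  x.\<close>

fun off_y :: "mon4 \<Rightarrow> int" where "off_y (a, b, c, d) = int a + int b + int d"
fun off_x :: "mon4 \<Rightarrow> int" where "off_x (a, b, c, d) = int a + int c + int d"

lemma weight_off: "weight off_y" "weight off_x"
  by (auto simp: weight_def)

lemma part_ex_ey: "part (\<lambda>m. off_x m = 0) (ex :: 'k::comm_ring_1 poly4) = mon (0, 4, 0, 0)"
  "part (\<lambda>m. off_y m = 0) (ey :: 'k::comm_ring_1 poly4) = mon (0, 0, 4, 0)"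
  by (rule poly_mapping_eqI; auto simp: ex_def ey_def lookup_part lookup_minus lookup_single when_def)+

text \<open>Nilpotency of \<open>ex\<close> and \<open>ey\<close> forces a pure power of x and one
  of y to occur in the generators. They occur in different ones, which gives the box form up to
  order.\<close>

theorem no_bihomogeneous_pair:
  fixes F G :: "'k::field_char_0 poly4"
  assumes F: "F \<in> hom c" "pure w1 s F" "0 < c" and G: "G \<in> hom m" "pure w1 t G" "0 < m"
    and ex: "ex ^ n1 \<in> ideal_gen {F, G}" and ey: "ey ^ n2 \<in> ideal_gen {F, G}"
  shows "(vX * vY - vW * vZ) ^ n \<notin> ideal_gen {F, G}"
proof -
  have y: "k = (0, 0, p, 0)" if "off_y k = 0" "k \<in> keys H" "H \<in> hom p" for k p and H :: "'k poly4"
    using that by (cases k) (force simp: hom_def pure_def wt_def)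
  have x: "k = (0, p, 0, 0)" if "off_x k = 0" "k \<in> keys H" "H \<in> hom p" for k p and H :: "'k poly4"
    using that by (cases k) (force simp: hom_def pure_def wt_def)
  obtain k where "off_y k = 0" "k \<in> keys F \<or> k \<in> keys G"
    by (rule pure_power_in_generators[OF weight_off(1) _ part_ex_ey(2) ey]) (auto simp: split_paired_all)
  then have Y: "(0, 0, c, 0) \<in> keys F \<or> (0, 0, m, 0) \<in> keys G" using y F(1) G(1) by metis
  obtain k where "off_x k = 0" "k \<in> keys F \<or> k \<in> keys G"
    by (rule pure_power_in_generators[OF weight_off(2) _ part_ex_ey(1) ex]) (auto simp: split_paired_all)
  then have X: "(0, c, 0, 0) \<in> keys F \<or> (0, m, 0, 0) \<in> keys G" using x F(1) G(1) by metis
  \<comment> \<open>x^p and y^p have first bidegrees 3p and p, which differ for positive p.\<close>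
  have not_both: "\<not> ((0, 0, p, 0) \<in> keys H \<and> (0, p, 0, 0) \<in> keys H)" if H: "pure w1 q H" "0 < p"
    for q p and H :: "'k poly4"
  proof
    assume "(0, 0, p, 0) \<in> keys H \<and> (0, p, 0, 0) \<in> keys H"
    then have "w1 (0, 0, p, 0) = w1 (0, p, 0, 0)" using H(1) by (simp add: pure_def)
    then show False using H(2) by (simp add: w1_def)
  qed
  consider "(0, 0, c, 0) \<in> keys F" "(0, m, 0, 0) \<in> keys G" | "(0, c, 0, 0) \<in> keys F" "(0, 0, m, 0) \<in> keys G"
    using X Y not_both[OF F(2,3)] not_both[OF G(2,3)] by blast
  then show ?thesis
  proof cases
    case 1
    then show ?thesis using no_bihomogeneous_pair_aux[OF F(1,2) _ F(3) G(1,2) _ G(3)] by blast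
  next
    case 2
    then show ?thesis
      using no_bihomogeneous_pair_aux[OF G(1,2) _ G(3) F(1,2) _ F(3), of n] by (simp add: insert_commute)
  qed
qed

text \<open>The mixed second difference of the cubic \<open>card (mons n)\<close> with steps \<open>a\<close>, \<open>b\<close> is \<open>a b n + O(1)\<close>.\<close>

lemma bounded_defect_imp_le:
  fixes a b p q K :: nat
  assumes "\<And>n. a + b \<le> n \<Longrightarrow> p + q \<le> n \<Longrightarrow>
    card (mons (n - p)) + card (mons (n - q)) + card (mons (n - (a + b))) \<le>
    card (mons (n - a)) + card (mons (n - b)) + card (mons (n - (p + q))) + K"
  shows "a * b \<le> p * q"
proof (rule ccontr)
  assume "\<not> a * b \<le> p * q"
  then have gt: "real (p * q) + 1 \<le> real (a * b)" by linarith
  \<comment> \<open>Large enough for the linear term, whose coefficient is at least 6, to exceed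
    \<open>6 * K\<close> and the constant \<open>3 * a * b * (a + b)\<close>.\<close>
  define n where "n = a + b + (p + q) + K + a * b * (a + b)"
  let ?P = "\<lambda>x :: real. (x + 1) * (x + 2) * (x + 3)"
  have le: "a + b \<le> n" "p + q \<le> n" "a \<le> n" "b \<le> n" "p \<le> n" "q \<le> n" by (simp_all add: n_def)
  have P: "6 * real (card (mons (n - i))) = ?P (real n - real i)" if "i \<le> n" for i
    using real_card_mons[of "n - i"] that by (simp add: of_nat_diff)
  define A where "A = real a" define B where "B = real b" define U where "U = real p"
  define V where "V = real q" define X where "X = real n" define k where "k = real K"
  note defs = A_def B_def U_def V_def X_def k_def
  have "real (card (mons (n - p))) + real (card (mons (n - q))) + real (card (mons (n - (a + b)))) \<le>
      real (card (mons (n - a))) + real (card (mons (n - b))) + real (card (mons (n - (p + q)))) + real K"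
    using assms[OF le(1,2)] by (simp flip: of_nat_add)
  then have "?P (X - U) + ?P (X - V) + ?P (X - (A + B)) \<le> ?P (X - A) + ?P (X - B) + ?P (X - (U + V)) + 6 * k"
    using P[OF le(1)] P[OF le(2)] P[OF le(3)] P[OF le(4)] P[OF le(5)] P[OF le(6)]
    unfolding defs by (simp only: of_nat_add)
  moreover have "?P (X - U) + ?P (X - V) + ?P (X - (A + B)) - (?P (X - A) + ?P (X - B) + ?P (X - (U + V)))
      = A * B * (6 * X + 12 - 3 * (A + B)) - U * V * (6 * X + 12 - 3 * (U + V))"
    by (simp add: algebra_simps)
  ultimately have "A * B * (6 * X + 12 - 3 * (A + B)) - U * V * (6 * X + 12 - 3 * (U + V)) \<le> 6 * k"
    by linarith
  then have 1: "(A * B - U * V) * (6 * X + 12) \<le> 6 * k + 3 * (A * B * (A + B)) - 3 * (U * V * (U + V))"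
    by (simp add: algebra_simps)
  have "1 \<le> A * B - U * V" using gt by (simp add: A_def B_def U_def V_def)
  moreover have "0 \<le> 6 * X + 12" by (simp add: X_def)
  ultimately have 2: "6 * X + 12 \<le> (A * B - U * V) * (6 * X + 12)" using mult_right_mono by fastforce
  have 3: "0 \<le> U * V * (U + V)" "0 \<le> A" "0 \<le> B" "0 \<le> U" "0 \<le> V" "0 \<le> A * B * (A + B)" "0 \<le> k"
    by (simp_all add: defs)
  have "X = A + B + (U + V) + k + A * B * (A + B)" by (simp add: n_def defs)
  with 1 2 3 show False by linarith
qed

text \<open>Both choices of \<open>\<omega>\<close> are treated at once: \<open>w1\<close> yields
  the lowest components and its negative the highest. The equality of the radical with the curve
  ideal enters through \<open>nilpotent\<close>, for bihomogeneous elements.\<close>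

locale degeneration =
  fixes f g h f1 g1 :: "'k::field_char_0 poly4" and \<omega> :: "mon4 \<Rightarrow> int" and i j :: int and d1 d2 :: nat
  assumes \<omega>: "\<omega> = w1 \<or> \<omega> = (\<lambda>m. - w1 m)"
    and f_hom: "f \<in> hom d1" and g_hom: "g \<in> hom d2" and d_pos: "0 < d1" "0 < d2"
    and f: "low \<omega> i f" "part (\<lambda>m. \<omega> m = i) f = h * f1"
    and g: "low \<omega> j g" "part (\<lambda>m. \<omega> m = j) g = h * g1"
    and nz: "h * f1 \<noteq> 0" "h * g1 \<noteq> 0"
    and cop: "\<And>u v. f1 * u = g1 * v \<Longrightarrow> g1 dvd u"
    and nilpotent: "\<And>e s n. pure w1 s e \<Longrightarrow> e \<in> hom n \<Longrightarrow> eps e = 0 \<Longrightarrow> \<exists>k. e ^ k \<in> ideal_gen {f, g}"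
begin

lemma w: "weight \<omega>"
  using \<omega> weight_w1 weight_uminus by auto

lemma pure_w1: "pure \<omega> s p \<Longrightarrow> pure w1 s p \<or> pure w1 (- s) p"
  using \<omega> by (auto simp: pure_def)

lemma pure_\<omega>: "pure w1 s p \<Longrightarrow> pure \<omega> s p \<or> pure \<omega> (- s) p"
  using \<omega> by (auto simp: pure_def)

lemma pure_\<omega>_ex: "pure w1 s p \<Longrightarrow> \<exists>s. pure \<omega> s p"
  using pure_\<omega> by blast

lemma pure_w1_ex: "pure \<omega> s p \<Longrightarrow> \<exists>s. pure w1 s p"
  using pure_w1 by blast

lemma initial_hom: "h * f1 \<in> hom d1" "h * g1 \<in> hom d2"
  using f_hom g_hom unfolding f(2)[symmetric] g(2)[symmetric] by (auto simp: hom_def pure_def keys_part)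

lemma initial_pure: "pure \<omega> i (h * f1)" "pure \<omega> j (h * g1)"
  unfolding f(2)[symmetric] g(2)[symmetric] by (rule pure_part)+

lemma factors_hom:
  obtains \<delta> p q where "h \<in> hom \<delta>" "f1 \<in> hom p" "g1 \<in> hom q" "\<delta> + p = d1" "\<delta> + q = d2"
proof -
  obtain \<delta> p where 1: "h \<in> hom \<delta>" "f1 \<in> hom p" "\<delta> + p = d1" by (rule hom_factors[OF initial_hom(1) nz(1)])
  obtain \<delta>' q where 2: "h \<in> hom \<delta>'" "g1 \<in> hom q" "\<delta>' + q = d2" by (rule hom_factors[OF initial_hom(2) nz(2)])
  have "h \<noteq> 0" using nz by auto
  then have "\<delta>' = \<delta>" using pure_unique 1(1) 2(1) unfolding hom_def by fastforce
  with 1 2 show thesis using that by blast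
qed

lemma factors_pure:
  obtains s p q where "pure \<omega> s h" "pure \<omega> p f1" "pure \<omega> q g1" "s + p = i" "s + q = j"
proof -
  obtain s p where 1: "pure \<omega> s h" "pure \<omega> p f1" "s + p = i" by (rule pure_factors[OF w initial_pure(1) nz(1)])
  obtain s' q where 2: "pure \<omega> s' h" "pure \<omega> q g1" "s' + q = j" by (rule pure_factors[OF w initial_pure(2) nz(2)])
  have "h \<noteq> 0" using nz by auto
  then have "s' = s" using pure_unique 1(1) 2(1) by fastforce
  with 1 2 show thesis using that by blast
qed

lemma power_multiple_initial:
  assumes "a \<in> ideal_gen {f, g}" "pure \<omega> s a"
  shows "\<exists>n. h ^ n * a \<in> ideal_gen {h * f1, h * g1}"
proof -
  have "\<exists>n. h ^ n * part (\<lambda>m. \<omega> m = s) a \<in> ideal_gen {h * f1, h * g1}"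
    by (rule initial_form_power_multiple[OF w f g nz _ assms(1) pure_imp_low[OF assms(2)]]) (rule cop)
  then show ?thesis using part_of_pure[OF assms(2), of s] by simp
qed

section \<open>Dimension of the space of lowest components\<close>

definition In :: "nat \<Rightarrow> 'k poly4 set" where "In n = ideal_gen {f, g} \<inter> hom n"

text \<open>Kept as a set of lowest components, without taking its span; its size is measured by
  independent subsets. Since \<open>s\<close> is only a lower bound, 0 is included.\<close>

definition Init :: "nat \<Rightarrow> 'k poly4 set" where
  "Init n = {part (\<lambda>m. \<omega> m = s) a | a s. a \<in> In n \<and> low \<omega> s a}"

lemma In_subset_span: "In n \<subseteq> pm.span (mon ` mons n)"
  unfolding In_def using hom_subset_span by blast

lemma Init_subset_hom: "Init n \<subseteq> hom n"
  by (auto simp: Init_def In_def hom_def pure_def keys_part)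

lemma In_eq:
  assumes n: "d1 + d2 \<le> n"
  shows "In n = {f * u + g * v | u v. u \<in> hom (n - d1) \<and> v \<in> hom (n - d2)}"
proof
  show "In n \<subseteq> {f * u + g * v | u v. u \<in> hom (n - d1) \<and> v \<in> hom (n - d2)}"
  proof
    fix a assume "a \<in> In n"
    then obtain \<alpha> \<beta> where a: "a = \<alpha> * f + \<beta> * g" "a \<in> hom n" unfolding In_def ideal_gen_pair by blast
    let ?u = "part (\<lambda>m. wt m = int (n - d1)) \<alpha>" and ?v = "part (\<lambda>m. wt m = int (n - d2)) \<beta>"
    have "a = part (\<lambda>m. wt m = int n) a" using a(2) part_of_pure[of wt "int n" a "int n"] by (simp add: hom_def)
    also have "\<dots> = part (\<lambda>m. wt m = int (n - d1) + int d1) (\<alpha> * f) + part (\<lambda>m. wt m = int (n - d2) + int d2) (\<beta> * g)"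
      using n by (simp add: a(1) part_add of_nat_diff)
    also have "\<dots> = f * ?u + g * ?v"
      using f_hom g_hom by (simp add: part_mult_pure[OF weight_wt] hom_def mult.commute)
    finally have "a = f * ?u + g * ?v" .
    moreover have "?u \<in> hom (n - d1)" "?v \<in> hom (n - d2)" by (simp_all add: hom_def pure_part)
    ultimately show "a \<in> {f * u + g * v | u v. u \<in> hom (n - d1) \<and> v \<in> hom (n - d2)}" by blast
  qed
  show "{f * u + g * v | u v. u \<in> hom (n - d1) \<and> v \<in> hom (n - d2)} \<subseteq> In n"
  proof
    fix a assume "a \<in> {f * u + g * v | u v. u \<in> hom (n - d1) \<and> v \<in> hom (n - d2)}"
    then obtain u v where a: "a = f * u + g * v" "u \<in> hom (n - d1)" "v \<in> hom (n - d2)" by blast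
    have "f * u \<in> hom n" "g * v \<in> hom n"
      using hom_mult[OF f_hom a(2)] hom_mult[OF g_hom a(3)] n by simp_all
    then have "a \<in> hom n" using a(1) by (simp add: hom_def pure_add)
    moreover have "a = u * f + v * g" using a(1) by (simp add: mult.commute)
    then have "a \<in> ideal_gen {f, g}" using ideal_gen_pairI by simp
    ultimately show "a \<in> In n" by (simp add: In_def)
  qed
qed

text \<open>Independent lowest components lift to independent elements of the ideal: in a relation
  among the lifts, the part of minimal weight would be a relation among the components.\<close>

lemma card_independent_Init:
  assumes B: "B \<subseteq> Init n" and ind: "pm.independent B"
  shows "finite B \<and> card B \<le> pm.dim (In n)"
proof -
  have "B \<subseteq> pm.span (mon ` mons n)"
    by (rule subset_trans[OF B subset_trans[OF Init_subset_hom hom_subset_span]])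
  from pm.independent_span_bound[OF finite_imageI[OF finite_mons] ind this]
  have finB: "finite B" by (rule conjunct1)
  have "\<exists>x. fst x \<in> In n \<and> low \<omega> (snd x) (fst x) \<and> part (\<lambda>m. \<omega> m = snd x) (fst x) = b" if b: "b \<in> B" for b
  proof -
    have "b \<in> Init n" using B b by (rule subsetD)
    then obtain a s where "b = part (\<lambda>m. \<omega> m = s) a \<and> a \<in> In n \<and> low \<omega> s a"
      unfolding Init_def by (elim CollectE exE)
    then show ?thesis by (intro exI[of _ "(a, s)"]) simp
  qed
  note ex = this
  define x where "x b = (SOME x. fst x \<in> In n \<and> low \<omega> (snd x) (fst x) \<and>
    part (\<lambda>m. \<omega> m = snd x) (fst x) = b)" for b
  define A where "A b = fst (x b)" for b
  define S where "S b = snd (x b)" for b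
  have A: "A b \<in> In n" and lowA: "low \<omega> (S b) (A b)" and partA: "part (\<lambda>m. \<omega> m = S b) (A b) = b"
    if "b \<in> B" for b
    using someI_ex[OF ex[OF that]] unfolding A_def S_def x_def by simp_all
  have nz: "b \<noteq> 0" if "b \<in> B" for b
  proof
    assume "b = 0"
    then show False using that ind pm.dependent_zero[of B] by simp
  qed
  have le: "S b' \<le> S b" if "b \<in> B" "b' \<in> B" "A b = A b'" for b b'
  proof (rule ccontr)
    assume "\<not> S b' \<le> S b"
    then have "part (\<lambda>m. \<omega> m = S b) (A b') = 0" using lowA[OF that(2)] by (intro part_of_low) auto
    then show False using partA[OF that(1)] nz[OF that(1)] that(3) by simp
  qed
  have inj: "inj_on A B"
  proof (rule inj_onI)
    fix b b' assume bb: "b \<in> B" "b' \<in> B" "A b = A b'"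
    have S: "S b = S b'" using le[OF bb] le[OF bb(2,1) bb(3)[symmetric]] by (rule antisym[rotated])
    have "b = part (\<lambda>m. \<omega> m = S b) (A b)" by (rule partA[OF bb(1), symmetric])
    also have "\<dots> = part (\<lambda>m. \<omega> m = S b') (A b')" by (simp only: S bb(3))
    also have "\<dots> = b'" by (rule partA[OF bb(2)])
    finally show "b = b'" .
  qed
  have "pm.independent (A ` B)"
  proof (rule pm.independent_if_scalars_zero)
    show "finite (A ` B)" using finB by simp
    fix c x assume 0: "(\<Sum>x\<in>A ` B. coef (c x) * x) = 0" and x: "x \<in> A ` B"
    show "c x = 0"
    proof (rule ccontr)
      assume "c x \<noteq> 0"
      \<comment> \<open>Among the lifts with nonzero coefficient, those of minimal weight
        \<open>s\<close> are the only ones contributing in weight \<open>s\<close>.\<close>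
      define T where "T = {b \<in> B. c (A b) \<noteq> 0}"
      have T: "finite T" "T \<noteq> {}" using finB x \<open>c x \<noteq> 0\<close> by (auto simp: T_def)
      define s where "s = Min (S ` T)"
      have "s \<in> S ` T" unfolding s_def using T by (intro Min_in) auto
      then obtain b0 where b0: "b0 \<in> T" "S b0 = s" by blast
      have smin: "s \<le> S b" if "b \<in> T" for b unfolding s_def using T that by simp
      have part_term: "part (\<lambda>m. \<omega> m = s) (coef (c (A b)) * A b) = coef (if b \<in> T \<and> S b = s then c (A b) else 0) * b"
        if b: "b \<in> B" for b
      proof (cases "b \<in> T")
        case True
        show ?thesis
        proof (cases "S b = s")
          case True
          have "part (\<lambda>m. \<omega> m = s) (A b) = b" using partA[OF b] True by simp
          then show ?thesis using True \<open>b \<in> T\<close> by (simp add: part_coef_mult)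
        next
          case False
          then have "s < S b" using smin[OF \<open>b \<in> T\<close>] by simp
          then have "part (\<lambda>m. \<omega> m = s) (A b) = 0" by (rule part_of_low[OF lowA[OF b]])
          then show ?thesis using False by (simp add: part_coef_mult)
        qed
      next
        case False
        then have "c (A b) = 0" using b by (simp add: T_def)
        then show ?thesis using False part_eq_0[of 0] by simp
      qed
      have "(\<Sum>b\<in>B. coef (c (A b)) * A b) = 0" using 0 by (simp add: sum.reindex[OF inj])
      then have "part (\<lambda>m. \<omega> m = s) (\<Sum>b\<in>B. coef (c (A b)) * A b) = 0" using part_eq_0[of 0] by simp
      then have "(\<Sum>b\<in>B. coef (if b \<in> T \<and> S b = s then c (A b) else 0) * b) = 0"
        unfolding part_sum using part_term by simp
      from pm.independentD[OF ind finB subset_refl this, of b0] b0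
      show False by (simp add: T_def)
    qed
  qed
  moreover obtain D where D: "D \<subseteq> In n" "pm.independent D" "In n \<subseteq> pm.span D" "card D = pm.dim (In n)"
    by (rule pm.basis_exists)
  moreover have "finite D"
    using pm.independent_span_bound[OF finite_imageI[OF finite_mons] D(2) subset_trans[OF D(1) In_subset_span]]
    by (rule conjunct1)
  moreover have "A ` B \<subseteq> pm.span D" using A D(3) by (auto dest: subsetD)
  ultimately have "card (A ` B) \<le> card D" using pm.independent_span_bound[of D "A ` B"] by simp
  then show ?thesis using card_image[OF inj] D(4) finB by simp
qed

lemma InitI: "a \<in> ideal_gen {f, g} \<Longrightarrow> a \<in> hom n \<Longrightarrow> pure \<omega> s a \<Longrightarrow> a \<in> Init n"
  unfolding Init_def In_def using part_of_pure[of \<omega> s a s] pure_imp_low[of \<omega> s a]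
  by (auto intro!: exI[of _ a] exI[of _ s])

lemma Init_initial_mult:
  assumes u: "u \<in> hom k" "pure \<omega> s u"
  shows "(h * f1) * u \<in> Init (d1 + k)" "(h * g1) * u \<in> Init (d2 + k)"
proof -
  have "part (\<lambda>m. \<omega> m = s + i) (u * f) = part (\<lambda>m. \<omega> m = s) u * part (\<lambda>m. \<omega> m = i) f"
    by (rule part_mult_low[OF w pure_imp_low[OF u(2)] f(1)])
  then have "(h * f1) * u = part (\<lambda>m. \<omega> m = s + i) (u * f)"
    using part_of_pure[OF u(2), of s] f(2) by (simp add: mult.commute)
  moreover have "low \<omega> (s + i) (u * f)" by (rule low_mult[OF w pure_imp_low[OF u(2)] f(1)])
  moreover have "u * f \<in> In (d1 + k)"
    using hom_mult[OF u(1) f_hom] ideal_gen_pairI[of u f 0 g] by (simp add: In_def add.commute)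
  ultimately show "(h * f1) * u \<in> Init (d1 + k)" unfolding Init_def by blast
  have "part (\<lambda>m. \<omega> m = s + j) (u * g) = part (\<lambda>m. \<omega> m = s) u * part (\<lambda>m. \<omega> m = j) g"
    by (rule part_mult_low[OF w pure_imp_low[OF u(2)] g(1)])
  then have "(h * g1) * u = part (\<lambda>m. \<omega> m = s + j) (u * g)"
    using part_of_pure[OF u(2), of s] g(2) by (simp add: mult.commute)
  moreover have "low \<omega> (s + j) (u * g)" by (rule low_mult[OF w pure_imp_low[OF u(2)] g(1)])
  moreover have "u * g \<in> In (d2 + k)"
    using hom_mult[OF u(1) g_hom] ideal_gen_pairI[of 0 f u g] by (simp add: In_def add.commute)
  ultimately show "(h * g1) * u \<in> Init (d2 + k)" unfolding Init_def by blast
qed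

lemma ex_pure: "pure w1 12 ex" "ex \<in> hom 4" "eps ex = 0" and ey_pure: "pure w1 4 ey" "ey \<in> hom 4" "eps ey = 0"
  unfolding ex_def ey_def
  by (auto intro!: pure_diff pure_single hom_diff hom_mon simp: w1_def)

text \<open>This supplies the hypotheses of \<open>reduction\<close> uniformly in the degree. Powers
  of \<open>ex\<close> and \<open>ey\<close> lie in the ideal (f, g); the monomial w^A z^D comes
  from combining a power of \<open>e3\<close> with the fact that \<open>h * f1\<close> and
  \<open>h * g1\<close> are lowest components.\<close>

lemma finite_codimension:
  assumes "eps h \<noteq> 0"
  obtains N A D where "\<And>p \<phi> k n Z \<mu>. pm.subspace Z \<Longrightarrow> Init n \<subseteq> Z \<Longrightarrow>
     (\<phi> = f1 \<or> \<phi> = g1) \<Longrightarrow> \<phi> \<in> hom p \<Longrightarrow> p + k = n \<Longrightarrow>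
     (\<And>\<mu>. \<mu> \<in> residual (4 * N) A D k \<Longrightarrow> \<phi> * mon \<mu> \<in> Z) \<Longrightarrow> tdeg \<mu> = k \<Longrightarrow> \<phi> * mon \<mu> \<in> Z"
proof -
  obtain \<delta> p0 q0 where hom: "h \<in> hom \<delta>" "f1 \<in> hom p0" "g1 \<in> hom q0" "\<delta> + p0 = d1" "\<delta> + q0 = d2"
    by (rule factors_hom)
  obtain sh sf sg where pur: "pure \<omega> sh h" "pure \<omega> sf f1" "pure \<omega> sg g1" by (rule factors_pure)
  have "h \<noteq> 0" using nz by auto
  then have "keys h \<noteq> {}" by simp
  then obtain \<kappa> where \<kappa>: "\<kappa> \<in> keys h" by blast
  \<comment> \<open>The fourth power of \<open>h\<close> has the bidegree of w^i0 z^j0, since w and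
    z have bidegrees (4,0) and (0,4).\<close>
  define i0 j0 where "i0 = bideg1 \<kappa>" and "j0 = bideg2 \<kappa>"
  have \<delta>: "tdeg \<kappa> = \<delta>" using \<kappa> hom(1) by (simp add: hom_def pure_def wt_def)
  have ij: "i0 + j0 = 4 * \<delta>" unfolding \<delta>[symmetric] i0_def j0_def by (cases \<kappa>) simp
  obtain s0 where s0: "pure w1 s0 h" using pure_w1_ex[OF pur(1)] by blast
  then have "s0 = int i0" using \<kappa> by (simp add: pure_def w1_def i0_def)
  with s0 have h_w1: "pure w1 (int i0) h" by simp
  define r where "r = eps h ^ 4"
  define q where "q = (Poly_Mapping.single (i0, 0, 0, j0) r :: 'k poly4)"
  define e3 where "e3 = h ^ 4 - q" \<comment> \<open>vanishes on the curve, so modulo \<open>h\<close> and a power of \<open>e3\<close> some \<open>w\<^sup>A z\<^sup>D\<close> becomes zero\<close>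
  have q_hom: "q \<in> hom (4 * \<delta>)" unfolding q_def hom_def mem_Collect_eq by (rule pure_single) (use ij in \<open>simp add: wt_def\<close>)
  have q_w1: "pure w1 (int 4 * int i0) q" unfolding q_def by (rule pure_single) (simp add: w1_def)
  have e3_hom: "e3 \<in> hom (4 * \<delta>)" unfolding e3_def by (rule hom_diff[OF hom_power[OF hom(1)] q_hom])
  have e3_w1: "pure w1 (int 4 * int i0) e3" unfolding e3_def by (rule pure_diff[OF pure_power[OF weight_w1 h_w1] q_w1])
  have e3_eps: "eps e3 = 0" by (simp add: e3_def q_def r_def)
  obtain k1 where k1: "ex ^ k1 \<in> ideal_gen {f, g}" using nilpotent[OF ex_pure] by blast
  obtain k2 where k2: "ey ^ k2 \<in> ideal_gen {f, g}" using nilpotent[OF ey_pure] by blast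
  obtain k3 where k3: "e3 ^ k3 \<in> ideal_gen {f, g}" using nilpotent[OF e3_w1 e3_hom e3_eps] by blast
  \<comment> \<open>One exponent serving all three nilpotent elements.\<close>
  define N where "N = k1 + k2 + k3"
  have N: "ex ^ N \<in> ideal_gen {f, g}" "ey ^ N \<in> ideal_gen {f, g}" "e3 ^ N \<in> ideal_gen {f, g}"
    using ideal_gen_pair_mult[OF k1, of "ex ^ (k2 + k3)"] ideal_gen_pair_mult[OF k2, of "ey ^ (k1 + k3)"]
      ideal_gen_pair_mult[OF k3, of "e3 ^ (k1 + k2)"]
    by (simp_all add: N_def ac_simps flip: power_add)
  have mult_Init: "\<phi> * (mon \<mu> * e ^ N) \<in> Init n"
    if \<phi>: "\<phi> = f1 \<or> \<phi> = g1" "\<phi> \<in> hom p" and e: "e ^ N \<in> ideal_gen {f, g}" "e \<in> hom c" "pure w1 s e"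
      and n: "p + (tdeg \<mu> + N * c) = n" for \<phi> p \<mu> e c s n
  proof -
    obtain s' where s': "pure \<omega> s' e" using pure_\<omega>_ex[OF e(3)] by blast
    have "mon \<mu> * e ^ N \<in> hom (tdeg \<mu> + N * c)" by (rule hom_mult[OF hom_mon[OF refl] hom_power[OF e(2)]])
    from hom_mult[OF \<phi>(2) this] have 1: "\<phi> * (mon \<mu> * e ^ N) \<in> hom n" using n by simp
    have "pure \<omega> (\<omega> \<mu> + int N * s') (mon \<mu> * e ^ N)" by (intro pure_mult[OF w] pure_power[OF w s'] pure_single refl)
    moreover obtain sp where "pure \<omega> sp \<phi>" using \<phi>(1) pur by blast
    ultimately have 2: "pure \<omega> (sp + (\<omega> \<mu> + int N * s')) (\<phi> * (mon \<mu> * e ^ N))" by (rule pure_mult[OF w, rotated])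
    have "(\<phi> * mon \<mu>) * e ^ N \<in> ideal_gen {f, g}" by (rule ideal_gen_pair_mult[OF e(1)])
    then have 3: "\<phi> * (mon \<mu> * e ^ N) \<in> ideal_gen {f, g}" by (simp only: mult.assoc)
    show ?thesis by (rule InitI[OF 3 1 2])
  qed
  \<comment> \<open>The cofactor of \<open>e3 - (- q) = h ^ 4\<close> in the difference of the N-th
    powers, which is therefore a multiple of \<open>h\<close>.\<close>
  define T where "T = (\<Sum>l<N. (- q) ^ (N - Suc l) * e3 ^ l)"
  define t where "t = T * h ^ 3"
  have e3N: "e3 ^ N - (- q) ^ N = h * t"
  proof -
    have "e3 ^ N - (- q) ^ N = (e3 - (- q)) * T" unfolding T_def by (rule power_diff_sumr2)
    also have "e3 - (- q) = h ^ 4" by (simp add: e3_def)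
    also have "h ^ 4 = h * h ^ 3" by (simp add: power4_eq_xxxx power3_eq_cube mult.assoc)
    finally show ?thesis unfolding t_def by (simp only: ac_simps)
  qed
  have nq: "- q = Poly_Mapping.single (i0, 0, 0, j0) (- r)" by (simp add: q_def single_uminus)
  have q_pow: "(- q) ^ l = Poly_Mapping.single (l * i0, 0, 0, l * j0) ((- r) ^ l)" for l
  proof (induction l)
    case 0
    show ?case by (simp add: zero_prod_def flip: single_one)
  next
    case (Suc l)
    have "(- q) ^ Suc l = (- q) * (- q) ^ l" by (rule power_Suc)
    also have "\<dots> = Poly_Mapping.single (i0 + l * i0, 0, 0, j0 + l * j0) (- r * (- r) ^ l)"
      unfolding Suc unfolding nq mult_single by simp
    finally show ?case by (simp only: mult_Suc power_Suc)
  qed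
  have rN: "(- r) ^ N \<noteq> 0" using assms by (simp add: r_def)
  have nq_hom: "- q \<in> hom (4 * \<delta>)" unfolding nq hom_def mem_Collect_eq
    by (rule pure_single) (use ij in \<open>simp add: wt_def\<close>)
  have nq_w1: "pure w1 (int 4 * int i0) (- q)" unfolding nq by (rule pure_single) (simp add: w1_def)
  have ht_hom: "h * t \<in> hom (N * (4 * \<delta>))"
    unfolding e3N[symmetric] by (rule hom_diff[OF hom_power[OF e3_hom] hom_power[OF nq_hom]])
  have ht_w1: "pure w1 (int N * (int 4 * int i0)) (h * t)"
    unfolding e3N[symmetric] by (rule pure_diff[OF pure_power[OF weight_w1 e3_w1] pure_power[OF weight_w1 nq_w1]])
  show thesis
  proof (rule that[of N "N * i0" "N * j0"])
    fix p \<phi> k n Z \<mu>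
    assume Z: "pm.subspace Z" "Init n \<subseteq> Z" and \<phi>: "\<phi> = f1 \<or> \<phi> = g1" "\<phi> \<in> hom p" and n: "p + k = n"
      and res: "\<And>\<mu>. \<mu> \<in> residual (4 * N) (N * i0) (N * j0) k \<Longrightarrow> \<phi> * mon \<mu> \<in> Z" and \<mu>: "tdeg \<mu> = k"
    show "\<phi> * mon \<mu> \<in> Z"
    proof (rule reduction[OF Z(1) _ _ _ res \<mu>])
      show "\<phi> * (mon \<mu>' * ex ^ N) \<in> Z" if "tdeg \<mu>' + 4 * N = k" for \<mu>'
        using mult_Init[OF \<phi> N(1) ex_pure(2,1), of \<mu>' n] that n Z(2) by (auto simp: mult.commute)
      show "\<phi> * (mon \<mu>' * ey ^ N) \<in> Z" if "tdeg \<mu>' + 4 * N = k" for \<mu>'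
        using mult_Init[OF \<phi> N(2) ey_pure(2,1), of \<mu>' n] that n Z(2) by (auto simp: mult.commute)
      show "\<phi> * (mon \<mu>' * mon (N * i0, 0, 0, N * j0)) \<in> Z" if \<mu>': "tdeg \<mu>' + (N * i0 + N * j0) = k" for \<mu>'
      proof -
        have NN: "N * i0 + N * j0 = N * (4 * \<delta>)" using ij by (simp flip: distrib_left)
        have 1: "\<phi> * (mon \<mu>' * e3 ^ N) \<in> Z"
          using mult_Init[OF \<phi> N(3) e3_hom e3_w1, of \<mu>' n] \<mu>' n Z(2) NN by auto
        \<comment> \<open>\<open>h * \<phi>\<close> is the lowest component of \<open>f\<close> or
          \<open>g\<close>, and the cofactor is bihomogeneous, so the product is again a lowest
          component.\<close>
        have 2: "(h * \<phi>) * (mon \<mu>' * t) \<in> Z"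
        proof (cases "t = 0")
          case True
          then show ?thesis using pm.subspace_0[OF Z(1)] by simp
        next
          case False
          with \<open>h \<noteq> 0\<close> have ht: "h * t \<noteq> 0" by simp
          obtain a b where ab: "h \<in> hom a" "t \<in> hom b" "a + b = N * (4 * \<delta>)" by (rule hom_factors[OF ht_hom ht])
          have "a = \<delta>" using pure_unique[of wt "int a" h "int \<delta>"] ab(1) hom(1) \<open>h \<noteq> 0\<close> by (simp add: hom_def)
          obtain s1 s2 where "pure w1 s1 h" "pure w1 s2 t" by (rule pure_factors[OF weight_w1 ht_w1 ht])
          then obtain s3 where "pure \<omega> s3 t" using pure_\<omega>_ex by blast
          then have u2: "pure \<omega> (\<omega> \<mu>' + s3) (mon \<mu>' * t)" by (intro pure_mult[OF w] pure_single refl)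
          have u1: "mon \<mu>' * t \<in> hom (tdeg \<mu>' + b)" by (rule hom_mult[OF hom_mon[OF refl] ab(2)])
          have "(\<phi> = f1 \<and> d1 + (tdeg \<mu>' + b) = n) \<or> (\<phi> = g1 \<and> d2 + (tdeg \<mu>' + b) = n)"
          proof -
            have nb: "\<delta> + p + (tdeg \<mu>' + b) = n" using ab(3) \<open>a = \<delta>\<close> n \<mu>' NN by (simp add: ac_simps)
            have "f1 \<noteq> 0" "g1 \<noteq> 0" using nz by auto
            show ?thesis
            proof (cases "\<phi> = f1")
              case True
              then have "p = p0" using pure_unique[of wt "int p" f1 "int p0"] \<phi>(2) hom(2) \<open>f1 \<noteq> 0\<close> by (simp add: hom_def)
              then show ?thesis using True nb hom(4) by simp
            next
              case False
              then have g1: "\<phi> = g1" using \<phi>(1) by simp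
              then have "p = q0" using pure_unique[of wt "int p" g1 "int q0"] \<phi>(2) hom(3) \<open>g1 \<noteq> 0\<close> by (simp add: hom_def)
              then show ?thesis using g1 nb hom(5) by simp
            qed
          qed
          then show ?thesis using Init_initial_mult[OF u1 u2] Z(2) by auto
        qed
        \<comment> \<open>\<open>(- q) ^ N\<close> is the difference of the two elements treated
          above; its coefficient is a power of \<open>eps h\<close> up to sign, hence
          invertible.\<close>
        have inv: "coef (inverse ((- r) ^ N)) * (- q) ^ N = mon (N * i0, 0, 0, N * j0)"
          unfolding q_pow using rN by (simp add: mult_single)
        have "\<phi> * (mon \<mu>' * e3 ^ N) - (h * \<phi>) * (mon \<mu>' * t) = \<phi> * (mon \<mu>' * (e3 ^ N - h * t))"
          by (simp add: algebra_simps)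
        also have "e3 ^ N - h * t = (- q) ^ N" unfolding e3N[symmetric] by simp
        finally have "\<phi> * (mon \<mu>' * (- q) ^ N) \<in> Z" using pm.subspace_diff[OF Z(1) 1 2] by simp
        then have "coef (inverse ((- r) ^ N)) * (\<phi> * (mon \<mu>' * (- q) ^ N)) \<in> Z" by (rule pm.subspace_scale[OF Z(1)])
        also have "coef (inverse ((- r) ^ N)) * (\<phi> * (mon \<mu>' * (- q) ^ N)) =
            \<phi> * (mon \<mu>' * (coef (inverse ((- r) ^ N)) * (- q) ^ N))" by (simp only: ac_simps)
        finally show ?thesis unfolding inv .
      qed
    qed
  qed
qed

text \<open>A maximal independent subset of \<open>Init n\<close> together with the residual
  multiples of \<open>f1\<close> and \<open>g1\<close> spans the degree \<open>n\<close> part of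
  (f1, g1); the residual sets have bounded size.\<close>

lemma dim_initial_le:
  assumes eps: "eps h \<noteq> 0" and p: "f1 \<in> hom p" "p \<le> d1" and q: "g1 \<in> hom q" "q \<le> d2"
  shows "\<exists>K. \<forall>n\<ge>d1 + d2.
    pm.dim {f1 * u + g1 * v | u v. u \<in> hom (n - p) \<and> v \<in> hom (n - q)} \<le> pm.dim (In n) + K"
proof (rule finite_codimension[OF eps])
  fix N A D
  assume fc: "\<And>p \<phi> k n Z \<mu>. pm.subspace Z \<Longrightarrow> Init n \<subseteq> Z \<Longrightarrow>
     (\<phi> = f1 \<or> \<phi> = g1) \<Longrightarrow> \<phi> \<in> hom p \<Longrightarrow> p + k = n \<Longrightarrow>
     (\<And>\<mu>. \<mu> \<in> residual (4 * N) A D k \<Longrightarrow> \<phi> * mon \<mu> \<in> Z) \<Longrightarrow> tdeg \<mu> = k \<Longrightarrow> \<phi> * mon \<mu> \<in> Z"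
  let ?R = "residual (4 * N) A D"
  define M where "M = (4 * N) * (4 * N) * (A + D)"
  have R: "finite (?R k)" "card (?R k) \<le> M" for k using residual_card[of "4 * N" A D k] by (simp_all add: M_def)
  have "pm.dim {f1 * u + g1 * v | u v. u \<in> hom (n - p) \<and> v \<in> hom (n - q)} \<le> pm.dim (In n) + 2 * M"
    if n: "d1 + d2 \<le> n" for n
  proof -
    obtain B where B: "B \<subseteq> Init n" "pm.independent B" "Init n \<subseteq> pm.span B"
      by (rule pm.maximal_independent_subset)
    have cB: "finite B" "card B \<le> pm.dim (In n)" using card_independent_Init[OF B(1,2)] by auto
    let ?R1 = "(\<lambda>\<mu>. f1 * mon \<mu>) ` ?R (n - p)" and ?R2 = "(\<lambda>\<mu>. g1 * mon \<mu>) ` ?R (n - q)"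
    let ?T = "B \<union> (?R1 \<union> ?R2)"
    let ?Z = "pm.span ?T"
    have Z: "pm.subspace ?Z" by (rule pm.subspace_span)
    have "pm.span B \<subseteq> ?Z" by (rule pm.span_mono) simp
    then have IZ: "Init n \<subseteq> ?Z" using B(3) by simp
    have 1: "f1 * mon \<mu> \<in> ?Z" if "tdeg \<mu> = n - p" for \<mu>
    proof (rule fc[OF Z IZ _ p(1) _ _ that])
      show "f1 * mon \<mu> \<in> ?Z" if "\<mu> \<in> ?R (n - p)" for \<mu> by (rule pm.span_base) (use that in blast)
    qed (use n p(2) in auto)
    have 2: "g1 * mon \<mu> \<in> ?Z" if "tdeg \<mu> = n - q" for \<mu>
    proof (rule fc[OF Z IZ _ q(1) _ _ that])
      show "g1 * mon \<mu> \<in> ?Z" if "\<mu> \<in> ?R (n - q)" for \<mu> by (rule pm.span_base) (use that in blast)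
    qed (use n q(2) in auto)
    have "{f1 * u + g1 * v | u v. u \<in> hom (n - p) \<and> v \<in> hom (n - q)} \<subseteq> ?Z"
    proof
      fix x assume "x \<in> {f1 * u + g1 * v | u v. u \<in> hom (n - p) \<and> v \<in> hom (n - q)}"
      then obtain u v where x: "x = f1 * u + g1 * v" "u \<in> hom (n - p)" "v \<in> hom (n - q)" by blast
      have "f1 * u \<in> ?Z"
        by (rule mult_mem_subspace[OF Z 1]) (use x(2) in \<open>simp add: hom_def pure_def wt_def\<close>)
      moreover have "g1 * v \<in> ?Z"
        by (rule mult_mem_subspace[OF Z 2]) (use x(3) in \<open>simp add: hom_def pure_def wt_def\<close>)
      ultimately show "x \<in> ?Z" unfolding x(1) by (rule pm.span_add)
    qed
    then have "pm.dim {f1 * u + g1 * v | u v. u \<in> hom (n - p) \<and> v \<in> hom (n - q)} \<le> card ?T"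
      by (rule pm.dim_le_card) (use cB R in simp)
    also have "card ?T \<le> card B + (card ?R1 + card ?R2)"
      by (rule order_trans[OF card_Un_le add_left_mono[OF card_Un_le]])
    also have "card ?R1 \<le> M" using card_image_le[OF R(1)] R(2) order_trans by blast
    also have "card ?R2 \<le> M" using card_image_le[OF R(1)] R(2) order_trans by blast
    finally show ?thesis using cB(2) by simp
  qed
  then show ?thesis by blast
qed

text \<open>Passing to lowest components preserves the dimensions of the graded parts of \<open>(f, g)\<close>, while
  \<open>(f1, g1)\<close> exceeds the ideal of lowest components by a bounded amount only; comparing the two
  Hilbert functions gives \<open>deg f deg g \<le> deg f1 deg g1\<close>.\<close>

lemma common_factor_degree_zero:
  assumes eps: "eps h \<noteq> 0"
  shows "h \<in> hom 0"
proof -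
  obtain \<delta> p q where hom: "h \<in> hom \<delta>" "f1 \<in> hom p" "g1 \<in> hom q" and d: "\<delta> + p = d1" "\<delta> + q = d2"
    by (rule factors_hom)
  have pq: "p \<le> d1" "q \<le> d2" using d by simp_all
  from dim_initial_le[OF eps hom(2) pq(1) hom(3) pq(2)]
  obtain K where K: "\<forall>n\<ge>d1 + d2.
    pm.dim {f1 * u + g1 * v | u v. u \<in> hom (n - p) \<and> v \<in> hom (n - q)} \<le> pm.dim (In n) + K" by (elim exE)
  have ne: "f1 \<noteq> 0" "g1 \<noteq> 0" using nz by auto
  have "part P (0 :: 'k poly4) = 0" for P by (rule part_eq_0) simp
  then have nef: "f \<noteq> 0" "g \<noteq> 0" using nz f(2) g(2) by auto
  have "d1 * d2 \<le> p * q"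
  proof (rule bounded_defect_imp_le)
    fix n assume n: "d1 + d2 \<le> n" "p + q \<le> n"
    show "card (mons (n - p)) + card (mons (n - q)) + card (mons (n - (d1 + d2))) \<le>
        card (mons (n - d1)) + card (mons (n - d2)) + card (mons (n - (p + q))) + K"
    proof -
      have "card (mons (n - p)) + card (mons (n - q)) \<le>
          pm.dim {f1 * u + g1 * v | u v. u \<in> hom (n - p) \<and> v \<in> hom (n - q)} + card (mons (n - (p + q)))"
        by (rule dim_two_generated_ge[OF hom(2) ne(1) hom(3) ne(2) n(2)]) (rule cop)
      then show ?thesis
        using K[rule_format, OF n(1)] dim_two_generated_le[OF f_hom nef(1) g_hom nef(2) n(1)] In_eq[OF n(1)]
        by simp
    qed
  qed
  \<comment> \<open>Expanding the product of \<open>\<delta> + p\<close> and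
    \<open>\<delta> + q\<close> leaves exactly this excess over \<open>p * q\<close>.\<close>
  then have "\<delta> * (\<delta> + p + q) \<le> 0" unfolding d[symmetric] by (simp add: algebra_simps)
  then have "\<delta> = 0" by auto
  then show ?thesis using hom(1) by simp
qed

text \<open>Otherwise \<open>h\<close> is a nonzero constant, so its powers can be divided out of
  \<open>power_multiple_initial\<close>. Then the equations of the curve are nilpotent modulo the
  two bihomogeneous components, contrary to \<open>no_bihomogeneous_pair\<close>.\<close>

lemma eps_common_factor: "eps h = 0"
proof (rule ccontr)
  assume "eps h \<noteq> 0"
  then have h0: "h \<in> hom 0" by (rule common_factor_degree_zero)
  have "k = 0" if "k \<in> keys h" for k
    using that h0 by (cases k) (auto simp: hom_def pure_def wt_def zero_prod_def)
  then have "h = part (\<lambda>k. k = 0) h" using part_eq_self[of h "\<lambda>k. k = 0"] by simp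
  also have "\<dots> = coef (lookup h 0)"
    by (rule poly_mapping_eqI) (simp add: lookup_part lookup_single when_def)
  finally obtain r where hr: "h = coef r" by blast
  have "r \<noteq> 0" using hr nz by auto
  have mem: "\<exists>k. e ^ k \<in> ideal_gen {h * f1, h * g1}" if e: "pure w1 s e" "e \<in> hom n" "eps e = 0" for e s n
  proof -
    obtain k where k: "e ^ k \<in> ideal_gen {f, g}" using nilpotent[OF e] by blast
    obtain s' where "pure \<omega> s' e" using pure_\<omega>_ex[OF e(1)] by blast
    then have "pure \<omega> (int k * s') (e ^ k)" by (rule pure_power[OF w])
    from power_multiple_initial[OF k this] obtain l where l: "h ^ l * e ^ k \<in> ideal_gen {h * f1, h * g1}" by blast
    have "coef (inverse r) * h = 1" using \<open>r \<noteq> 0\<close> by (simp add: hr mult_single)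
    then have "coef (inverse r) ^ l * h ^ l = 1" by (metis power_mult_distrib power_one)
    moreover have "coef (inverse r) ^ l * (h ^ l * e ^ k) \<in> ideal_gen {h * f1, h * g1}"
      by (rule ideal_gen_pair_mult[OF l])
    ultimately have "e ^ k \<in> ideal_gen {h * f1, h * g1}" by (simp flip: mult.assoc)
    then show ?thesis by blast
  qed
  obtain n1 where n1: "ex ^ n1 \<in> ideal_gen {h * f1, h * g1}" using mem[OF ex_pure] by blast
  obtain n2 where n2: "ey ^ n2 \<in> ideal_gen {h * f1, h * g1}" using mem[OF ey_pure] by blast
  have "vX * vY - vW * vZ \<in> (hom 2 :: 'k poly4 set)" unfolding mult_single by (intro hom_diff) (simp_all add: hom_def wt_def pure_single)
  moreover have "pure w1 4 (vX * vY - vW * vZ :: 'k poly4)" unfolding mult_single by (intro pure_diff) (simp_all add: w1_def pure_single)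
  moreover have "eps (vX * vY - vW * vZ :: 'k poly4) = 0" by simp
  ultimately obtain n where n: "(vX * vY - vW * vZ) ^ n \<in> ideal_gen {h * f1, h * g1}" using mem by blast
  obtain s where s: "pure w1 s (h * f1)" using pure_w1_ex[OF initial_pure(1)] by blast
  obtain t where t: "pure w1 t (h * g1)" using pure_w1_ex[OF initial_pure(2)] by blast
  show False
    using no_bihomogeneous_pair[OF initial_hom(1) s d_pos(1) initial_hom(2) t d_pos(2) n1 n2] n by blast
qed

lemma common_factor_not_unit: "\<not> h dvd 1"
proof
  assume "h dvd 1"
  then obtain c where "1 = h * c" by (rule dvdE)
  then have "eps (h * c) = eps (1 :: 'k poly4)" by simp
  then show False by (simp add: eps_common_factor)
qed

text \<open>As \<open>eps h = 0\<close>, some power of \<open>h\<close> lies in (f, g); it is pure,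
  so a further multiple by a power of \<open>h\<close> lies in the ideal of the lowest
  components.\<close>

lemma height_initial_minimal_prime:
  assumes "minimal_prime_over (ideal_gen {h * f1, h * g1}) P"
  shows "height_eq P 1"
proof -
  obtain \<delta> where "h \<in> hom \<delta>" by (rule factors_hom)
  obtain s where s: "pure \<omega> s h" by (rule factors_pure)
  obtain s' where "pure w1 s' h" using pure_w1_ex[OF s] by blast
  then obtain k where k: "h ^ k \<in> ideal_gen {f, g}"
    using nilpotent[OF _ \<open>h \<in> hom \<delta>\<close> eps_common_factor] by blast
  from power_multiple_initial[OF k pure_power[OF w s]]
  obtain n where "h ^ n * h ^ k \<in> ideal_gen {h * f1, h * g1}" by blast
  then have "h ^ (n + k) \<in> ideal_gen {h * f1, h * g1}" by (simp add: power_add)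
  moreover have "h \<noteq> 0" using nz by auto
  ultimately show ?thesis using height_minimal_prime_common_factor[OF assms] by blast
qed

end

section \<open>Lowest and highest components of a pair cutting out the curve\<close>

lemma lowest_component_conclusion:
  fixes f g :: "'k::field_char_0 poly4"
  assumes f: "f \<in> macaulay_ideal" "homogeneous4 f d1" "low \<omega> i f" "part (\<lambda>m. \<omega> m = i) f \<noteq> 0"
    and g: "g \<in> macaulay_ideal" "homogeneous4 g d2" "low \<omega> j g" "part (\<lambda>m. \<omega> m = j) g \<noteq> 0"
    and rad: "radical (ideal_gen {f, g}) = macaulay_ideal"
    and \<omega>: "\<omega> = w1 \<or> \<omega> = (\<lambda>m. - w1 m)"
    and F: "F = part (\<lambda>m. \<omega> m = i) f" and G: "G = part (\<lambda>m. \<omega> m = j) g"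
  shows "(\<forall>P. minimal_prime_over (ideal_gen {F, G}) P \<longrightarrow> height_eq P 1) \<and>
    (\<exists>h. \<not> h dvd 1 \<and> h dvd F \<and> h dvd G)"
proof -
  have hom: "p \<in> hom d" if "homogeneous4 p d" for p :: "'k poly4" and d
    using that by (simp add: homogeneous4_def hom_def pure_def wt_def)
  have pure_w2: "pure w2 (4 * int n - s) p" if p: "pure w1 s p" "p \<in> hom n" for p :: "'k poly4" and n s
    unfolding pure_def
  proof
    fix m assume "m \<in> keys p"
    then have "w1 m = s" "wt m = int n" using p by (simp_all add: pure_def hom_def)
    then show "w2 m = 4 * int n - s" using w1_w2[of m] by linarith
  qed
  \<comment> \<open>A form of degree 0 is constant, and a constant vanishing on the curve is
    0.\<close>
  have pos: "0 < d" if p: "p \<in> macaulay_ideal" "homogeneous4 p d" "p \<noteq> 0" for p :: "'k poly4" and d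
  proof (rule ccontr)
    assume "\<not> 0 < d"
    have zero: "m = 0" if "m \<in> keys p" for m
      using p(2) that \<open>\<not> 0 < d\<close> by (cases m) (auto simp: homogeneous4_def zero_prod_def)
    then have "pure w1 0 p" "pure w2 0 p" by (auto simp: pure_def w1_def w2_def zero_prod_def)
    then have "eps p = 0" using p(1) bihomogeneous_in_macaulay_ideal_iff by blast
    moreover have "keys p \<subseteq> {0}" using zero by blast
    then have "eps p = lookup p 0" using eps_superset[of "{0}" p] by simp
    ultimately have "p = 0" using zero by (intro poly_mapping_eqI) (metis in_keys_iff lookup_zero)
    with p(3) show False by simp
  qed
  have "part P (0 :: 'k poly4) = 0" for P by (rule part_eq_0) simp
  then have ne: "f \<noteq> 0" "g \<noteq> 0" using f(4) g(4) by auto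
  obtain h f1 g1 where fg: "F = h * f1" "G = h * g1" and cop: "\<And>u v. f1 * u = g1 * v \<Longrightarrow> g1 dvd u"
    by (rule poly4_gcd[of F G]) (use f(4) F in auto)
  interpret degeneration f g h f1 g1 \<omega> i j d1 d2
  proof
    show "\<exists>k. e ^ k \<in> ideal_gen {f, g}" if e: "pure w1 s e" "e \<in> hom n" "eps e = 0" for e s n
    proof -
      have "e \<in> macaulay_ideal" using bihomogeneous_in_macaulay_ideal_iff[OF e(1) pure_w2[OF e(1,2)]] e(3) by simp
      then have "e \<in> radical (ideal_gen {f, g})" using rad by simp
      then show ?thesis by (simp add: radical_def)
    qed
    show "0 < d1" "0 < d2" by (rule pos[OF f(1,2) ne(1)], rule pos[OF g(1,2) ne(2)])
    show "g1 dvd u" if "f1 * u = g1 * v" for u v using that by (rule cop)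
  qed (use \<omega> hom f g fg F G in auto)
  show ?thesis unfolding fg
    using height_initial_minimal_prime common_factor_not_unit by (auto intro!: exI[of _ h])
qed

lemma comp_min_lowest:
  assumes "f \<noteq> 0"
  obtains i where "low w1 i f" "comp_min f = part (\<lambda>m. w1 m = i) f" "comp_min f \<noteq> 0"
proof
  let ?i = "Min (bideg1 ` keys f)"
  show "low w1 (int ?i) f" by (simp add: low_def w1_def)
  show eq: "comp_min f = part (\<lambda>m. w1 m = int ?i) f"
    by (rule poly_mapping_eqI) (simp add: comp_min_def bicomp.rep_eq lookup_part w1_def)
  have "?i \<in> bideg1 ` keys f" using assms by (intro Min_in) auto
  then obtain m where "m \<in> keys f" "bideg1 m = ?i" by force
  then have "m \<in> keys (comp_min f)" by (simp add: eq keys_part w1_def)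
  then show "comp_min f \<noteq> 0" by auto
qed

lemma comp_max_lowest:
  assumes "f \<noteq> 0"
  obtains i where "low (\<lambda>m. - w1 m) i f" "comp_max f = part (\<lambda>m. - w1 m = i) f" "comp_max f \<noteq> 0"
proof
  let ?i = "Max (bideg1 ` keys f)"
  show "low (\<lambda>m. - w1 m) (- int ?i) f" by (simp add: low_def w1_def)
  show eq: "comp_max f = part (\<lambda>m. - w1 m = - int ?i) f"
    by (rule poly_mapping_eqI) (simp add: comp_max_def bicomp.rep_eq lookup_part w1_def)
  have "?i \<in> bideg1 ` keys f" using assms by (intro Max_in) auto
  then obtain m where "m \<in> keys f" "bideg1 m = ?i" by force
  then have "m \<in> keys (comp_max f)" by (simp add: eq keys_part w1_def)
  then show "comp_max f \<noteq> 0" by auto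
qed

theorem theorem1:
  fixes f g :: "'k::field_char_0 poly4" and d1 d2 :: nat
  assumes "alg_closed TYPE('k)"
    and "f \<in> macaulay_ideal" and "g \<in> macaulay_ideal"
    and "homogeneous4 f d1" and "homogeneous4 g d2"
    and "f \<noteq> 0" and "g \<noteq> 0"
    and "radical (ideal_gen {f, g}) = macaulay_ideal"
  shows "(\<forall>P. minimal_prime_over (ideal_gen {comp_min f, comp_min g}) P \<longrightarrow> height_eq P 1)
       \<and> (\<forall>P. minimal_prime_over (ideal_gen {comp_max f, comp_max g}) P \<longrightarrow> height_eq P 1)
       \<and> (\<exists>h. \<not> h dvd 1 \<and> h dvd comp_min f \<and> h dvd comp_min g)
       \<and> (\<exists>h. \<not> h dvd 1 \<and> h dvd comp_max f \<and> h dvd comp_max g)"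
proof -
  obtain i where i: "low w1 i f" "comp_min f = part (\<lambda>m. w1 m = i) f" "comp_min f \<noteq> 0"
    by (rule comp_min_lowest[OF assms(6)])
  obtain j where j: "low w1 j g" "comp_min g = part (\<lambda>m. w1 m = j) g" "comp_min g \<noteq> 0"
    by (rule comp_min_lowest[OF assms(7)])
  obtain i' where i': "low (\<lambda>m. - w1 m) i' f" "comp_max f = part (\<lambda>m. - w1 m = i') f" "comp_max f \<noteq> 0"
    by (rule comp_max_lowest[OF assms(6)])
  obtain j' where j': "low (\<lambda>m. - w1 m) j' g" "comp_max g = part (\<lambda>m. - w1 m = j') g" "comp_max g \<noteq> 0"
    by (rule comp_max_lowest[OF assms(7)])
  have min: "(\<forall>P. minimal_prime_over (ideal_gen {comp_min f, comp_min g}) P \<longrightarrow> height_eq P 1) \<and>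
      (\<exists>h. \<not> h dvd 1 \<and> h dvd comp_min f \<and> h dvd comp_min g)"
    using i j by (intro lowest_component_conclusion[OF assms(2,4) i(1) _ assms(3,5) j(1) _ assms(8) _ i(2) j(2)]) auto
  have max: "(\<forall>P. minimal_prime_over (ideal_gen {comp_max f, comp_max g}) P \<longrightarrow> height_eq P 1) \<and>
      (\<exists>h. \<not> h dvd 1 \<and> h dvd comp_max f \<and> h dvd comp_max g)"
    using i' j' by (intro lowest_component_conclusion[OF assms(2,4) i'(1) _ assms(3,5) j'(1) _ assms(8) _ i'(2) j'(2)]) auto
  from min max show ?thesis by blast
qed

end
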